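(* Let $q\colon E\to M$ be a tangent display map in a tangent category $(\mathbb X,\mathbb T)$. (a) For a morphism $R\colon TE\to Vq$ the following are equivalent: (1) $R$ is a full vertical connection on $q$ and $q$ is a submersion; (2) $R$ is the vertical component of an Ehresmann connection $(R,H)$ on $q$. (b) For a morphism $H\colon Fq\to TE$ the following are equivalent: (1) $H$ is a full horizontal connection on $q$ and $q$ is a submersion; (2) $H$ is the horizontal component of an Ehresmann connection $(R,H)$ on $q$.
   Context: Composition is diagrammatic: $fg$ is $f$ followed by $g$; $\langle f,g\rangle$ denotes pairing into a (fibred) product, with projections $\pi_1,\pi_2$. A tangent category $(\mathbb X,\mathbb T)$ is a category $\mathbb X$ with an endofunctor $T$ and natural transformations $p_M\colon TM\to M$, $z_M\colon M\to TM$, $s_M\colon T_2M\to TM$, $l_M\colon TM\to T^2M$, $c_M\colon T^2M\to T^2M$, where the $n$-fold pullback $T_nM$ of $p_M$ along itself exists and is preserved by all $T^m$, such that: $(p_M,z_M,s_M)$ is an additive bundle (a commutative monoid in the category over $M$); $(z_M,l_M)\colon p_M\to Tp_M$ and $(\mathrm{id}_{TM},c_M)\colon Tp_M\to p_{TM}$ are additive bundle morphisms (commutative squares preserving zero and sum); $c_Mc_M=\mathrm{id}$, $l_Mc_M=l_M$, $l_M\,Tl_M=l_M\,l_{TM}$, $Tc_M\,c_{TM}\,Tc_M=c_{TM}\,Tc_M\,c_{TM}$, $l_{TM}\,Tc_M\,c_{TM}=c_M\,Tl_M$; and, with $\xi_M=\langle\pi_1l_M,\pi_2z_{TM}\rangle\,Ts_M\colon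 T_2M\to T^2M$, the square $\xi_M\,Tp_M=\pi_1p_Mz_M$ is a tangent pullback. A tangent pullback is a pullback preserved by $T^m$ for all $m\ge0$. A tangent display map is a morphism $q\colon E\to M$ such that for all $n\ge0$ and all $f\colon N\to T^nM$ the pullback of $T^nq$ along $f$ exists and is a tangent pullback. A differential bundle $\mathbf q\colon E\to M$ consists of $q\colon E\to M$, $z_q\colon M\to E$, $s_q\colon E_2\to E$, $l_q\colon E\to TE$ ($E_n$ the $n$-fold pullback of $q$ along itself, required to exist and be preserved by all $T^m$) such that $(q,z_q,s_q)$ is an additive bundle, $(z_M,l_q)\colon q\to Tq$ and $(z_q,l_q)\colon q\to p_E$ are additive bundle morphisms, $l_ql_E=l_q\,Tl_q$, and with $\xi_q=\langle\pi_1l_q,\pi_2z_E\rangle\,Ts_q\colon E_2\to TE$ the square $\xi_q\,Tq=\pi_1qz_M$ is a tangent pullback. Convention: all differential bundles are assumed display, i.e. $q$ is a tangent display map. A morphism $(f,g)\colon\mathbf q\to\mathbf q'$ (with $qf=gq'$) is linear if $g\,l_{q'}=l_q\,Tg$. $\mathsf{DB}(E)$ is the category of differential bundles over $E$ and linear morphisms over $\mathrm{id}_E$; it has finite biproducts, with zero object the trivial bundle $\mathbf 0_E=(\mathrm{id}_E,\mathrm{id}_E,\mathrm{id}_E,z_E)$. $\mathbf p_E=(p_E,z_E,s_E,l_E)$ is the tangent bundle. For a tangent display map $q\colon E\to M$: the vertical bundle $\mathbf q^V\colon Vq\to E$ is given by the tangent pullback $Vq$ of $Tq$ along $z_M$,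 with projections $\iota_q\colon Vq\to TE$ and $T^Vq\colon Vq\to M$; $q^V=\iota_qp_E$, and its zero $z_q^V$, sum $s^V_q$, lift $l_q^V$ are determined by $z_q^V\iota_q=z_E$, $s_q^V\iota_q=(\iota_q\times\iota_q)s_E$, $l_q^V\,T\iota_q=\iota_ql_E$. The Finsler bundle $\mathbf q^F\colon Fq\to E$ is given by the tangent pullback $Fq$ of $q$ along $p_M$, with projections $q^F\colon Fq\to E$ and $T^Fq\colon Fq\to TM$, its zero $z_q^F$, sum $s_q^F$, lift $l_q^F$ determined by $z_q^Fq^F=\mathrm{id}_E$, $z_q^F\,T^Fq=qz_M$; $s_q^Fq^F=\pi_1q^F$, $s_q^F\,T^Fq=(T^Fq\times T^Fq)s_M$; $l_q^F\,Tq^F=q^Fz_E$, $l_q^F\,T(T^Fq)=T^Fq\,l_M$. The horizontal descent $\pi_q\colon TE\to Fq$ is the unique morphism with $\pi_qq^F=p_E$ and $\pi_q\,T^Fq=Tq$. The square $\iota_q\pi_q=q^Vz_q^F$ (with corners $\mathbf q^V,\mathbf p_E,\mathbf 0_E,\mathbf q^F$) is commutative in $\mathsf{DB}(E)$; $q$ is a submersion if it is a pushout in $\mathsf{DB}(E)$. A vertical connection on $q$ is $R\colon TE\to Vq$ with $\iota_qR=\mathrm{id}_{Vq}$ and $R\colon\mathbf p_E\to\mathbf q^V$ linear over $E$ ($Rq^V=p_E$, $Rl_q^V=l_E\,TR$). A horizontal connection on $q$ is $H\colon Fq\to TE$ with $H\pi_q=\mathrm{id}_{Fq}$ and $H\colon\mathbf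 q^F\to\mathbf p_E$ linear over $E$ ($Hp_E=q^F$, $Hl_E=l_q^F\,TH$). An Ehresmann connection on $q$ is a pair $(R,H)$ of a vertical connection $R$ (its vertical component) and a horizontal connection $H$ (its horizontal component) with $HR=q^Fz_q^V$ and $\langle R\iota_q,\pi_qH\rangle s_E=\mathrm{id}_{TE}$. A vertical connection $R$ on $q$ is full if the commutative square $R\,T^Vq=Tq\,p_M$ (exhibiting $TE$ over $Vq\to M\leftarrow TM$ via $T^Vq$ and $p_M$) is a tangent pullback in $(\mathbb X,\mathbb T)$. A horizontal connection $H$ on $q$ is full if the square $z_q^V\iota_q=z_q^FH$ (with corners $\mathbf 0_E,\mathbf q^V,\mathbf q^F,\mathbf p_E$) is a pushout in $\mathsf{DB}(E)$. *)

theory Defs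
  imports Main
begin

section \<open>Categories\<close>

text \<open>Composition is diagrammatic: \<open>f \<cdot> g\<close> is \<open>f\<close> followed by \<open>g\<close>.\<close>

record ('o, 'm) cat =
  Ob :: "'o set"
  Mor :: "'m set"
  Dom :: "'m \<Rightarrow> 'o"
  Cod :: "'m \<Rightarrow> 'o"
  Id :: "'o \<Rightarrow> 'm"
  Comp :: "'m \<Rightarrow> 'm \<Rightarrow> 'm"  (infixl "\<cdot>\<index>" 70)

definition Hom :: "('o, 'm, 'r) cat_scheme \<Rightarrow> 'o \<Rightarrow> 'o \<Rightarrow> 'm set" where
  "Hom X A B = {f \<in> Mor X. Dom X f = A \<and> Cod X f = B}"

locale category =
  fixes X :: "('o, 'm, 'r) cat_scheme" (structure)
  assumes Dom_Ob: "f \<in> Mor X \<Longrightarrow> Dom X f \<in> Ob X"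
    and Cod_Ob: "f \<in> Mor X \<Longrightarrow> Cod X f \<in> Ob X"
    and Id_Hom: "A \<in> Ob X \<Longrightarrow> Id X A \<in> Hom X A A"
    and Comp_Hom: "f \<in> Hom X A B \<Longrightarrow> g \<in> Hom X B C \<Longrightarrow> f \<cdot> g \<in> Hom X A C"
    and Id_left: "f \<in> Hom X A B \<Longrightarrow> Id X A \<cdot> f = f"
    and Id_right: "f \<in> Hom X A B \<Longrightarrow> f \<cdot> Id X B = f"
    and Comp_assoc: "f \<in> Hom X A B \<Longrightarrow> g \<in> Hom X B C \<Longrightarrow> h \<in> Hom X C D
      \<Longrightarrow> (f \<cdot> g) \<cdot> h = f \<cdot> (g \<cdot> h)"

text \<open>\<open>pullback X f g a b\<close>: the square \<open>a f = b g\<close> is a pullback of \<open>f\<close> along \<open>g\<close>.\<close>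

definition pullback :: "('o, 'm, 'r) cat_scheme \<Rightarrow> 'm \<Rightarrow> 'm \<Rightarrow> 'm \<Rightarrow> 'm \<Rightarrow> bool" where
  "pullback X f g a b \<longleftrightarrow>
     f \<in> Mor X \<and> g \<in> Mor X \<and> Cod X f = Cod X g \<and>
     a \<in> Hom X (Dom X a) (Dom X f) \<and> b \<in> Hom X (Dom X a) (Dom X g) \<and> a \<cdot> f = b \<cdot> g \<and>
     (\<forall>A. \<forall>x \<in> Hom X A (Dom X f). \<forall>y \<in> Hom X A (Dom X g). x \<cdot> f = y \<cdot> g \<longrightarrow>
        (\<exists>!h. h \<in> Hom X A (Dom X a) \<and> h \<cdot> a = x \<and> h \<cdot> b = y))"
  for X (structure)

text \<open>\<open>pushout X f g a b\<close>: the square \<open>f a = g b\<close> is a pushout of \<open>f\<close> and \<open>g\<close>.\<close>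

definition pushout :: "('o, 'm, 'r) cat_scheme \<Rightarrow> 'm \<Rightarrow> 'm \<Rightarrow> 'm \<Rightarrow> 'm \<Rightarrow> bool" where
  "pushout X f g a b \<longleftrightarrow>
     f \<in> Mor X \<and> g \<in> Mor X \<and> Dom X f = Dom X g \<and>
     a \<in> Hom X (Cod X f) (Cod X a) \<and> b \<in> Hom X (Cod X g) (Cod X a) \<and> f \<cdot> a = g \<cdot> b \<and>
     (\<forall>A. \<forall>x \<in> Hom X (Cod X f) A. \<forall>y \<in> Hom X (Cod X g) A. f \<cdot> x = g \<cdot> y \<longrightarrow>
        (\<exists>!h. h \<in> Hom X (Cod X a) A \<and> a \<cdot> h = x \<and> b \<cdot> h = y))"
  for X (structure)

text \<open>\<open>fibre_power X n q r \<pi>\<close>: the \<open>n\<close>-fold pullback of \<open>q\<close> along itself, with structure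
  morphism \<open>r\<close> to the base (the only datum when \<open>n = 0\<close>) and projections \<open>\<pi> 0, \<dots>, \<pi> (n - 1)\<close>.\<close>

definition fibre_power ::
    "('o, 'm, 'r) cat_scheme \<Rightarrow> nat \<Rightarrow> 'm \<Rightarrow> 'm \<Rightarrow> (nat \<Rightarrow> 'm) \<Rightarrow> bool" where
  "fibre_power X n q r \<pi> \<longleftrightarrow>
     q \<in> Mor X \<and> r \<in> Hom X (Dom X r) (Cod X q) \<and>
     (\<forall>i<n. \<pi> i \<in> Hom X (Dom X r) (Dom X q) \<and> \<pi> i \<cdot> q = r) \<and>
     (\<forall>A. \<forall>y \<in> Hom X A (Cod X q). \<forall>\<phi>. (\<forall>i<n. \<phi> i \<in> Hom X A (Dom X q) \<and> \<phi> i \<cdot> q = y) \<longrightarrow>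
        (\<exists>!h. h \<in> Hom X A (Dom X r) \<and> h \<cdot> r = y \<and> (\<forall>i<n. h \<cdot> \<pi> i = \<phi> i)))"
  for X (structure)

text \<open>The pairing of \<open>x\<close> and \<open>y\<close> into a pullback whose pair of projections is \<open>P\<close>.\<close>

definition pair :: "('o, 'm, 'r) cat_scheme \<Rightarrow> 'm \<times> 'm \<Rightarrow> 'm \<Rightarrow> 'm \<Rightarrow> 'm" where
  "pair X P x y = (THE h. h \<in> Hom X (Dom X x) (Dom X (fst P)) \<and> h \<cdot> fst P = x \<and> h \<cdot> snd P = y)"
  for X (structure)

section \<open>Tangent structures\<close>

text \<open>The component \<open>pb\<close> is an arbitrary choice of pullbacks: \<open>pb f g\<close> is the pair of projections
  of the chosen pullback of \<open>f\<close> along \<open>g\<close>, whenever there is one. It names the objects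
  \<open>T\<^sub>2M\<close>, \<open>E\<^sub>2\<close>, \<open>Vq\<close> and \<open>Fq\<close>; in particular \<open>tsum X M\<close> is defined on the chosen pullback of
  \<open>tproj X M\<close> along itself.\<close>

record ('o, 'm) tangent_cat = "('o, 'm) cat" +
  TOb :: "'o \<Rightarrow> 'o"
  TMor :: "'m \<Rightarrow> 'm"
  tproj :: "'o \<Rightarrow> 'm"
  tzero :: "'o \<Rightarrow> 'm"
  tsum :: "'o \<Rightarrow> 'm"
  tlift :: "'o \<Rightarrow> 'm"
  tflip :: "'o \<Rightarrow> 'm"
  pb :: "'m \<Rightarrow> 'm \<Rightarrow> 'm \<times> 'm"

abbreviation TPair :: "('o, 'm, 'r) tangent_cat_scheme \<Rightarrow> 'm \<times> 'm \<Rightarrow> 'm \<times> 'm" where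
  "TPair X \<equiv> map_prod (TMor X) (TMor X)"

definition tangent_pullback ::
    "('o, 'm, 'r) tangent_cat_scheme \<Rightarrow> 'm \<Rightarrow> 'm \<Rightarrow> 'm \<Rightarrow> 'm \<Rightarrow> bool" where
  "tangent_pullback X f g a b \<longleftrightarrow>
     (\<forall>m. pullback X ((TMor X ^^ m) f) ((TMor X ^^ m) g) ((TMor X ^^ m) a) ((TMor X ^^ m) b))"

definition has_fibre_powers :: "('o, 'm, 'r) tangent_cat_scheme \<Rightarrow> 'm \<Rightarrow> bool" where
  "has_fibre_powers X q \<longleftrightarrow>
     (\<forall>n. \<exists>r \<pi>. \<forall>m. fibre_power X n ((TMor X ^^ m) q) ((TMor X ^^ m) r) (\<lambda>i. (TMor X ^^ m) (\<pi> i)))"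

text \<open>Additive bundles carry the pair \<open>P\<close> of projections of the object \<open>E\<^sub>2\<close> on which the sum \<open>s\<close>
  is defined, since for \<open>Tq\<close> this object is \<open>T(E\<^sub>2)\<close> and not the chosen pullback of \<open>Tq\<close> along itself.\<close>

definition additive_bundle ::
    "('o, 'm, 'r) cat_scheme \<Rightarrow> 'm \<Rightarrow> 'm \<times> 'm \<Rightarrow> 'm \<Rightarrow> 'm \<Rightarrow> bool" where
  "additive_bundle X q P z s \<longleftrightarrow>
     q \<in> Mor X \<and> pullback X q q (fst P) (snd P) \<and>
     z \<in> Hom X (Cod X q) (Dom X q) \<and> z \<cdot> q = Id X (Cod X q) \<and>
     s \<in> Hom X (Dom X (fst P)) (Dom X q) \<and> s \<cdot> q = fst P \<cdot> q \<and>
     pair X P (q \<cdot> z) (Id X (Dom X q)) \<cdot> s = Id X (Dom X q) \<and>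
     pair X P (Id X (Dom X q)) (q \<cdot> z) \<cdot> s = Id X (Dom X q) \<and>
     pair X P (snd P) (fst P) \<cdot> s = s \<and>
     (\<exists>r \<pi>. fibre_power X 3 q r \<pi>) \<and>
     (\<forall>r \<pi>. fibre_power X 3 q r \<pi> \<longrightarrow>
        pair X P (pair X P (\<pi> 0) (\<pi> 1) \<cdot> s) (\<pi> 2) \<cdot> s = pair X P (\<pi> 0) (pair X P (\<pi> 1) (\<pi> 2) \<cdot> s) \<cdot> s)"
  for X (structure)

text \<open>\<open>additive_morphism X f g q P z s q' P' z' s'\<close>: \<open>f\<close> is the morphism of bases and \<open>g\<close> the
  morphism of total objects.\<close>

definition additive_morphism ::
    "('o, 'm, 'r) cat_scheme \<Rightarrow> 'm \<Rightarrow> 'm \<Rightarrow> 'm \<Rightarrow> 'm \<times> 'm \<Rightarrow> 'm \<Rightarrow> 'm \<Rightarrow> 'm \<Rightarrow> 'm \<times> 'm \<Rightarrow> 'm \<Rightarrow> 'm \<Rightarrow> bool" where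
  "additive_morphism X f g q P z s q' P' z' s' \<longleftrightarrow>
     f \<in> Hom X (Cod X q) (Cod X q') \<and> g \<in> Hom X (Dom X q) (Dom X q') \<and>
     q \<cdot> f = g \<cdot> q' \<and> z \<cdot> g = f \<cdot> z' \<and>
     s \<cdot> g = pair X P' (fst P \<cdot> g) (snd P \<cdot> g) \<cdot> s'"
  for X (structure)

abbreviation T2 :: "('o, 'm, 'r) tangent_cat_scheme \<Rightarrow> 'o \<Rightarrow> 'm \<times> 'm" where
  "T2 X M \<equiv> pb X (tproj X M) (tproj X M)"

text \<open>For a bundle with total object \<open>E\<close>, projections \<open>P\<close> of \<open>E\<^sub>2\<close>, sum \<open>s\<close> and lift \<open>l\<close>, this is
  \<open>\<xi> = \<langle>\<pi>\<^sub>1 l, \<pi>\<^sub>2 z\<^sub>E\<rangle> Ts\<close>; the pairing is into \<open>T(E\<^sub>2)\<close>.\<close>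

definition xi :: "('o, 'm, 'r) tangent_cat_scheme \<Rightarrow> 'o \<Rightarrow> 'm \<times> 'm \<Rightarrow> 'm \<Rightarrow> 'm \<Rightarrow> 'm" where
  "xi X E P s l = pair X (TPair X P) (fst P \<cdot> l) (snd P \<cdot> tzero X E) \<cdot> TMor X s"
  for X (structure)

locale tangent_category = category X for X :: "('o, 'm, 'r) tangent_cat_scheme" (structure) +
  assumes pb_choice: "\<exists>a b. pullback X f g a b \<Longrightarrow> pullback X f g (fst (pb X f g)) (snd (pb X f g))"
    \<comment> \<open>the endofunctor\<close>
    and TOb_Ob: "M \<in> Ob X \<Longrightarrow> TOb X M \<in> Ob X"
    and TMor_Hom: "f \<in> Hom X M N \<Longrightarrow> TMor X f \<in> Hom X (TOb X M) (TOb X N)"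
    and TMor_Id: "M \<in> Ob X \<Longrightarrow> TMor X (Id X M) = Id X (TOb X M)"
    and TMor_Comp: "f \<in> Hom X M N \<Longrightarrow> g \<in> Hom X N K \<Longrightarrow> TMor X (f \<cdot> g) = TMor X f \<cdot> TMor X g"
    \<comment> \<open>the natural transformations\<close>
    and tproj_Hom: "M \<in> Ob X \<Longrightarrow> tproj X M \<in> Hom X (TOb X M) M"
    and tzero_Hom: "M \<in> Ob X \<Longrightarrow> tzero X M \<in> Hom X M (TOb X M)"
    and tsum_Hom: "M \<in> Ob X \<Longrightarrow> tsum X M \<in> Hom X (Dom X (fst (T2 X M))) (TOb X M)"
    and tlift_Hom: "M \<in> Ob X \<Longrightarrow> tlift X M \<in> Hom X (TOb X M) (TOb X (TOb X M))"
    and tflip_Hom: "M \<in> Ob X \<Longrightarrow> tflip X M \<in> Hom X (TOb X (TOb X M)) (TOb X (TOb X M))"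
    and tproj_nat: "f \<in> Hom X M N \<Longrightarrow> TMor X f \<cdot> tproj X N = tproj X M \<cdot> f"
    and tzero_nat: "f \<in> Hom X M N \<Longrightarrow> f \<cdot> tzero X N = tzero X M \<cdot> TMor X f"
    and tsum_nat: "f \<in> Hom X M N \<Longrightarrow>
      pair X (T2 X N) (fst (T2 X M) \<cdot> TMor X f) (snd (T2 X M) \<cdot> TMor X f) \<cdot> tsum X N
        = tsum X M \<cdot> TMor X f"
    and tlift_nat: "f \<in> Hom X M N \<Longrightarrow> TMor X f \<cdot> tlift X N = tlift X M \<cdot> TMor X (TMor X f)"
    and tflip_nat: "f \<in> Hom X M N \<Longrightarrow>
      TMor X (TMor X f) \<cdot> tflip X N = tflip X M \<cdot> TMor X (TMor X f)"
    \<comment> \<open>the axioms\<close>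
    and tangent_fibre_powers: "M \<in> Ob X \<Longrightarrow> has_fibre_powers X (tproj X M)"
    and tangent_additive: "M \<in> Ob X \<Longrightarrow>
      additive_bundle X (tproj X M) (T2 X M) (tzero X M) (tsum X M)"
    and tlift_additive: "M \<in> Ob X \<Longrightarrow>
      additive_morphism X (tzero X M) (tlift X M)
        (tproj X M) (T2 X M) (tzero X M) (tsum X M)
        (TMor X (tproj X M)) (TPair X (T2 X M)) (TMor X (tzero X M)) (TMor X (tsum X M))"
    and tflip_additive: "M \<in> Ob X \<Longrightarrow>
      additive_morphism X (Id X (TOb X M)) (tflip X M)
        (TMor X (tproj X M)) (TPair X (T2 X M)) (TMor X (tzero X M)) (TMor X (tsum X M))
        (tproj X (TOb X M)) (T2 X (TOb X M)) (tzero X (TOb X M)) (tsum X (TOb X M))"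
    and tflip_tflip: "M \<in> Ob X \<Longrightarrow> tflip X M \<cdot> tflip X M = Id X (TOb X (TOb X M))"
    and tlift_tflip: "M \<in> Ob X \<Longrightarrow> tlift X M \<cdot> tflip X M = tlift X M"
    and tlift_tlift: "M \<in> Ob X \<Longrightarrow>
      tlift X M \<cdot> TMor X (tlift X M) = tlift X M \<cdot> tlift X (TOb X M)"
    and tflip_yang_baxter: "M \<in> Ob X \<Longrightarrow>
      TMor X (tflip X M) \<cdot> tflip X (TOb X M) \<cdot> TMor X (tflip X M)
        = tflip X (TOb X M) \<cdot> TMor X (tflip X M) \<cdot> tflip X (TOb X M)"
    and tlift_tflip_tflip: "M \<in> Ob X \<Longrightarrow>
      tlift X (TOb X M) \<cdot> TMor X (tflip X M) \<cdot> tflip X (TOb X M) = tflip X M \<cdot> TMor X (tlift X M)"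
    and tangent_universal: "M \<in> Ob X \<Longrightarrow>
      tangent_pullback X (TMor X (tproj X M)) (tzero X M)
        (xi X (TOb X M) (T2 X M) (tsum X M) (tlift X M)) (fst (T2 X M) \<cdot> tproj X M)"

definition tangent_display :: "('o, 'm, 'r) tangent_cat_scheme \<Rightarrow> 'm \<Rightarrow> bool" where
  "tangent_display X q \<longleftrightarrow> q \<in> Mor X \<and>
     (\<forall>n N. \<forall>f \<in> Hom X N ((TOb X ^^ n) (Cod X q)). \<exists>a b. tangent_pullback X ((TMor X ^^ n) q) f a b)"

section \<open>Differential bundles\<close>

record 'm dbundle =
  bproj :: 'm
  bzero :: 'm
  bsum :: 'm
  blift :: 'm

text \<open>Differential bundles are display by convention.\<close>

definition differential_bundle :: "('o, 'm, 'r) tangent_cat_scheme \<Rightarrow> 'm dbundle \<Rightarrow> bool" where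
  "differential_bundle X b \<longleftrightarrow>
     (let q = bproj b; z = bzero b; s = bsum b; l = blift b; E = Dom X q; M = Cod X q; E2 = pb X q q in
        tangent_display X q \<and> has_fibre_powers X q \<and> additive_bundle X q E2 z s \<and>
        l \<in> Hom X E (TOb X E) \<and>
        additive_morphism X (tzero X M) l q E2 z s
          (TMor X q) (TPair X E2) (TMor X z) (TMor X s) \<and>
        additive_morphism X z l q E2 z s
          (tproj X E) (T2 X E) (tzero X E) (tsum X E) \<and>
        l \<cdot> tlift X E = l \<cdot> TMor X l \<and>
        tangent_pullback X (TMor X q) (tzero X M) (xi X E E2 s l) (fst E2 \<cdot> q))"
  for X (structure)

definition linear_morphism ::
    "('o, 'm, 'r) tangent_cat_scheme \<Rightarrow> 'm dbundle \<Rightarrow> 'm \<Rightarrow> 'm \<Rightarrow> 'm dbundle \<Rightarrow> bool" where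
  "linear_morphism X b f g b' \<longleftrightarrow>
     f \<in> Hom X (Cod X (bproj b)) (Cod X (bproj b')) \<and>
     g \<in> Hom X (Dom X (bproj b)) (Dom X (bproj b')) \<and>
     bproj b \<cdot> f = g \<cdot> bproj b' \<and> g \<cdot> blift b' = blift b \<cdot> TMor X g"
  for X (structure)

text \<open>A morphism of \<open>DB(E)\<close> is recorded together with its source and target bundles.\<close>

definition DB ::
    "('o, 'm, 'r) tangent_cat_scheme \<Rightarrow> 'o \<Rightarrow> ('m dbundle, 'm dbundle \<times> 'm \<times> 'm dbundle) cat" where
  "DB X E =
     \<lparr>Ob = {b. differential_bundle X b \<and> Cod X (bproj b) = E},
      Mor = {(b, g, b'). differential_bundle X b \<and> Cod X (bproj b) = E \<and>
               differential_bundle X b' \<and> Cod X (bproj b') = E \<and>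
               linear_morphism X b (Id X E) g b'},
      Dom = (\<lambda>(b, g, b'). b),
      Cod = (\<lambda>(b, g, b'). b'),
      Id = (\<lambda>b. (b, Id X (Dom X (bproj b)), b)),
      Comp = (\<lambda>(b, g, b') (c, h, c'). (b, g \<cdot> h, c'))\<rparr>"
  for X (structure)

text \<open>The sum of the trivial bundle is the identity up to the isomorphism of the chosen pullback
  of \<open>id\<close> along itself with \<open>E\<close>.\<close>

definition trivial_bundle :: "('o, 'm, 'r) tangent_cat_scheme \<Rightarrow> 'o \<Rightarrow> 'm dbundle" where
  "trivial_bundle X E =
     \<lparr>bproj = Id X E, bzero = Id X E, bsum = fst (pb X (Id X E) (Id X E)), blift = tzero X E\<rparr>"

definition tangent_bundle :: "('o, 'm, 'r) tangent_cat_scheme \<Rightarrow> 'o \<Rightarrow> 'm dbundle" where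
  "tangent_bundle X E =
     \<lparr>bproj = tproj X E, bzero = tzero X E, bsum = tsum X E, blift = tlift X E\<rparr>"

section \<open>Vertical and Finsler bundles\<close>

abbreviation vert_incl :: "('o, 'm, 'r) tangent_cat_scheme \<Rightarrow> 'm \<Rightarrow> 'm" where
  "vert_incl X q \<equiv> fst (pb X (TMor X q) (tzero X (Cod X q)))"

abbreviation TV :: "('o, 'm, 'r) tangent_cat_scheme \<Rightarrow> 'm \<Rightarrow> 'm" where
  "TV X q \<equiv> snd (pb X (TMor X q) (tzero X (Cod X q)))"

abbreviation Vob :: "('o, 'm, 'r) tangent_cat_scheme \<Rightarrow> 'm \<Rightarrow> 'o" where
  "Vob X q \<equiv> Dom X (vert_incl X q)"

definition vertical_bundle :: "('o, 'm, 'r) tangent_cat_scheme \<Rightarrow> 'm \<Rightarrow> 'm dbundle" where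
  "vertical_bundle X q =
     (let E = Dom X q; i = vert_incl X q; qV = i \<cdot> tproj X E; V2 = pb X qV qV in
      \<lparr>bproj = qV,
       bzero = (THE h. h \<in> Hom X E (Vob X q) \<and> h \<cdot> i = tzero X E),
       bsum = (THE h. h \<in> Hom X (Dom X (fst V2)) (Vob X q) \<and>
                 h \<cdot> i = pair X (T2 X E) (fst V2 \<cdot> i) (snd V2 \<cdot> i) \<cdot> tsum X E),
       blift = (THE h. h \<in> Hom X (Vob X q) (TOb X (Vob X q)) \<and> h \<cdot> TMor X i = i \<cdot> tlift X E)\<rparr>)"
  for X (structure)

abbreviation finsler_proj :: "('o, 'm, 'r) tangent_cat_scheme \<Rightarrow> 'm \<Rightarrow> 'm" where
  "finsler_proj X q \<equiv> fst (pb X q (tproj X (Cod X q)))"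

abbreviation TF :: "('o, 'm, 'r) tangent_cat_scheme \<Rightarrow> 'm \<Rightarrow> 'm" where
  "TF X q \<equiv> snd (pb X q (tproj X (Cod X q)))"

abbreviation Fob :: "('o, 'm, 'r) tangent_cat_scheme \<Rightarrow> 'm \<Rightarrow> 'o" where
  "Fob X q \<equiv> Dom X (finsler_proj X q)"

definition finsler_bundle :: "('o, 'm, 'r) tangent_cat_scheme \<Rightarrow> 'm \<Rightarrow> 'm dbundle" where
  "finsler_bundle X q =
     (let E = Dom X q; M = Cod X q; P = pb X q (tproj X M); qF = finsler_proj X q;
          F2 = pb X qF qF in
      \<lparr>bproj = qF,
       bzero = pair X P (Id X E) (q \<cdot> tzero X M),
       bsum = pair X P (fst F2 \<cdot> qF)
                (pair X (T2 X M) (fst F2 \<cdot> TF X q) (snd F2 \<cdot> TF X q) \<cdot> tsum X M),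
       blift = pair X (TPair X P) (qF \<cdot> tzero X E) (TF X q \<cdot> tlift X M)\<rparr>)"
  for X (structure)

definition horizontal_descent :: "('o, 'm, 'r) tangent_cat_scheme \<Rightarrow> 'm \<Rightarrow> 'm" where
  "horizontal_descent X q = pair X (pb X q (tproj X (Cod X q))) (tproj X (Dom X q)) (TMor X q)"

definition submersion :: "('o, 'm, 'r) tangent_cat_scheme \<Rightarrow> 'm \<Rightarrow> bool" where
  "submersion X q \<longleftrightarrow>
     (let E = Dom X q; bV = vertical_bundle X q; bF = finsler_bundle X q;
          bT = tangent_bundle X E; b0 = trivial_bundle X E in
      pushout (DB X E)
        (bV, vert_incl X q, bT) (bV, bproj bV, b0)
        (bT, horizontal_descent X q, bF) (b0, bzero bF, bF))"

section \<open>Connections\<close>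

definition vertical_connection :: "('o, 'm, 'r) tangent_cat_scheme \<Rightarrow> 'm \<Rightarrow> 'm \<Rightarrow> bool" where
  "vertical_connection X q R \<longleftrightarrow>
     R \<in> Hom X (TOb X (Dom X q)) (Vob X q) \<and>
     vert_incl X q \<cdot> R = Id X (Vob X q) \<and>
     linear_morphism X (tangent_bundle X (Dom X q)) (Id X (Dom X q)) R (vertical_bundle X q)"
  for X (structure)

definition horizontal_connection :: "('o, 'm, 'r) tangent_cat_scheme \<Rightarrow> 'm \<Rightarrow> 'm \<Rightarrow> bool" where
  "horizontal_connection X q H \<longleftrightarrow>
     H \<in> Hom X (Fob X q) (TOb X (Dom X q)) \<and>
     H \<cdot> horizontal_descent X q = Id X (Fob X q) \<and>
     linear_morphism X (finsler_bundle X q) (Id X (Dom X q)) H (tangent_bundle X (Dom X q))"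
  for X (structure)

definition ehresmann_connection :: "('o, 'm, 'r) tangent_cat_scheme \<Rightarrow> 'm \<Rightarrow> 'm \<Rightarrow> 'm \<Rightarrow> bool" where
  "ehresmann_connection X q R H \<longleftrightarrow>
     vertical_connection X q R \<and> horizontal_connection X q H \<and>
     H \<cdot> R = finsler_proj X q \<cdot> bzero (vertical_bundle X q) \<and>
     pair X (T2 X (Dom X q)) (R \<cdot> vert_incl X q) (horizontal_descent X q \<cdot> H) \<cdot> tsum X (Dom X q)
       = Id X (TOb X (Dom X q))"
  for X (structure)

definition full_vertical_connection :: "('o, 'm, 'r) tangent_cat_scheme \<Rightarrow> 'm \<Rightarrow> 'm \<Rightarrow> bool" where
  "full_vertical_connection X q R \<longleftrightarrow>
     vertical_connection X q R \<and>
     tangent_pullback X (TV X q) (tproj X (Cod X q)) R (TMor X q)"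

definition full_horizontal_connection :: "('o, 'm, 'r) tangent_cat_scheme \<Rightarrow> 'm \<Rightarrow> 'm \<Rightarrow> bool" where
  "full_horizontal_connection X q H \<longleftrightarrow>
     horizontal_connection X q H \<and>
     (let E = Dom X q; bV = vertical_bundle X q; bF = finsler_bundle X q;
          bT = tangent_bundle X E; b0 = trivial_bundle X E in
      pushout (DB X E)
        (b0, bzero bV, bV) (b0, bzero bF, bF)
        (bV, vert_incl X q, bT) (bF, H, bT))"

end

theory Submission
  imports Defs
begin

text \<open>An Ehresmann connection is a splitting of the tangent bundle of \<open>E\<close> as a biproduct of the
  vertical bundle \<open>V\<close> and the Finsler bundle \<open>F\<close> in \<open>DB(E)\<close>: the injections are \<open>\<iota>\<close> and \<open>H\<close>, the
  projections are \<open>R\<close> and \<open>\<pi>\<close>. Such a splitting writes every linear map \<open>g\<close> out of the tangent bundle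
  as \<open>R \<iota> g + \<pi> H g\<close> (\<open>ehresmann_decompose\<close>), and both pushout properties follow from this formula:
  a map that vanishes on \<open>V\<close> factors through \<open>\<pi>\<close>, and maps out of \<open>V\<close> and \<open>F\<close> are copaired by
  \<open>(x, y) \<mapsto> R x + \<pi> y\<close>. Fullness of \<open>R\<close> holds because \<open>\<langle>R, \<pi>\<rangle>\<close> identifies \<open>TE\<close> with the fibre product of
  \<open>V\<close> and \<open>F\<close> over \<open>E\<close>, while \<open>F\<close> is itself the pullback of \<open>TM\<close> along \<open>q\<close>.

  Conversely, if \<open>H\<close> is full, the coproduct property defines \<open>R\<close> by \<open>\<iota> R = id\<close> and \<open>H R = 0\<close>, and
  \<open>R \<iota> + \<pi> H\<close> is the identity because both agree after \<open>\<iota>\<close> and after \<open>H\<close>. If \<open>R\<close> is full,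
  the horizontal part of a tangent vector would be obtained by subtracting its vertical part. There
  are no negatives, but the pullback property of \<open>R\<close> provides the result of the subtraction: an
  endomorphism \<open>K\<close> of \<open>TE\<close> with \<open>K R = 0\<close> and \<open>K Tq = Tq\<close>. It vanishes on \<open>V\<close>, so for a submersion it
  factors as \<open>K = \<pi> H\<close>.

  Two facts about differential bundles carry these arguments. Linear maps are additive
  (\<open>linear_zero\<close>, \<open>linear_additive\<close>): the lift is a monomorphism into the tangent bundle of the
  total object, and every \<open>Tg\<close> is additive. And \<open>V\<close> and \<open>F\<close> are differential bundles. Both
  are limits of cospans of bundles lying over \<open>E \<rightarrow> M = M\<close>, namely \<open>p\<^sub>E \<rightarrow> p\<^sub>M \<leftarrow> 0\<^sub>M\<close> and
  \<open>0\<^sub>E \<rightarrow> 0\<^sub>M \<leftarrow> p\<^sub>M\<close>, so that one lemma, \<open>limit_bundle\<close>, treats them together. The universality of the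
  lift of such a limit rests on the fact that pullbacks commute with pullbacks
  (\<open>pullback_of_pullbacks\<close>).

  Equations between arrows are proved by the simplifier, with typing expressed through \<open>Mor\<close>, \<open>Dom\<close>
  and \<open>Cod\<close>, and fibrewise sums are handled through generalised elements: \<open>plus b x y\<close> is the sum of
  two arrows into the total object of \<open>b\<close> that have the same projection.\<close>

section \<open>Arrow calculus\<close>

lemma Hom_iff [simp]: "f \<in> Hom X A B \<longleftrightarrow> f \<in> Mor X \<and> Dom X f = A \<and> Cod X f = B"
  by (auto simp: Hom_def)

context category
begin

declare Dom_Ob [simp] Cod_Ob [simp]

lemma comp_arrow [simp]:
  assumes "f \<in> Mor X" "g \<in> Mor X" "Cod X f = Dom X g"
  shows "f \<cdot> g \<in> Mor X" "Dom X (f \<cdot> g) = Dom X f" "Cod X (f \<cdot> g) = Cod X g"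
  using Comp_Hom[of f "Dom X f" "Cod X f" g "Cod X g"] assms by auto

lemma id_arrow [simp]:
  assumes "A \<in> Ob X"
  shows "Id X A \<in> Mor X" "Dom X (Id X A) = A" "Cod X (Id X A) = A"
  using Id_Hom[OF assms] by auto

lemma id_comp [simp]: "f \<in> Mor X \<Longrightarrow> Dom X f = A \<Longrightarrow> Id X A \<cdot> f = f"
  using Id_left by auto

lemma comp_id [simp]: "f \<in> Mor X \<Longrightarrow> Cod X f = A \<Longrightarrow> f \<cdot> Id X A = f"
  using Id_right by auto

lemma assoc [simp]:
  "f \<in> Mor X \<Longrightarrow> g \<in> Mor X \<Longrightarrow> h \<in> Mor X \<Longrightarrow> Cod X f = Dom X g \<Longrightarrow> Cod X g = Dom X h
   \<Longrightarrow> (f \<cdot> g) \<cdot> h = f \<cdot> (g \<cdot> h)"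
  using Comp_assoc by auto

text \<open>Composites are normalised to the right, so an equation between composites is also needed
  with a further arrow appended.\<close>

lemma extend:
  "a \<cdot> b = c \<Longrightarrow> a \<in> Mor X \<Longrightarrow> b \<in> Mor X \<Longrightarrow> Cod X a = Dom X b \<Longrightarrow> h \<in> Mor X
   \<Longrightarrow> Cod X b = Dom X h \<Longrightarrow> a \<cdot> (b \<cdot> h) = c \<cdot> h"
  by (metis assoc)

section \<open>Pullbacks\<close>

lemma pullback_arrows:
  assumes "pullback X f g a b"
  shows "f \<in> Mor X" "g \<in> Mor X" "a \<in> Mor X" "b \<in> Mor X" "Cod X f = Cod X g"
    "Cod X a = Dom X f" "Cod X b = Dom X g" "Dom X b = Dom X a" "a \<cdot> f = b \<cdot> g"
  using assms by (auto simp: pullback_def)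

lemma pullback_mono:
  assumes "pullback X f g a b" and "x \<in> Mor X" "y \<in> Mor X" "Dom X x = Dom X y"
    "Cod X x = Dom X a" "Cod X y = Dom X a" "x \<cdot> a = y \<cdot> a" "x \<cdot> b = y \<cdot> b"
  shows "x = y"
proof -
  note p = pullback_arrows[OF assms(1)]
  have "\<exists>!h. h \<in> Hom X (Dom X x) (Dom X a) \<and> h \<cdot> a = x \<cdot> a \<and> h \<cdot> b = x \<cdot> b"
  proof -
    have "x \<cdot> a \<in> Hom X (Dom X x) (Dom X f)" "x \<cdot> b \<in> Hom X (Dom X x) (Dom X g)"
      "(x \<cdot> a) \<cdot> f = (x \<cdot> b) \<cdot> g"
      using p assms by auto
    then show ?thesis using assms(1) unfolding pullback_def by blast
  qed
  then show ?thesis using assms by auto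
qed

lemma pullback_ex:
  assumes "pullback X f g a b" and "x \<in> Mor X" "y \<in> Mor X" "Dom X x = Dom X y"
    "Cod X x = Dom X f" "Cod X y = Dom X g" "x \<cdot> f = y \<cdot> g"
  shows "\<exists>h. h \<in> Mor X \<and> Dom X h = Dom X x \<and> Cod X h = Dom X a \<and> h \<cdot> a = x \<and> h \<cdot> b = y"
proof -
  have "x \<in> Hom X (Dom X x) (Dom X f)" "y \<in> Hom X (Dom X x) (Dom X g)"
    using assms by auto
  then have "\<exists>!h. h \<in> Hom X (Dom X x) (Dom X a) \<and> h \<cdot> a = x \<and> h \<cdot> b = y"
    using assms(1,7) unfolding pullback_def by blast
  then show ?thesis by auto
qed

lemma pullbackI:
  assumes "f \<in> Mor X" "g \<in> Mor X" "a \<in> Mor X" "b \<in> Mor X" "Cod X f = Cod X g"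
    "Cod X a = Dom X f" "Cod X b = Dom X g" "Dom X b = Dom X a" "a \<cdot> f = b \<cdot> g"
    and ex: "\<And>x y. x \<in> Mor X \<Longrightarrow> y \<in> Mor X \<Longrightarrow> Dom X x = Dom X y \<Longrightarrow>
      Cod X x = Dom X f \<Longrightarrow> Cod X y = Dom X g \<Longrightarrow> x \<cdot> f = y \<cdot> g \<Longrightarrow>
      \<exists>h. h \<in> Mor X \<and> Dom X h = Dom X x \<and> Cod X h = Dom X a \<and> h \<cdot> a = x \<and> h \<cdot> b = y"
    and uniq: "\<And>x y. x \<in> Mor X \<Longrightarrow> y \<in> Mor X \<Longrightarrow> Dom X x = Dom X y \<Longrightarrow>
      Cod X x = Dom X a \<Longrightarrow> Cod X y = Dom X a \<Longrightarrow> x \<cdot> a = y \<cdot> a \<Longrightarrow> x \<cdot> b = y \<cdot> b \<Longrightarrow> x = y"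
  shows "pullback X f g a b"
  unfolding pullback_def
proof (intro conjI allI ballI impI)
  fix A x y assume "x \<in> Hom X A (Dom X f)" "y \<in> Hom X A (Dom X g)" "x \<cdot> f = y \<cdot> g"
  then obtain h where "h \<in> Mor X" "Dom X h = Dom X x" "Cod X h = Dom X a" "h \<cdot> a = x" "h \<cdot> b = y"
    using ex[of x y] by auto
  then show "\<exists>!h. h \<in> Hom X A (Dom X a) \<and> h \<cdot> a = x \<and> h \<cdot> b = y"
    using \<open>x \<in> Hom X A (Dom X f)\<close> uniq by (intro ex1I[of _ h]) auto
qed (use assms in auto)

lemma pair_universal:
  assumes "pullback X f g (fst P) (snd P)" and "x \<in> Mor X" "y \<in> Mor X" "Dom X x = Dom X y"
    "Cod X x = Dom X f" "Cod X y = Dom X g" "x \<cdot> f = y \<cdot> g"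
  shows "pair X P x y \<in> Mor X" "Dom X (pair X P x y) = Dom X x"
    "Cod X (pair X P x y) = Dom X (fst P)" "pair X P x y \<cdot> fst P = x" "pair X P x y \<cdot> snd P = y"
proof -
  obtain h where h: "h \<in> Mor X" "Dom X h = Dom X x" "Cod X h = Dom X (fst P)"
      "h \<cdot> fst P = x" "h \<cdot> snd P = y"
    using pullback_ex[OF assms] by blast
  have "pair X P x y = h"
    unfolding pair_def using h pullback_mono[OF assms(1)] by (intro the_equality) auto
  then show "pair X P x y \<in> Mor X" "Dom X (pair X P x y) = Dom X x"
    "Cod X (pair X P x y) = Dom X (fst P)" "pair X P x y \<cdot> fst P = x" "pair X P x y \<cdot> snd P = y"
    using h by auto
qed

lemma pair_eq:
  assumes "pullback X f g (fst P) (snd P)" and "h \<in> Mor X" "Cod X h = Dom X (fst P)"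
    "h \<cdot> fst P = x" "h \<cdot> snd P = y"
  shows "pair X P x y = h"
  unfolding pair_def
proof (rule the_equality)
  note p = pullback_arrows[OF assms(1)]
  show "h \<in> Hom X (Dom X x) (Dom X (fst P)) \<and> h \<cdot> fst P = x \<and> h \<cdot> snd P = y"
    using assms p by auto
  show "k = h" if "k \<in> Hom X (Dom X x) (Dom X (fst P)) \<and> k \<cdot> fst P = x \<and> k \<cdot> snd P = y" for k
    by (rule pullback_mono[OF assms(1)]) (use that assms p in auto)
qed

lemma comp_pair:
  assumes "pullback X f g (fst P) (snd P)" and "x \<in> Mor X" "y \<in> Mor X" "Dom X x = Dom X y"
    "Cod X x = Dom X f" "Cod X y = Dom X g" "x \<cdot> f = y \<cdot> g" "h \<in> Mor X" "Cod X h = Dom X x"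
  shows "h \<cdot> pair X P x y = pair X P (h \<cdot> x) (h \<cdot> y)"
proof -
  note p = pullback_arrows[OF assms(1)] and pr = pair_universal[OF assms(1-7)]
  show ?thesis by (rule pair_eq[OF assms(1), symmetric]) (use assms p pr in auto)
qed

text \<open>Limits commute with limits: \<open>S\<^sub>1 \<rightarrow> S\<^sub>2 \<leftarrow> S\<^sub>3\<close> is a cospan of pullback squares, and
  the square at index \<open>0\<close> is its pullback, formed corner by corner. The maps \<open>x\<^sub>i\<close>, \<open>y\<^sub>i\<close>, \<open>w\<^sub>i\<close> form the
  cospan at each corner and \<open>u\<^sub>i\<close>, \<open>v\<^sub>i\<close>, \<open>t\<^sub>i\<close>, \<open>k\<^sub>i\<close> are the projections from the limit. A cone over the
  limit square projects to cones over \<open>S\<^sub>1\<close> and \<open>S\<^sub>3\<close>, whose mediating arrows agree in \<open>S\<^sub>2\<close>. The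
  square with sides \<open>d\<^sub>1\<close> and \<open>d\<^sub>3\<close> expresses that \<open>k\<^sub>1\<close> and \<open>k\<^sub>3\<close> are jointly monic, which gives the
  commutativity of the limit square.\<close>

lemma pullback_of_pullbacks:
  assumes S1: "pullback X f1 g1 a1 b1" and S2: "pullback X f2 g2 a2 b2"
    and S3: "pullback X f3 g3 a3 b3"
    and PX: "pullback X x1 x3 u1 u3" and PY: "pullback X y1 y3 v1 v3"
    and PW: "pullback X w1 w3 t1 t3"
    and PZ: "pullback X d1 d3 k1 k3"
    and k: "Dom X k1 = Cod X f0" "Cod X k1 = Cod X f1" "Cod X k3 = Cod X f3"
    and t0: "f0 \<in> Mor X" "g0 \<in> Mor X" "a0 \<in> Mor X" "b0 \<in> Mor X" "Cod X f0 = Cod X g0"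
      "Dom X f0 = Dom X u1" "Cod X a0 = Dom X u1" "Dom X g0 = Dom X v1" "Cod X b0 = Dom X v1"
      "Dom X a0 = Dom X t1" "Dom X b0 = Dom X t1"
    and t2: "Dom X x1 = Dom X f1" "Cod X x1 = Dom X f2" "Dom X x3 = Dom X f3"
      "Dom X y1 = Dom X g1" "Cod X y1 = Dom X g2" "Dom X y3 = Dom X g3"
      "Dom X w1 = Dom X a1" "Cod X w1 = Dom X a2" "Dom X w3 = Dom X a3"
    and c: "f0 \<cdot> k1 = u1 \<cdot> f1" "f0 \<cdot> k3 = u3 \<cdot> f3" "g0 \<cdot> k1 = v1 \<cdot> g1" "g0 \<cdot> k3 = v3 \<cdot> g3"
      "a0 \<cdot> u1 = t1 \<cdot> a1" "a0 \<cdot> u3 = t3 \<cdot> a3" "b0 \<cdot> v1 = t1 \<cdot> b1" "b0 \<cdot> v3 = t3 \<cdot> b3"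
      "w1 \<cdot> a2 = a1 \<cdot> x1" "w3 \<cdot> a2 = a3 \<cdot> x3" "w1 \<cdot> b2 = b1 \<cdot> y1" "w3 \<cdot> b2 = b3 \<cdot> y3"
  shows "pullback X f0 g0 a0 b0"
proof -
  note p = pullback_arrows[OF S1] pullback_arrows[OF S2] pullback_arrows[OF S3]
    pullback_arrows[OF PX] pullback_arrows[OF PY] pullback_arrows[OF PW] pullback_arrows[OF PZ]
  show ?thesis
  proof (rule pullbackI)
    have e1: "a0 \<cdot> f0 \<cdot> k1 = b0 \<cdot> g0 \<cdot> k1"
      using p k t0 t2 c extend[OF c(5)] extend[OF c(7)] by simp
    have e3: "a0 \<cdot> f0 \<cdot> k3 = b0 \<cdot> g0 \<cdot> k3"
      using p k t0 t2 c extend[OF c(6)] extend[OF c(8)] by simp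
    show "a0 \<cdot> f0 = b0 \<cdot> g0" by (rule pullback_mono[OF PZ]) (use e1 e3 p k t0 t2 in auto)
  next
    fix x y
    assume xy: "x \<in> Mor X" "y \<in> Mor X" "Dom X x = Dom X y" "Cod X x = Dom X f0"
      "Cod X y = Dom X g0" and e: "x \<cdot> f0 = y \<cdot> g0"
    have e1: "x \<cdot> (f0 \<cdot> k1) = y \<cdot> (g0 \<cdot> k1)" and e3: "x \<cdot> (f0 \<cdot> k3) = y \<cdot> (g0 \<cdot> k3)"
      using extend[OF e, of k1] extend[OF e, of k3] xy t0 k p by simp_all
    obtain h1 where h1: "h1 \<in> Mor X" "Dom X h1 = Dom X x" "Cod X h1 = Dom X a1"
        "h1 \<cdot> a1 = x \<cdot> u1" "h1 \<cdot> b1 = y \<cdot> v1"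
      using pullback_ex[OF S1, of "x \<cdot> u1" "y \<cdot> v1"] xy p k t0 t2 e1 c by auto
    obtain h3 where h3: "h3 \<in> Mor X" "Dom X h3 = Dom X x" "Cod X h3 = Dom X a3"
        "h3 \<cdot> a3 = x \<cdot> u3" "h3 \<cdot> b3 = y \<cdot> v3"
      using pullback_ex[OF S3, of "x \<cdot> u3" "y \<cdot> v3"] xy p k t0 t2 e3 c by auto
    have "h1 \<cdot> w1 = h3 \<cdot> w3"
    proof (rule pullback_mono[OF S2])
      show "h1 \<cdot> w1 \<cdot> a2 = h3 \<cdot> w3 \<cdot> a2"
        using h1 h3 p t0 t2 c xy extend[OF h1(4)] extend[OF h3(4)] by simp
      show "h1 \<cdot> w1 \<cdot> b2 = h3 \<cdot> w3 \<cdot> b2"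
        using h1 h3 p t0 t2 c xy extend[OF h1(5)] extend[OF h3(5)] by simp
    qed (use h1 h3 p t2 in auto)
    then obtain h where h: "h \<in> Mor X" "Dom X h = Dom X x" "Cod X h = Dom X t1"
        "h \<cdot> t1 = h1" "h \<cdot> t3 = h3"
      using pullback_ex[OF PW, of h1 h3] h1 h3 t2 p by auto
    have "h \<cdot> a0 = x"
    proof (rule pullback_mono[OF PX])
      show "h \<cdot> a0 \<cdot> u1 = x \<cdot> u1" "h \<cdot> a0 \<cdot> u3 = x \<cdot> u3"
        using h h1 h3 p t0 t2 c xy extend[OF h(4)] extend[OF h(5)] by simp_all
    qed (use h xy t0 in auto)
    moreover have "h \<cdot> b0 = y"
    proof (rule pullback_mono[OF PY])
      show "h \<cdot> b0 \<cdot> v1 = y \<cdot> v1" "h \<cdot> b0 \<cdot> v3 = y \<cdot> v3"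
        using h h1 h3 p t0 t2 c xy extend[OF h(4)] extend[OF h(5)] by simp_all
    qed (use h xy t0 in auto)
    ultimately show "\<exists>h. h \<in> Mor X \<and> Dom X h = Dom X x \<and> Cod X h = Dom X a0 \<and>
        h \<cdot> a0 = x \<and> h \<cdot> b0 = y"
      using h t0 by auto
  next
    fix x y
    assume xy: "x \<in> Mor X" "y \<in> Mor X" "Dom X x = Dom X y" "Cod X x = Dom X a0"
      "Cod X y = Dom X a0" and e: "x \<cdot> a0 = y \<cdot> a0" "x \<cdot> b0 = y \<cdot> b0"
    note ee = extend[OF e(1)] extend[OF e(2)]
    have s: "x \<cdot> (a0 \<cdot> u1) = y \<cdot> (a0 \<cdot> u1)" "x \<cdot> (b0 \<cdot> v1) = y \<cdot> (b0 \<cdot> v1)"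
      "x \<cdot> (a0 \<cdot> u3) = y \<cdot> (a0 \<cdot> u3)" "x \<cdot> (b0 \<cdot> v3) = y \<cdot> (b0 \<cdot> v3)"
      using ee[of u1] ee[of u3] ee[of v1] ee[of v3] xy p t0 by simp_all
    have e1: "x \<cdot> t1 = y \<cdot> t1"
      by (rule pullback_mono[OF S1]) (use s c p xy t0 t2 in auto)
    have e3: "x \<cdot> t3 = y \<cdot> t3"
      by (rule pullback_mono[OF S3]) (use s c p xy t0 t2 in auto)
    show "x = y" by (rule pullback_mono[OF PW]) (use e1 e3 xy t0 p in auto)
  qed (use t0 p in auto)
qed

lemma pullback_iso:
  assumes P: "pullback X f g a b" and "i \<in> Mor X" "j \<in> Mor X" "Cod X i = Dom X a"
    "Dom X j = Dom X a" "Cod X j = Dom X i" "i \<cdot> j = Id X (Dom X i)" "j \<cdot> i = Id X (Dom X a)"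
  shows "pullback X f g (i \<cdot> a) (i \<cdot> b)"
proof -
  note p = pullback_arrows[OF P]
  show ?thesis
  proof (rule pullbackI)
    fix x y
    assume xy: "x \<in> Mor X" "y \<in> Mor X" "Dom X x = Dom X y"
      "Cod X x = Dom X f" "Cod X y = Dom X g" "x \<cdot> f = y \<cdot> g"
    obtain h where h: "h \<in> Mor X" "Dom X h = Dom X x" "Cod X h = Dom X a" "h \<cdot> a = x" "h \<cdot> b = y"
      using pullback_ex[OF P xy] by auto
    show "\<exists>h. h \<in> Mor X \<and> Dom X h = Dom X x \<and> Cod X h = Dom X (i \<cdot> a) \<and>
        h \<cdot> (i \<cdot> a) = x \<and> h \<cdot> (i \<cdot> b) = y"
      using h assms p extend[OF assms(8)] by (intro exI[of _ "h \<cdot> j"]) simp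
  next
    fix x y
    assume xy: "x \<in> Mor X" "y \<in> Mor X" "Dom X x = Dom X y" "Cod X x = Dom X (i \<cdot> a)"
      "Cod X y = Dom X (i \<cdot> a)" "x \<cdot> (i \<cdot> a) = y \<cdot> (i \<cdot> a)" "x \<cdot> (i \<cdot> b) = y \<cdot> (i \<cdot> b)"
    have "x \<cdot> i = y \<cdot> i" by (rule pullback_mono[OF P]) (use xy assms p in auto)
    then have "x \<cdot> (i \<cdot> j) = y \<cdot> (i \<cdot> j)"
      using xy assms p extend[of x i "y \<cdot> i" j] by simp
    then show "x = y" using xy assms p by simp
  qed (use assms p in auto)
qed

lemma pullback_paste:
  assumes P: "pullback X f g a b" and Q: "pullback X h a c d"
  shows "pullback X (h \<cdot> f) g c (d \<cdot> b)"
proof -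
  note p = pullback_arrows[OF P] pullback_arrows[OF Q]
  show ?thesis
  proof (rule pullbackI)
    show "c \<cdot> (h \<cdot> f) = d \<cdot> b \<cdot> g" using p extend[OF p(18)] by simp
  next
    fix x y
    assume xy: "x \<in> Mor X" "y \<in> Mor X" "Dom X x = Dom X y"
      "Cod X x = Dom X (h \<cdot> f)" "Cod X y = Dom X g" "x \<cdot> (h \<cdot> f) = y \<cdot> g"
    obtain k where k: "k \<in> Mor X" "Dom X k = Dom X x" "Cod X k = Dom X a" "k \<cdot> a = x \<cdot> h" "k \<cdot> b = y"
      using pullback_ex[OF P, of "x \<cdot> h" y] xy p by auto
    obtain l where "l \<in> Mor X" "Dom X l = Dom X x" "Cod X l = Dom X c" "l \<cdot> c = x" "l \<cdot> d = k"
      using pullback_ex[OF Q, of x k] xy p k by auto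
    then show "\<exists>l. l \<in> Mor X \<and> Dom X l = Dom X x \<and> Cod X l = Dom X c \<and> l \<cdot> c = x \<and> l \<cdot> (d \<cdot> b) = y"
      using k p extend[of l d k b] by (intro exI[of _ l]) simp
  next
    fix x y
    assume xy: "x \<in> Mor X" "y \<in> Mor X" "Dom X x = Dom X y" "Cod X x = Dom X c"
      "Cod X y = Dom X c" "x \<cdot> c = y \<cdot> c" "x \<cdot> (d \<cdot> b) = y \<cdot> (d \<cdot> b)"
    have da: "x \<cdot> (d \<cdot> a) = y \<cdot> (d \<cdot> a)"
      using xy p extend[OF xy(6), of h] by simp
    have xd: "x \<cdot> d = y \<cdot> d" by (rule pullback_mono[OF P]) (use da xy p in auto)
    show "x = y" by (rule pullback_mono[OF Q]) (use xd xy p in auto)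
  qed (use p in auto)
qed

end

context tangent_category
begin

section \<open>Tangent pullbacks\<close>

declare TOb_Ob [simp]

lemma T_arrow [simp]:
  assumes "f \<in> Mor X"
  shows "TMor X f \<in> Mor X" "Dom X (TMor X f) = TOb X (Dom X f)"
    "Cod X (TMor X f) = TOb X (Cod X f)"
  using TMor_Hom[of f "Dom X f" "Cod X f"] assms by auto

lemma T_id [simp]: "A \<in> Ob X \<Longrightarrow> TMor X (Id X A) = Id X (TOb X A)"
  by (rule TMor_Id)

lemma T_comp [simp]:
  "f \<in> Mor X \<Longrightarrow> g \<in> Mor X \<Longrightarrow> Cod X f = Dom X g \<Longrightarrow> TMor X (f \<cdot> g) = TMor X f \<cdot> TMor X g"
  by (rule TMor_Comp[of f "Dom X f" "Cod X f" g "Cod X g"]) auto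

lemma structure_arrow [simp]:
  assumes "A \<in> Ob X"
  shows "tproj X A \<in> Mor X" "Dom X (tproj X A) = TOb X A" "Cod X (tproj X A) = A"
    "tzero X A \<in> Mor X" "Dom X (tzero X A) = A" "Cod X (tzero X A) = TOb X A"
    "tlift X A \<in> Mor X" "Dom X (tlift X A) = TOb X A" "Cod X (tlift X A) = TOb X (TOb X A)"
    "tflip X A \<in> Mor X" "Dom X (tflip X A) = TOb X (TOb X A)"
    "Cod X (tflip X A) = TOb X (TOb X A)"
    "tsum X A \<in> Mor X" "Dom X (tsum X A) = Dom X (fst (T2 X A))" "Cod X (tsum X A) = TOb X A"
  using tproj_Hom[OF assms] tzero_Hom[OF assms] tlift_Hom[OF assms] tflip_Hom[OF assms]
    tsum_Hom[OF assms] by auto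

lemma naturality:
  assumes "f \<in> Mor X"
  shows tproj_natural: "TMor X f \<cdot> tproj X (Cod X f) = tproj X (Dom X f) \<cdot> f"
    and tzero_natural: "f \<cdot> tzero X (Cod X f) = tzero X (Dom X f) \<cdot> TMor X f"
    and tlift_natural: "TMor X f \<cdot> tlift X (Cod X f) = tlift X (Dom X f) \<cdot> TMor X (TMor X f)"
  using tproj_nat[of f "Dom X f" "Cod X f"] tzero_nat[of f "Dom X f" "Cod X f"]
    tlift_nat[of f "Dom X f" "Cod X f"] assms by auto

lemma Tn_arrow [simp]:
  assumes "f \<in> Mor X"
  shows "(TMor X ^^ m) f \<in> Mor X" "Dom X ((TMor X ^^ m) f) = (TOb X ^^ m) (Dom X f)"
    "Cod X ((TMor X ^^ m) f) = (TOb X ^^ m) (Cod X f)"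
  using assms by (induction m) auto

lemma TnOb_Ob [simp]: "A \<in> Ob X \<Longrightarrow> (TOb X ^^ m) A \<in> Ob X"
  by (induction m) auto

lemma Tn_comp [simp]:
  assumes "f \<in> Mor X" "g \<in> Mor X" "Cod X f = Dom X g"
  shows "(TMor X ^^ m) (f \<cdot> g) = (TMor X ^^ m) f \<cdot> (TMor X ^^ m) g"
  using assms by (induction m) auto

lemma Tn_id [simp]: "A \<in> Ob X \<Longrightarrow> (TMor X ^^ m) (Id X A) = Id X ((TOb X ^^ m) A)"
  by (induction m) auto

lemma Tn_square:
  assumes "f \<cdot> g = h \<cdot> k" "f \<in> Mor X" "g \<in> Mor X" "Cod X f = Dom X g"
    "h \<in> Mor X" "k \<in> Mor X" "Cod X h = Dom X k"
  shows "(TMor X ^^ m) f \<cdot> (TMor X ^^ m) g = (TMor X ^^ m) h \<cdot> (TMor X ^^ m) k"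
  using assms by (metis Tn_comp)

lemma tangent_pullbackD: "tangent_pullback X f g a b \<Longrightarrow> pullback X f g a b"
  unfolding tangent_pullback_def by (metis funpow_0)

lemma tangent_pullback_T:
  "tangent_pullback X f g a b \<Longrightarrow>
   tangent_pullback X (TMor X f) (TMor X g) (TMor X a) (TMor X b)"
  unfolding tangent_pullback_def by (metis comp_apply funpow_Suc_right)

lemma tangent_pullback_of_pullbacks:
  assumes S1: "tangent_pullback X f1 g1 a1 b1" and S2: "tangent_pullback X f2 g2 a2 b2"
    and S3: "tangent_pullback X f3 g3 a3 b3"
    and PX: "tangent_pullback X x1 x3 u1 u3" and PY: "tangent_pullback X y1 y3 v1 v3"
    and PW: "tangent_pullback X w1 w3 t1 t3" and PZ: "tangent_pullback X d1 d3 k1 k3"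
    and k: "Dom X k1 = Cod X f0" "Cod X k1 = Cod X f1" "Cod X k3 = Cod X f3"
    and t0: "f0 \<in> Mor X" "g0 \<in> Mor X" "a0 \<in> Mor X" "b0 \<in> Mor X" "Cod X f0 = Cod X g0"
      "Dom X f0 = Dom X u1" "Cod X a0 = Dom X u1" "Dom X g0 = Dom X v1" "Cod X b0 = Dom X v1"
      "Dom X a0 = Dom X t1" "Dom X b0 = Dom X t1"
    and t2: "Dom X x1 = Dom X f1" "Cod X x1 = Dom X f2" "Dom X x3 = Dom X f3"
      "Dom X y1 = Dom X g1" "Cod X y1 = Dom X g2" "Dom X y3 = Dom X g3"
      "Dom X w1 = Dom X a1" "Cod X w1 = Dom X a2" "Dom X w3 = Dom X a3"
    and c: "f0 \<cdot> k1 = u1 \<cdot> f1" "f0 \<cdot> k3 = u3 \<cdot> f3" "g0 \<cdot> k1 = v1 \<cdot> g1" "g0 \<cdot> k3 = v3 \<cdot> g3"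
      "a0 \<cdot> u1 = t1 \<cdot> a1" "a0 \<cdot> u3 = t3 \<cdot> a3" "b0 \<cdot> v1 = t1 \<cdot> b1" "b0 \<cdot> v3 = t3 \<cdot> b3"
      "w1 \<cdot> a2 = a1 \<cdot> x1" "w3 \<cdot> a2 = a3 \<cdot> x3" "w1 \<cdot> b2 = b1 \<cdot> y1" "w3 \<cdot> b2 = b3 \<cdot> y3"
  shows "tangent_pullback X f0 g0 a0 b0"
  unfolding tangent_pullback_def
proof
  fix m
  note D = tangent_pullbackD[OF S1] tangent_pullbackD[OF S2] tangent_pullbackD[OF S3]
    tangent_pullbackD[OF PX] tangent_pullbackD[OF PY] tangent_pullbackD[OF PW]
    tangent_pullbackD[OF PZ]
  note p = D[THEN pullback_arrows(1)] D[THEN pullback_arrows(2)] D[THEN pullback_arrows(3)]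
    D[THEN pullback_arrows(4)] D[THEN pullback_arrows(5)] D[THEN pullback_arrows(6)]
    D[THEN pullback_arrows(7)] D[THEN pullback_arrows(8)]
  have t3: "Dom X d1 = Cod X f1" "Dom X d3 = Cod X f3" "Cod X x3 = Dom X f2"
    "Cod X y3 = Dom X g2" "Cod X w3 = Dom X a2"
    using p k t2 by simp_all
  have cm: "(TMor X ^^ m) f0 \<cdot> (TMor X ^^ m) k1 = (TMor X ^^ m) u1 \<cdot> (TMor X ^^ m) f1"
    "(TMor X ^^ m) f0 \<cdot> (TMor X ^^ m) k3 = (TMor X ^^ m) u3 \<cdot> (TMor X ^^ m) f3"
    "(TMor X ^^ m) g0 \<cdot> (TMor X ^^ m) k1 = (TMor X ^^ m) v1 \<cdot> (TMor X ^^ m) g1"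
    "(TMor X ^^ m) g0 \<cdot> (TMor X ^^ m) k3 = (TMor X ^^ m) v3 \<cdot> (TMor X ^^ m) g3"
    "(TMor X ^^ m) a0 \<cdot> (TMor X ^^ m) u1 = (TMor X ^^ m) t1 \<cdot> (TMor X ^^ m) a1"
    "(TMor X ^^ m) a0 \<cdot> (TMor X ^^ m) u3 = (TMor X ^^ m) t3 \<cdot> (TMor X ^^ m) a3"
    "(TMor X ^^ m) b0 \<cdot> (TMor X ^^ m) v1 = (TMor X ^^ m) t1 \<cdot> (TMor X ^^ m) b1"
    "(TMor X ^^ m) b0 \<cdot> (TMor X ^^ m) v3 = (TMor X ^^ m) t3 \<cdot> (TMor X ^^ m) b3"
    "(TMor X ^^ m) w1 \<cdot> (TMor X ^^ m) a2 = (TMor X ^^ m) a1 \<cdot> (TMor X ^^ m) x1"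
    "(TMor X ^^ m) w3 \<cdot> (TMor X ^^ m) a2 = (TMor X ^^ m) a3 \<cdot> (TMor X ^^ m) x3"
    "(TMor X ^^ m) w1 \<cdot> (TMor X ^^ m) b2 = (TMor X ^^ m) b1 \<cdot> (TMor X ^^ m) y1"
    "(TMor X ^^ m) w3 \<cdot> (TMor X ^^ m) b2 = (TMor X ^^ m) b3 \<cdot> (TMor X ^^ m) y3"
    by (rule c[THEN Tn_square]; simp add: p k t0 t2 t3)+
  show "pullback X ((TMor X ^^ m) f0) ((TMor X ^^ m) g0) ((TMor X ^^ m) a0) ((TMor X ^^ m) b0)"
    by (rule pullback_of_pullbacks[OF
      S1[unfolded tangent_pullback_def, rule_format, of m]
      S2[unfolded tangent_pullback_def, rule_format, of m]
      S3[unfolded tangent_pullback_def, rule_format, of m]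
      PX[unfolded tangent_pullback_def, rule_format, of m]
      PY[unfolded tangent_pullback_def, rule_format, of m]
      PW[unfolded tangent_pullback_def, rule_format, of m]
      PZ[unfolded tangent_pullback_def, rule_format, of m]])
      (simp_all add: p k t0 t2 t3 cm)
qed

lemma tangent_pullback_iso:
  assumes P: "tangent_pullback X f g a b" and "i \<in> Mor X" "j \<in> Mor X" "Cod X i = Dom X a"
    "Dom X j = Dom X a" "Cod X j = Dom X i" "i \<cdot> j = Id X (Dom X i)" "j \<cdot> i = Id X (Dom X a)"
  shows "tangent_pullback X f g (i \<cdot> a) (i \<cdot> b)"
  unfolding tangent_pullback_def
proof
  fix m
  note p = pullback_arrows[OF tangent_pullbackD[OF P]]
  note e = assms(7,8)[THEN arg_cong[where f = "TMor X ^^ m"]]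
  have "pullback X ((TMor X ^^ m) f) ((TMor X ^^ m) g)
      ((TMor X ^^ m) i \<cdot> (TMor X ^^ m) a) ((TMor X ^^ m) i \<cdot> (TMor X ^^ m) b)"
    by (rule pullback_iso[OF P[unfolded tangent_pullback_def, rule_format, of m],
        of _ "(TMor X ^^ m) j"]) (use assms(2-6) e p in simp_all)
  then show "pullback X ((TMor X ^^ m) f) ((TMor X ^^ m) g)
      ((TMor X ^^ m) (i \<cdot> a)) ((TMor X ^^ m) (i \<cdot> b))"
    using assms(2-4) p by simp
qed

lemma tangent_pullback_paste:
  assumes P: "tangent_pullback X f g a b" and Q: "tangent_pullback X h a c d"
  shows "tangent_pullback X (h \<cdot> f) g c (d \<cdot> b)"
  unfolding tangent_pullback_def
proof
  fix m
  note p = pullback_arrows[OF tangent_pullbackD[OF P]] pullback_arrows[OF tangent_pullbackD[OF Q]]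
  show "pullback X ((TMor X ^^ m) (h \<cdot> f)) ((TMor X ^^ m) g) ((TMor X ^^ m) c) ((TMor X ^^ m) (d \<cdot> b))"
    using pullback_paste[OF P[unfolded tangent_pullback_def, rule_format, of m]
      Q[unfolded tangent_pullback_def, rule_format, of m]] p by simp
qed

lemma tangent_pullback_id:
  assumes "f \<in> Mor X" "Cod X f = A"
  shows "tangent_pullback X f (Id X A) (Id X (Dom X f)) f"
    and "tangent_pullback X (Id X A) f f (Id X (Dom X f))"
proof -
  have that: "pullback X f (Id X A) (Id X (Dom X f)) f" "pullback X (Id X A) f f (Id X (Dom X f))"
    if "f \<in> Mor X" "Cod X f = A" for f A
    using that by (auto intro!: pullbackI)
  then show "tangent_pullback X f (Id X A) (Id X (Dom X f)) f"
    "tangent_pullback X (Id X A) f f (Id X (Dom X f))"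
    using assms that[of "(TMor X ^^ m) f" "(TOb X ^^ m) A" for m]
    unfolding tangent_pullback_def by auto
qed

text \<open>Any two pullbacks of the same cospan are isomorphic, so the chosen one is preserved by the powers
  of \<open>T\<close> as soon as some pullback is.\<close>

lemma tangent_pullback_pb:
  assumes P: "tangent_pullback X f g a b"
  shows "tangent_pullback X f g (fst (pb X f g)) (snd (pb X f g))"
proof -
  let ?c = "fst (pb X f g)" and ?d = "snd (pb X f g)"
  note P0 = tangent_pullbackD[OF P]
  have Q0: "pullback X f g ?c ?d" using P0 pb_choice by blast
  note p = pullback_arrows[OF P0] and q = pullback_arrows[OF Q0]
  obtain i where i: "i \<in> Mor X" "Dom X i = Dom X ?c" "Cod X i = Dom X a" "i \<cdot> a = ?c" "i \<cdot> b = ?d"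
    using pullback_ex[OF P0, of ?c ?d] q by auto
  obtain j where j: "j \<in> Mor X" "Dom X j = Dom X a" "Cod X j = Dom X ?c" "j \<cdot> ?c = a" "j \<cdot> ?d = b"
    using pullback_ex[OF Q0, of a b] p by auto
  have "i \<cdot> j = Id X (Dom X i)" by (rule pullback_mono[OF Q0]) (use i j q in auto)
  moreover have "j \<cdot> i = Id X (Dom X a)" by (rule pullback_mono[OF P0]) (use i j p in auto)
  ultimately have "tangent_pullback X f g (i \<cdot> a) (i \<cdot> b)"
    using i j by (intro tangent_pullback_iso[OF P, of i j]) auto
  then show ?thesis using i by simp
qed

lemma tangent_display_pullback:
  assumes "tangent_display X q" "f \<in> Mor X"
  shows "Cod X f = Cod X q \<Longrightarrow> tangent_pullback X q f (fst (pb X q f)) (snd (pb X q f))"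
    and "Cod X f = TOb X (Cod X q) \<Longrightarrow>
      tangent_pullback X (TMor X q) f (fst (pb X (TMor X q) f)) (snd (pb X (TMor X q) f))"
proof -
  have d: "\<exists>a b. tangent_pullback X ((TMor X ^^ n) q) f a b" if "Cod X f = (TOb X ^^ n) (Cod X q)" for n
    using assms that unfolding tangent_display_def by auto
  show "tangent_pullback X q f (fst (pb X q f)) (snd (pb X q f))" if "Cod X f = Cod X q"
    using d[of 0] that tangent_pullback_pb by auto
  show "tangent_pullback X (TMor X q) f (fst (pb X (TMor X q) f)) (snd (pb X (TMor X q) f))"
    if "Cod X f = TOb X (Cod X q)"
    using d[of 1] that tangent_pullback_pb by auto
qed

lemma fibre_power_ex:
  assumes "fibre_power X n q r \<pi>" "y \<in> Mor X" "Cod X y = Cod X q"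
    "\<And>i. i < n \<Longrightarrow> \<phi> i \<in> Mor X \<and> Dom X (\<phi> i) = Dom X y \<and> Cod X (\<phi> i) = Dom X q \<and> \<phi> i \<cdot> q = y"
  shows "\<exists>h. h \<in> Mor X \<and> Dom X h = Dom X y \<and> Cod X h = Dom X r \<and> h \<cdot> r = y \<and> (\<forall>i<n. h \<cdot> \<pi> i = \<phi> i)"
proof -
  have "\<exists>!h. h \<in> Hom X (Dom X y) (Dom X r) \<and> h \<cdot> r = y \<and> (\<forall>i<n. h \<cdot> \<pi> i = \<phi> i)"
    by (rule assms(1)[unfolded fibre_power_def, THEN conjunct2, THEN conjunct2, THEN conjunct2, rule_format])
      (use assms in auto)
  then show ?thesis by auto
qed

lemma fibre_power_mono:
  assumes F: "fibre_power X n q r \<pi>" and "h \<in> Mor X" "k \<in> Mor X" "Dom X h = Dom X k"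
    "Cod X h = Dom X r" "Cod X k = Dom X r" "h \<cdot> r = k \<cdot> r" "\<And>i. i < n \<Longrightarrow> h \<cdot> \<pi> i = k \<cdot> \<pi> i"
  shows "h = k"
proof -
  have a: "r \<in> Mor X" "Cod X r = Cod X q" "q \<in> Mor X"
    "\<And>i. i < n \<Longrightarrow> \<pi> i \<in> Mor X \<and> Dom X (\<pi> i) = Dom X r \<and> Cod X (\<pi> i) = Dom X q \<and> \<pi> i \<cdot> q = r"
    using F unfolding fibre_power_def by auto
  have "h \<cdot> r \<in> Hom X (Dom X h) (Cod X q)"
    "\<forall>i<n. h \<cdot> \<pi> i \<in> Hom X (Dom X h) (Dom X q) \<and> (h \<cdot> \<pi> i) \<cdot> q = h \<cdot> r"
    using a assms(2-6) by auto
  then have "\<exists>!g. g \<in> Hom X (Dom X h) (Dom X r) \<and> g \<cdot> r = h \<cdot> r \<and> (\<forall>i<n. g \<cdot> \<pi> i = h \<cdot> \<pi> i)"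
    by (intro F[unfolded fibre_power_def, THEN conjunct2, THEN conjunct2, THEN conjunct2, rule_format])
      auto
  moreover have "k \<in> Hom X (Dom X h) (Dom X r) \<and> k \<cdot> r = h \<cdot> r \<and> (\<forall>i<n. k \<cdot> \<pi> i = h \<cdot> \<pi> i)"
    "h \<in> Hom X (Dom X h) (Dom X r)"
    using assms(2-8) by simp_all
  ultimately show ?thesis by metis
qed

lemma fibre_power_two:
  assumes F: "fibre_power X 2 q r \<pi>"
  shows "pullback X q q (\<pi> 0) (\<pi> 1)"
proof -
  have "\<pi> i \<in> Mor X \<and> Dom X (\<pi> i) = Dom X r \<and> Cod X (\<pi> i) = Dom X q \<and> \<pi> i \<cdot> q = r"
    if "i < 2" for i
    using F that unfolding fibre_power_def by auto
  from this[of 0] this[of 1]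
  have a: "\<pi> 0 \<in> Mor X" "\<pi> 1 \<in> Mor X" "Dom X (\<pi> 0) = Dom X r" "Dom X (\<pi> 1) = Dom X r"
    "Cod X (\<pi> 0) = Dom X q" "Cod X (\<pi> 1) = Dom X q" "\<pi> 0 \<cdot> q = r" "\<pi> 1 \<cdot> q = r" by auto
  have q: "q \<in> Mor X" using F unfolding fibre_power_def by auto
  show ?thesis
  proof (rule pullbackI)
    fix x y
    assume xy: "x \<in> Mor X" "y \<in> Mor X" "Dom X x = Dom X y"
      "Cod X x = Dom X q" "Cod X y = Dom X q" "x \<cdot> q = y \<cdot> q"
    define \<phi> where "\<phi> i = (if i = 0 then x else y)" for i :: nat
    have "\<phi> i \<in> Mor X \<and> Dom X (\<phi> i) = Dom X (x \<cdot> q) \<and> Cod X (\<phi> i) = Dom X q \<and> \<phi> i \<cdot> q = x \<cdot> q" for i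
      using xy q by (simp add: \<phi>_def)
    then obtain h where h: "h \<in> Mor X" "Dom X h = Dom X (x \<cdot> q)" "Cod X h = Dom X r"
        "\<forall>i<2. h \<cdot> \<pi> i = \<phi> i"
      using fibre_power_ex[OF F, of "x \<cdot> q" \<phi>] xy q by auto
    have "h \<cdot> \<pi> 0 = x" "h \<cdot> \<pi> 1 = y" using h(4) by (auto simp: \<phi>_def)
    with h xy q show "\<exists>h. h \<in> Mor X \<and> Dom X h = Dom X x \<and> Cod X h = Dom X (\<pi> 0) \<and>
        h \<cdot> \<pi> 0 = x \<and> h \<cdot> \<pi> 1 = y"
      using a by (intro exI[of _ h]) auto
  next
    fix x y
    assume xy: "x \<in> Mor X" "y \<in> Mor X" "Dom X x = Dom X y" "Cod X x = Dom X (\<pi> 0)"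
      "Cod X y = Dom X (\<pi> 0)" "x \<cdot> \<pi> 0 = y \<cdot> \<pi> 0" "x \<cdot> \<pi> 1 = y \<cdot> \<pi> 1"
    have "x \<cdot> r = y \<cdot> r" using a q xy extend[OF xy(6), of q] by simp
    moreover have "x \<cdot> \<pi> i = y \<cdot> \<pi> i" if "i < 2" for i
      using that xy by (cases "i = 0") (auto dest: less_2_cases)
    ultimately show "x = y" using xy a by (intro fibre_power_mono[OF F, of x y]) auto
  qed (use a q in auto)
qed

lemma fibre_power_0:
  assumes "q \<in> Mor X"
  shows "fibre_power X 0 q (Id X (Cod X q)) \<pi>"
  unfolding fibre_power_def
proof (intro conjI allI ballI impI)
  show "\<exists>!h. h \<in> Hom X A (Dom X (Id X (Cod X q))) \<and> h \<cdot> Id X (Cod X q) = y \<and>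
      (\<forall>i<0. h \<cdot> \<pi> i = \<phi> i)"
    if "y \<in> Hom X A (Cod X q)" for A y \<phi>
    by (rule ex1I[of _ y]) (use that assms in \<open>simp, clarsimp\<close>)
qed (use assms in simp_all)

text \<open>The new factor is adjoined by pulling \<open>q\<close> back along the structure map of the \<open>n\<close>-fold power.\<close>

lemma fibre_power_Suc:
  assumes F: "fibre_power X n q r \<pi>" and P: "pullback X q r a b"
    and \<pi>': "\<And>i. i < n \<Longrightarrow> \<pi>' i = b \<cdot> \<pi> i" "\<pi>' n = a"
  shows "fibre_power X (Suc n) q (b \<cdot> r) \<pi>'"
proof -
  note p = pullback_arrows[OF P]
  have a: "\<And>i. i < n \<Longrightarrow> \<pi> i \<in> Mor X \<and> Dom X (\<pi> i) = Dom X r \<and> Cod X (\<pi> i) = Dom X q \<and> \<pi> i \<cdot> q = r"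
    using F unfolding fibre_power_def by auto
  show ?thesis
    unfolding fibre_power_def
  proof (intro conjI allI ballI impI)
    show "q \<in> Mor X" "b \<cdot> r \<in> Hom X (Dom X (b \<cdot> r)) (Cod X q)" using p by auto
    show "\<pi>' i \<in> Hom X (Dom X (b \<cdot> r)) (Dom X q)" "\<pi>' i \<cdot> q = b \<cdot> r" if "i < Suc n" for i
      using that p a[of i] \<pi>' by (auto simp: less_Suc_eq)
    fix A y \<phi>
    assume y: "y \<in> Hom X A (Cod X q)"
      and \<phi>: "\<forall>i<Suc n. \<phi> i \<in> Hom X A (Dom X q) \<and> \<phi> i \<cdot> q = y"
    obtain k where k: "k \<in> Mor X" "Dom X k = Dom X y" "Cod X k = Dom X r" "k \<cdot> r = y"
        "\<forall>i<n. k \<cdot> \<pi> i = \<phi> i"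
      using fibre_power_ex[OF F, of y \<phi>] y \<phi> by auto
    obtain h where h: "h \<in> Mor X" "Dom X h = Dom X y" "Cod X h = Dom X a" "h \<cdot> a = \<phi> n" "h \<cdot> b = k"
      using pullback_ex[OF P, of "\<phi> n" k] k y \<phi> by auto
    show "\<exists>!h. h \<in> Hom X A (Dom X (b \<cdot> r)) \<and> h \<cdot> (b \<cdot> r) = y \<and> (\<forall>i<Suc n. h \<cdot> \<pi>' i = \<phi> i)"
    proof (rule ex1I[of _ h])
      have "h \<cdot> (b \<cdot> r) = y" using extend[OF h(5), of r] h k p by simp
      moreover have "\<forall>i<Suc n. h \<cdot> \<pi>' i = \<phi> i"
      proof (intro allI impI)
        fix i assume "i < Suc n"
        then show "h \<cdot> \<pi>' i = \<phi> i"
        proof (cases "i = n")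
          case False
          then have i: "i < n" using \<open>i < Suc n\<close> by simp
          have "h \<cdot> (b \<cdot> \<pi> i) = k \<cdot> \<pi> i"
            by (rule extend[OF h(5)]) (use h(1,3) p(4,7,8) a[OF i] in simp_all)
          then show ?thesis using i k(5) \<pi>'(1) by simp
        qed (use h(4) \<pi>'(2) in simp)
      qed
      moreover have "h \<in> Hom X A (Dom X (b \<cdot> r))" using h(1-3) y p by simp
      ultimately show "h \<in> Hom X A (Dom X (b \<cdot> r)) \<and> h \<cdot> (b \<cdot> r) = y \<and> (\<forall>i<Suc n. h \<cdot> \<pi>' i = \<phi> i)"
        by blast
    next
      fix g
      assume g: "g \<in> Hom X A (Dom X (b \<cdot> r)) \<and> g \<cdot> (b \<cdot> r) = y \<and> (\<forall>i<Suc n. g \<cdot> \<pi>' i = \<phi> i)"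
      have "g \<cdot> b = k"
      proof (rule fibre_power_mono[OF F])
        show "g \<cdot> b \<cdot> \<pi> i = k \<cdot> \<pi> i" if "i < n" for i
        proof -
          have "g \<cdot> \<pi>' i = \<phi> i" using g that by simp
          then have "g \<cdot> (b \<cdot> \<pi> i) = k \<cdot> \<pi> i" using \<pi>'(1)[OF that] k(5) that by simp
          then show ?thesis using g p a[OF that] by simp
        qed
      qed (use g k(1-4) p y in simp_all)
      then show "g = h" by (intro pullback_mono[OF P, of g h]) (use g h p y \<pi>' in auto)
    qed
  qed
qed

text \<open>The pullbacks of \<open>q\<close> along the structure maps of its own fibre powers exist and are preserved
  because \<open>q\<close> is display.\<close>

lemma tangent_display_fibre_powers:
  assumes q: "tangent_display X q"
  shows "has_fibre_powers X q"
  unfolding has_fibre_powers_def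
proof
  fix n
  have qM: "q \<in> Mor X" using q unfolding tangent_display_def by simp
  show "\<exists>r \<pi>. \<forall>m. fibre_power X n ((TMor X ^^ m) q) ((TMor X ^^ m) r) (\<lambda>i. (TMor X ^^ m) (\<pi> i))"
  proof (induction n)
    case 0
    show ?case
      by (rule exI[of _ "Id X (Cod X q)"]) (use fibre_power_0[of "(TMor X ^^ m) q" for m] qM in auto)
  next
    case (Suc n)
    then obtain r \<pi> where
      F: "\<And>m. fibre_power X n ((TMor X ^^ m) q) ((TMor X ^^ m) r) (\<lambda>i. (TMor X ^^ m) (\<pi> i))" by auto
    have r: "r \<in> Mor X" "Cod X r = Cod X q"
      and \<pi>: "\<And>i. i < n \<Longrightarrow> \<pi> i \<in> Mor X \<and> Dom X (\<pi> i) = Dom X r"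
      using F[of 0] unfolding fibre_power_def by auto
    define a b where "a = fst (pb X q r)" and "b = snd (pb X q r)"
    have P: "tangent_pullback X q r a b"
      using tangent_display_pullback(1)[OF q r] unfolding a_def b_def by simp
    note p = pullback_arrows[OF tangent_pullbackD[OF P]]
    define \<pi>' where "\<pi>' i = (if i < n then b \<cdot> \<pi> i else a)" for i
    have "fibre_power X (Suc n) ((TMor X ^^ m) q) ((TMor X ^^ m) b \<cdot> (TMor X ^^ m) r)
        (\<lambda>i. (TMor X ^^ m) (\<pi>' i))" for m
      by (rule fibre_power_Suc[OF F P[unfolded tangent_pullback_def, rule_format]])
        (use p \<pi> in \<open>auto simp: \<pi>'_def\<close>)
    then show ?case using p by (intro exI[of _ "b \<cdot> r"] exI[of _ \<pi>']) simp
  qed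
qed

lemma fibre_powers_pullback:
  assumes "has_fibre_powers X q"
  shows "tangent_pullback X q q (fst (pb X q q)) (snd (pb X q q))"
proof -
  obtain r \<pi> where
    "\<And>m. fibre_power X 2 ((TMor X ^^ m) q) ((TMor X ^^ m) r) (\<lambda>i. (TMor X ^^ m) (\<pi> i))"
    using assms unfolding has_fibre_powers_def by metis
  then have "tangent_pullback X q q (\<pi> 0) (\<pi> 1)"
    unfolding tangent_pullback_def using fibre_power_two by blast
  then show ?thesis by (rule tangent_pullback_pb)
qed

section \<open>Fibrewise sums of generalised elements\<close>

abbreviation E2 :: "'m dbundle \<Rightarrow> 'm \<times> 'm" where "E2 b \<equiv> pb X (bproj b) (bproj b)"

definition plus :: "'m dbundle \<Rightarrow> 'm \<Rightarrow> 'm \<Rightarrow> 'm" where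
  "plus b x y = pair X (E2 b) x y \<cdot> bsum b"

text \<open>The image of the sum under \<open>T\<close> adds arrows into the total object of \<open>Tq\<close>; its domain is
  \<open>T(E\<^sub>2)\<close>, whose projections are the images of those of \<open>E\<^sub>2\<close>.\<close>

definition Tplus :: "'m dbundle \<Rightarrow> 'm \<Rightarrow> 'm \<Rightarrow> 'm" where
  "Tplus b x y = pair X (TPair X (E2 b)) x y \<cdot> TMor X (bsum b)"

text \<open>The data of a bundle, with just enough conditions for sums of generalised elements to be defined
  and to have the expected projection. The limit bundle is known to be of this kind before its
  algebraic laws are verified.\<close>

definition prebundle :: "'m dbundle \<Rightarrow> bool" where
  "prebundle b \<longleftrightarrow> bproj b \<in> Mor X \<and>
     tangent_pullback X (bproj b) (bproj b) (fst (E2 b)) (snd (E2 b)) \<and>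
     bzero b \<in> Hom X (Cod X (bproj b)) (Dom X (bproj b)) \<and>
     bzero b \<cdot> bproj b = Id X (Cod X (bproj b)) \<and>
     bsum b \<in> Hom X (Dom X (fst (E2 b))) (Dom X (bproj b)) \<and>
     bsum b \<cdot> bproj b = fst (E2 b) \<cdot> bproj b \<and>
     blift b \<in> Hom X (Dom X (bproj b)) (TOb X (Dom X (bproj b)))"

lemma prebundle_arrow [simp]:
  assumes "prebundle b"
  shows "bproj b \<in> Mor X" "bzero b \<in> Mor X" "Dom X (bzero b) = Cod X (bproj b)"
    "Cod X (bzero b) = Dom X (bproj b)" "bzero b \<cdot> bproj b = Id X (Cod X (bproj b))"
    "blift b \<in> Mor X" "Dom X (blift b) = Dom X (bproj b)"
    "Cod X (blift b) = TOb X (Dom X (bproj b))"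
    "bsum b \<in> Mor X" "Dom X (bsum b) = Dom X (fst (E2 b))" "Cod X (bsum b) = Dom X (bproj b)"
  using assms by (auto simp: prebundle_def)

lemma E2_pullback:
  assumes "prebundle b"
  shows "tangent_pullback X (bproj b) (bproj b) (fst (E2 b)) (snd (E2 b))"
    "pullback X (bproj b) (bproj b) (fst (E2 b)) (snd (E2 b))"
    "pullback X (TMor X (bproj b)) (TMor X (bproj b)) (fst (TPair X (E2 b))) (snd (TPair X (E2 b)))"
proof -
  show P: "tangent_pullback X (bproj b) (bproj b) (fst (E2 b)) (snd (E2 b))"
    using assms unfolding prebundle_def by blast
  show "pullback X (bproj b) (bproj b) (fst (E2 b)) (snd (E2 b))"
    by (rule tangent_pullbackD[OF P])
  show "pullback X (TMor X (bproj b)) (TMor X (bproj b)) (fst (TPair X (E2 b))) (snd (TPair X (E2 b)))"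
    using tangent_pullbackD[OF tangent_pullback_T[OF P]] by simp
qed

lemma E2_arrow [simp]:
  assumes "prebundle b"
  shows "fst (E2 b) \<in> Mor X" "snd (E2 b) \<in> Mor X" "Cod X (fst (E2 b)) = Dom X (bproj b)"
    "Cod X (snd (E2 b)) = Dom X (bproj b)" "Dom X (snd (E2 b)) = Dom X (fst (E2 b))"
    "snd (E2 b) \<cdot> bproj b = fst (E2 b) \<cdot> bproj b" "bsum b \<cdot> bproj b = fst (E2 b) \<cdot> bproj b"
  using pullback_arrows(3,4,6,7,8)[OF E2_pullback(2)[OF assms]]
    pullback_arrows(9)[OF E2_pullback(2)[OF assms], symmetric]
  by simp_all (use assms in \<open>auto simp only: prebundle_def\<close>)

text \<open>The condition for two generalised elements to have a sum: they lie in the same fibre.\<close>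

definition parallel :: "'m \<Rightarrow> 'm \<Rightarrow> 'm \<Rightarrow> bool" where
  "parallel q x y \<longleftrightarrow> x \<in> Mor X \<and> y \<in> Mor X \<and> Dom X y = Dom X x \<and>
     Cod X x = Dom X q \<and> Cod X y = Dom X q \<and> x \<cdot> q = y \<cdot> q"

lemma parallelI [intro]:
  "x \<in> Mor X \<Longrightarrow> y \<in> Mor X \<Longrightarrow> Dom X y = Dom X x \<Longrightarrow> Cod X x = Dom X q \<Longrightarrow> Cod X y = Dom X q \<Longrightarrow>
   x \<cdot> q = y \<cdot> q \<Longrightarrow> parallel q x y"
  by (simp add: parallel_def)

lemma parallel_E2 [simp]:
  "prebundle b \<Longrightarrow> parallel (bproj b) (fst (E2 b)) (snd (E2 b))"
  "prebundle b \<Longrightarrow> parallel (bproj b) (snd (E2 b)) (fst (E2 b))"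
  by (auto simp: parallel_def)

lemma parallel_map:
  assumes "parallel q x y" "g \<in> Mor X" "Dom X g = Dom X q" "Cod X g = Dom X q'"
    "q \<in> Mor X" "q' \<in> Mor X" "f \<in> Mor X" "Dom X f = Cod X q" "q \<cdot> f = g \<cdot> q'"
  shows "parallel q' (x \<cdot> g) (y \<cdot> g)"
proof -
  have x: "x \<in> Mor X" "y \<in> Mor X" "Dom X y = Dom X x" "Cod X x = Dom X q" "Cod X y = Dom X q"
    and e: "x \<cdot> q = y \<cdot> q" using assms(1) by (auto simp: parallel_def)
  have "x \<cdot> (q \<cdot> f) = y \<cdot> (q \<cdot> f)" using extend[OF e, of f] x assms by simp
  then show ?thesis using x assms by (intro parallelI) auto
qed

lemma pair_E2:
  assumes b: "prebundle b" and "parallel (bproj b) x y"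
  shows "pair X (E2 b) x y \<in> Mor X" "Dom X (pair X (E2 b) x y) = Dom X x"
    "Cod X (pair X (E2 b) x y) = Dom X (fst (E2 b))"
    "pair X (E2 b) x y \<cdot> fst (E2 b) = x" "pair X (E2 b) x y \<cdot> snd (E2 b) = y"
  using pair_universal[OF E2_pullback(2)[OF b], of x y] assms(2) by (auto simp: parallel_def)

lemma pair_TE2:
  assumes b: "prebundle b" and "parallel (TMor X (bproj b)) x y"
  shows "pair X (TPair X (E2 b)) x y \<in> Mor X" "Dom X (pair X (TPair X (E2 b)) x y) = Dom X x"
    "Cod X (pair X (TPair X (E2 b)) x y) = TOb X (Dom X (fst (E2 b)))"
    "pair X (TPair X (E2 b)) x y \<cdot> TMor X (fst (E2 b)) = x"
    "pair X (TPair X (E2 b)) x y \<cdot> TMor X (snd (E2 b)) = y"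
  using pair_universal[OF E2_pullback(3)[OF b], of x y] assms by (auto simp: parallel_def)

lemma plus_arrow [simp]:
  assumes b: "prebundle b" and xy: "parallel (bproj b) x y"
  shows "plus b x y \<in> Mor X" "Dom X (plus b x y) = Dom X x" "Cod X (plus b x y) = Dom X (bproj b)"
    "plus b x y \<cdot> bproj b = x \<cdot> bproj b"
  using pair_E2[OF assms] b extend[OF pair_E2(4)[OF assms], of "bproj b"]
  by (auto simp: plus_def)

lemma Tplus_arrow [simp]:
  assumes b: "prebundle b" and xy: "parallel (TMor X (bproj b)) x y"
  shows "Tplus b x y \<in> Mor X" "Dom X (Tplus b x y) = Dom X x"
    "Cod X (Tplus b x y) = TOb X (Dom X (bproj b))"
    "Tplus b x y \<cdot> TMor X (bproj b) = x \<cdot> TMor X (bproj b)"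
proof -
  note p = pair_TE2[OF assms]
  show "Tplus b x y \<in> Mor X" "Dom X (Tplus b x y) = Dom X x"
    "Cod X (Tplus b x y) = TOb X (Dom X (bproj b))"
    using p b by (auto simp: Tplus_def)
  have "TMor X (bsum b) \<cdot> TMor X (bproj b) = TMor X (fst (E2 b)) \<cdot> TMor X (bproj b)"
    using b by (simp flip: T_comp)
  then show "Tplus b x y \<cdot> TMor X (bproj b) = x \<cdot> TMor X (bproj b)"
    using p b extend[OF p(4), of "TMor X (bproj b)"] by (simp add: Tplus_def)
qed

lemma comp_plus:
  assumes b: "prebundle b" and xy: "parallel (bproj b) x y" and h: "h \<in> Mor X" "Cod X h = Dom X x"
  shows "h \<cdot> plus b x y = plus b (h \<cdot> x) (h \<cdot> y)"
proof -
  have "h \<cdot> pair X (E2 b) x y = pair X (E2 b) (h \<cdot> x) (h \<cdot> y)"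
    by (rule comp_pair[OF E2_pullback(2)[OF b]]) (use xy h in \<open>auto simp: parallel_def\<close>)
  then show ?thesis
    using pair_E2[OF b xy] b h extend[of h "pair X (E2 b) x y" _ "bsum b"] by (simp add: plus_def)
qed

lemma comp_Tplus:
  assumes b: "prebundle b" and xy: "parallel (TMor X (bproj b)) x y"
    and h: "h \<in> Mor X" "Cod X h = Dom X x"
  shows "h \<cdot> Tplus b x y = Tplus b (h \<cdot> x) (h \<cdot> y)"
proof -
  have "h \<cdot> pair X (TPair X (E2 b)) x y = pair X (TPair X (E2 b)) (h \<cdot> x) (h \<cdot> y)"
    by (rule comp_pair[OF E2_pullback(3)[OF b]]) (use xy h b in \<open>auto simp: parallel_def\<close>)
  then show ?thesis
    using pair_TE2[OF b xy] b h extend[of h "pair X (TPair X (E2 b)) x y" _ "TMor X (bsum b)"]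
    by (simp add: Tplus_def)
qed

lemma sum_eq_plus:
  assumes b: "prebundle b"
  shows "bsum b = plus b (fst (E2 b)) (snd (E2 b))"
    "TMor X (bsum b) = Tplus b (TMor X (fst (E2 b))) (TMor X (snd (E2 b)))"
proof -
  have "pair X (E2 b) (fst (E2 b)) (snd (E2 b)) = Id X (Dom X (fst (E2 b)))"
    by (rule pair_eq[OF E2_pullback(2)[OF b]]) (use b in auto)
  then show "bsum b = plus b (fst (E2 b)) (snd (E2 b))"
    using b by (simp add: plus_def)
  have "pair X (TPair X (E2 b)) (TMor X (fst (E2 b))) (TMor X (snd (E2 b)))
      = Id X (TOb X (Dom X (fst (E2 b))))"
    by (rule pair_eq[OF E2_pullback(3)[OF b]]) (use b in auto)
  then show "TMor X (bsum b) = Tplus b (TMor X (fst (E2 b))) (TMor X (snd (E2 b)))"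
    using b by (simp add: Tplus_def)
qed

lemma parallel_T:
  assumes "parallel q x y" "q \<in> Mor X"
  shows "parallel (TMor X q) (TMor X x) (TMor X y)"
  using assms by (auto simp: parallel_def simp flip: T_comp)

lemma T_plus:
  assumes b: "prebundle b" and xy: "parallel (bproj b) x y"
  shows "TMor X (plus b x y) = Tplus b (TMor X x) (TMor X y)"
proof -
  note p = pair_E2[OF b xy]
  have "pair X (TPair X (E2 b)) (TMor X x) (TMor X y) = TMor X (pair X (E2 b) x y)"
    by (rule pair_eq[OF E2_pullback(3)[OF b]]) (use p b in \<open>auto simp flip: T_comp\<close>)
  then show ?thesis using p b by (simp add: plus_def Tplus_def)
qed

section \<open>Additive and linear maps\<close>

definition additive :: "'m dbundle \<Rightarrow> 'm \<Rightarrow> 'm dbundle \<Rightarrow> bool" where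
  "additive b g b' \<longleftrightarrow>
     bsum b \<cdot> g = plus b' (fst (E2 b) \<cdot> g) (snd (E2 b) \<cdot> g)"

text \<open>A linear morphism without the compatibility with lifts.\<close>

definition bundle_map :: "'m dbundle \<Rightarrow> 'm \<Rightarrow> 'm \<Rightarrow> 'm dbundle \<Rightarrow> bool" where
  "bundle_map b f g b' \<longleftrightarrow>
     f \<in> Hom X (Cod X (bproj b)) (Cod X (bproj b')) \<and>
     g \<in> Hom X (Dom X (bproj b)) (Dom X (bproj b')) \<and> bproj b \<cdot> f = g \<cdot> bproj b'"

lemma bundle_map_arrow:
  assumes "bundle_map b f g b'"
  shows "f \<in> Mor X" "g \<in> Mor X" "Dom X f = Cod X (bproj b)" "Cod X f = Cod X (bproj b')"
    "Dom X g = Dom X (bproj b)" "Cod X g = Dom X (bproj b')" "g \<cdot> bproj b' = bproj b \<cdot> f"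
  using assms by (auto simp: bundle_map_def)

lemma linear_bundle_map: "linear_morphism X b f g b' \<Longrightarrow> bundle_map b f g b'"
  by (simp add: linear_morphism_def bundle_map_def)

lemma linear_lift: "linear_morphism X b f g b' \<Longrightarrow> g \<cdot> blift b' = blift b \<cdot> TMor X g"
  by (simp add: linear_morphism_def)

lemma parallel_bundle_map:
  assumes "prebundle b" "prebundle b'" "bundle_map b f g b'" "parallel (bproj b) x y"
  shows "parallel (bproj b') (x \<cdot> g) (y \<cdot> g)"
  using assms bundle_map_arrow[OF assms(3)] by (intro parallel_map[of "bproj b" _ _ g _ f]) auto

lemma plus_additive:
  assumes b: "prebundle b" "prebundle b'" and m: "bundle_map b f g b'" and a: "additive b g b'"
    and xy: "parallel (bproj b) x y"
  shows "plus b x y \<cdot> g = plus b' (x \<cdot> g) (y \<cdot> g)"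
proof -
  note p = pair_E2[OF b(1) xy] and g = bundle_map_arrow[OF m]
  have "plus b x y \<cdot> g = pair X (E2 b) x y \<cdot> plus b' (fst (E2 b) \<cdot> g) (snd (E2 b) \<cdot> g)"
    using a p g b by (simp add: plus_def additive_def)
  also have "\<dots> = plus b' (pair X (E2 b) x y \<cdot> (fst (E2 b) \<cdot> g)) (pair X (E2 b) x y \<cdot> (snd (E2 b) \<cdot> g))"
    by (rule comp_plus) (use p b g m parallel_bundle_map in auto)
  also have "\<dots> = plus b' (x \<cdot> g) (y \<cdot> g)"
    using p b g extend[OF p(4), of g] extend[OF p(5), of g] by simp
  finally show ?thesis .
qed

lemma Tplus_additive:
  assumes b: "prebundle b" "prebundle b'" and m: "bundle_map b f g b'" and a: "additive b g b'"
    and xy: "parallel (TMor X (bproj b)) x y"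
  shows "Tplus b x y \<cdot> TMor X g = Tplus b' (x \<cdot> TMor X g) (y \<cdot> TMor X g)"
proof -
  note p = pair_TE2[OF b(1) xy] and g = bundle_map_arrow[OF m]
  have q: "parallel (bproj b') (fst (E2 b) \<cdot> g) (snd (E2 b) \<cdot> g)"
    by (rule parallel_bundle_map[OF b m]) (use b in simp)
  have "TMor X (bsum b) \<cdot> TMor X g = TMor X (plus b' (fst (E2 b) \<cdot> g) (snd (E2 b) \<cdot> g))"
    using a g b unfolding additive_def by (metis T_comp prebundle_arrow(9,11))
  then have e: "TMor X (bsum b) \<cdot> TMor X g
      = Tplus b' (TMor X (fst (E2 b)) \<cdot> TMor X g) (TMor X (snd (E2 b)) \<cdot> TMor X g)"
    using T_plus[OF b(2) q] g b by simp
  have "Tplus b x y \<cdot> TMor X g = pair X (TPair X (E2 b)) x y \<cdot>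
      Tplus b' (TMor X (fst (E2 b)) \<cdot> TMor X g) (TMor X (snd (E2 b)) \<cdot> TMor X g)"
    using e p g b by (simp add: Tplus_def)
  also have "\<dots> = Tplus b' (pair X (TPair X (E2 b)) x y \<cdot> (TMor X (fst (E2 b)) \<cdot> TMor X g))
      (pair X (TPair X (E2 b)) x y \<cdot> (TMor X (snd (E2 b)) \<cdot> TMor X g))"
    by (rule comp_Tplus) (use p b g parallel_T[OF q] in auto)
  also have "\<dots> = Tplus b' (x \<cdot> TMor X g) (y \<cdot> TMor X g)"
    using p b g extend[OF p(4), of "TMor X g"] extend[OF p(5), of "TMor X g"] by simp
  finally show ?thesis .
qed

section \<open>Differential bundles without the display condition\<close>

text \<open>The tangent bundle of \<open>M\<close> enters the construction of the vertical and Finsler bundles although its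
  projection is not assumed to be display. Hence the display condition is split off.\<close>

definition core_bundle :: "'m dbundle \<Rightarrow> bool" where
  "core_bundle b \<longleftrightarrow>
     (let q = bproj b; z = bzero b; s = bsum b; l = blift b; E = Dom X q; M = Cod X q in
        has_fibre_powers X q \<and> additive_bundle X q (E2 b) z s \<and>
        l \<in> Hom X E (TOb X E) \<and>
        additive_morphism X (tzero X M) l q (E2 b) z s
          (TMor X q) (TPair X (E2 b)) (TMor X z) (TMor X s) \<and>
        additive_morphism X z l q (E2 b) z s
          (tproj X E) (T2 X E) (tzero X E) (tsum X E) \<and>
        l \<cdot> tlift X E = l \<cdot> TMor X l \<and>
        tangent_pullback X (TMor X q) (tzero X M) (xi X E (E2 b) s l) (fst (E2 b) \<cdot> q))"

lemma differential_bundle_iff: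
  "differential_bundle X b \<longleftrightarrow> tangent_display X (bproj b) \<and> core_bundle b"
  unfolding differential_bundle_def core_bundle_def Let_def by simp

lemma tangent_bundle_simps [simp]:
  "bproj (tangent_bundle X A) = tproj X A" "bzero (tangent_bundle X A) = tzero X A"
  "bsum (tangent_bundle X A) = tsum X A" "blift (tangent_bundle X A) = tlift X A"
  by (auto simp: tangent_bundle_def)

lemma trivial_bundle_simps [simp]:
  "bproj (trivial_bundle X A) = Id X A" "bzero (trivial_bundle X A) = Id X A"
  "bsum (trivial_bundle X A) = fst (pb X (Id X A) (Id X A))" "blift (trivial_bundle X A) = tzero X A"
  by (auto simp: trivial_bundle_def)

lemma core_prebundle: "core_bundle b \<Longrightarrow> prebundle b"
  unfolding core_bundle_def prebundle_def Let_def additive_bundle_def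
  using fibre_powers_pullback by blast

lemma core_lift:
  assumes "core_bundle b"
  shows "blift b \<cdot> TMor X (bproj b) = bproj b \<cdot> tzero X (Cod X (bproj b))"
    "bzero b \<cdot> blift b = tzero X (Cod X (bproj b)) \<cdot> TMor X (bzero b)"
    "bzero b \<cdot> blift b = bzero b \<cdot> tzero X (Dom X (bproj b))"
    "blift b \<cdot> tproj X (Dom X (bproj b)) = bproj b \<cdot> bzero b"
    "blift b \<cdot> tlift X (Dom X (bproj b)) = blift b \<cdot> TMor X (blift b)"
    "bsum b \<cdot> blift b = Tplus b (fst (E2 b) \<cdot> blift b) (snd (E2 b) \<cdot> blift b)"
    "bsum b \<cdot> blift b = plus (tangent_bundle X (Dom X (bproj b)))
       (fst (E2 b) \<cdot> blift b) (snd (E2 b) \<cdot> blift b)"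
  using assms unfolding core_bundle_def Let_def additive_morphism_def Tplus_def plus_def
  by (auto simp: tangent_bundle_def)

lemma core_universal:
  assumes "core_bundle b"
  shows "tangent_pullback X (TMor X (bproj b)) (tzero X (Cod X (bproj b)))
    (Tplus b (fst (E2 b) \<cdot> blift b) (snd (E2 b) \<cdot> tzero X (Dom X (bproj b))))
    (fst (E2 b) \<cdot> bproj b)"
  using assms unfolding core_bundle_def Let_def xi_def Tplus_def by simp

lemma parallel_zero:
  assumes "prebundle b" "x \<in> Mor X" "Cod X x = Dom X (bproj b)"
  shows "parallel (bproj b) (x \<cdot> (bproj b \<cdot> bzero b)) x"
    "parallel (bproj b) x (x \<cdot> (bproj b \<cdot> bzero b))"
  using assms by (auto simp: parallel_def)

lemma plus_zero:
  assumes b: "core_bundle b" and x: "x \<in> Mor X" "Cod X x = Dom X (bproj b)"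
  shows "plus b (x \<cdot> (bproj b \<cdot> bzero b)) x = x" "plus b x (x \<cdot> (bproj b \<cdot> bzero b)) = x"
proof -
  let ?q = "bproj b" let ?z = "bzero b" let ?i = "Id X (Dom X ?q)"
  note pre = core_prebundle[OF b]
  have e: "plus b (?q \<cdot> ?z) ?i = ?i" "plus b ?i (?q \<cdot> ?z) = ?i"
    using b unfolding core_bundle_def Let_def additive_bundle_def plus_def by auto
  have p: "parallel ?q (?q \<cdot> ?z) ?i" "parallel ?q ?i (?q \<cdot> ?z)"
    using pre by (auto simp: parallel_def)
  show "plus b (x \<cdot> (bproj b \<cdot> bzero b)) x = x" "plus b x (x \<cdot> (bproj b \<cdot> bzero b)) = x"
    using comp_plus[OF pre p(1), of x] comp_plus[OF pre p(2), of x] e x pre by simp_all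
qed

lemma plus_commute:
  assumes b: "core_bundle b" and xy: "parallel (bproj b) x y"
  shows "plus b x y = plus b y x"
proof -
  note pre = core_prebundle[OF b]
  note p = pair_E2[OF pre xy]
  have "plus b (snd (E2 b)) (fst (E2 b)) = bsum b"
    using b unfolding core_bundle_def Let_def additive_bundle_def plus_def by auto
  then have "plus b x y = pair X (E2 b) x y \<cdot> plus b (snd (E2 b)) (fst (E2 b))"
    by (simp add: plus_def)
  then show ?thesis
    using comp_plus[OF pre parallel_E2(2)[OF pre] p(1)] p pre by simp
qed

text \<open>The axiom states associativity for the three projections of the triple fibre power; precomposing
  with the arrow induced by \<open>x\<close>, \<open>y\<close>, \<open>w\<close> gives it for arbitrary elements.\<close>

lemma plus_assoc:
  assumes b: "core_bundle b" and xy: "parallel (bproj b) x y" and yw: "parallel (bproj b) y w"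
  shows "plus b (plus b x y) w = plus b x (plus b y w)"
proof -
  note pre = core_prebundle[OF b]
  obtain r \<pi> where F: "fibre_power X 3 (bproj b) r \<pi>"
    and e: "plus b (plus b (\<pi> 0) (\<pi> 1)) (\<pi> 2) = plus b (\<pi> 0) (plus b (\<pi> 1) (\<pi> 2))"
    using b unfolding core_bundle_def Let_def additive_bundle_def plus_def by blast
  have "\<pi> i \<in> Mor X \<and> Dom X (\<pi> i) = Dom X r \<and> Cod X (\<pi> i) = Dom X (bproj b) \<and> \<pi> i \<cdot> bproj b = r"
    if "i < 3" for i
    using F that unfolding fibre_power_def by auto
  from this[of 0] this[of 1] this[of 2]
  have par: "parallel (bproj b) (\<pi> 0) (\<pi> 1)" "parallel (bproj b) (\<pi> 1) (\<pi> 2)"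
    and d: "Dom X (\<pi> 0) = Dom X r" "Dom X (\<pi> 1) = Dom X r"
    by (auto simp: parallel_def)
  have par': "parallel (bproj b) (plus b (\<pi> 0) (\<pi> 1)) (\<pi> 2)"
    "parallel (bproj b) (\<pi> 0) (plus b (\<pi> 1) (\<pi> 2))"
    using par plus_arrow[OF pre par(1)] plus_arrow[OF pre par(2)] unfolding parallel_def by metis+
  define \<phi> where "\<phi> i = (if i = 0 then x else if i = 1 then y else w)" for i :: nat
  have "\<phi> i \<in> Mor X \<and> Dom X (\<phi> i) = Dom X (x \<cdot> bproj b) \<and> Cod X (\<phi> i) = Dom X (bproj b) \<and>
      \<phi> i \<cdot> bproj b = x \<cdot> bproj b" for i
    using xy yw pre by (simp add: \<phi>_def parallel_def)
  then obtain h where h: "h \<in> Mor X" "Cod X h = Dom X r" "\<forall>i<3. h \<cdot> \<pi> i = \<phi> i"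
    using fibre_power_ex[OF F, of "x \<cdot> bproj b" \<phi>] xy pre by (auto simp: parallel_def)
  have h3: "h \<cdot> \<pi> 0 = x" "h \<cdot> \<pi> 1 = y" "h \<cdot> \<pi> 2 = w" using h(3) by (auto simp: \<phi>_def)
  have "h \<cdot> plus b (plus b (\<pi> 0) (\<pi> 1)) (\<pi> 2) = plus b (plus b x y) w"
    using comp_plus[OF pre par'(1) h(1)] comp_plus[OF pre par(1) h(1)] h h3 d pre par by simp
  moreover have "h \<cdot> plus b (\<pi> 0) (plus b (\<pi> 1) (\<pi> 2)) = plus b x (plus b y w)"
    using comp_plus[OF pre par'(2) h(1)] comp_plus[OF pre par(2) h(1)] h h3 d pre par by simp
  ultimately show ?thesis using e by simp
qed

lemma lift_bundle_map:
  assumes "core_bundle b"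
  shows "bundle_map b (bzero b) (blift b) (tangent_bundle X (Dom X (bproj b)))"
    "additive b (blift b) (tangent_bundle X (Dom X (bproj b)))"
  using core_prebundle[OF assms] core_lift[OF assms] by (auto simp: bundle_map_def additive_def)

lemma parallel_lift:
  assumes b: "core_bundle b" and xy: "parallel (bproj b) x y"
  shows "parallel (TMor X (bproj b)) (x \<cdot> blift b) (y \<cdot> blift b)"
    "parallel (tproj X (Dom X (bproj b))) (x \<cdot> blift b) (y \<cdot> blift b)"
  using core_prebundle[OF b] core_lift[OF b] xy
  by (auto intro: parallel_map[of "bproj b" _ _ _ _ "bzero b"]
    parallel_map[of "bproj b" _ _ _ _ "tzero X (Cod X (bproj b))"])

lemma plus_lift_T:
  assumes b: "core_bundle b" and xy: "parallel (bproj b) x y"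
  shows "plus b x y \<cdot> blift b = Tplus b (x \<cdot> blift b) (y \<cdot> blift b)"
proof -
  note pre = core_prebundle[OF b]
  note p = pair_E2[OF pre xy]
  have "plus b x y \<cdot> blift b = pair X (E2 b) x y \<cdot> Tplus b (fst (E2 b) \<cdot> blift b) (snd (E2 b) \<cdot> blift b)"
    using p pre core_lift(6)[OF b] by (simp add: plus_def)
  also have "\<dots> = Tplus b (pair X (E2 b) x y \<cdot> (fst (E2 b) \<cdot> blift b)) (pair X (E2 b) x y \<cdot> (snd (E2 b) \<cdot> blift b))"
    by (rule comp_Tplus) (use p pre parallel_lift[OF b] in auto)
  also have "\<dots> = Tplus b (x \<cdot> blift b) (y \<cdot> blift b)"
    using p pre extend[OF p(4), of "blift b"] extend[OF p(5), of "blift b"] by simp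
  finally show ?thesis .
qed

lemma parallel_xi:
  assumes pre: "prebundle b"
    and l: "blift b \<cdot> TMor X (bproj b) = bproj b \<cdot> tzero X (Cod X (bproj b))"
  shows "parallel (TMor X (bproj b)) (fst (E2 b) \<cdot> blift b) (snd (E2 b) \<cdot> tzero X (Dom X (bproj b)))"
    (is "parallel (TMor X ?q) (_ \<cdot> ?l) (_ \<cdot> tzero X ?E)")
proof
  have "snd (E2 b) \<cdot> (tzero X ?E \<cdot> TMor X ?q) = snd (E2 b) \<cdot> (?q \<cdot> tzero X (Cod X ?q))"
    using tzero_natural[of ?q] pre by simp
  also have "\<dots> = fst (E2 b) \<cdot> (?q \<cdot> tzero X (Cod X ?q))"
    using extend[OF E2_arrow(6)[OF pre], of "tzero X (Cod X ?q)"] pre by simp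
  finally show "(fst (E2 b) \<cdot> ?l) \<cdot> TMor X ?q = (snd (E2 b) \<cdot> tzero X ?E) \<cdot> TMor X ?q"
    using l pre by simp
qed (use pre in auto)

text \<open>The lift of \<open>x\<close> is the value of \<open>\<xi>\<close> at \<open>(x, 0)\<close> and determines the projection of \<open>x\<close>. Since
  \<open>\<xi>\<close> and the projection of \<open>E\<^sub>2\<close> to the base are jointly monic, the lift is monic.\<close>

lemma lift_mono:
  assumes b: "core_bundle b" and x: "x \<in> Mor X" "Cod X x = Dom X (bproj b)"
    and y: "y \<in> Mor X" "Cod X y = Dom X (bproj b)" and d: "Dom X x = Dom X y"
    and e: "x \<cdot> blift b = y \<cdot> blift b"
  shows "x = y"
proof -
  let ?q = "bproj b" let ?z = "bzero b" let ?l = "blift b" let ?E = "Dom X ?q"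
  let ?xi = "Tplus b (fst (E2 b) \<cdot> ?l) (snd (E2 b) \<cdot> tzero X ?E)"
  note pre = core_prebundle[OF b] and L = core_lift[OF b]
  note U = tangent_pullbackD[OF core_universal[OF b]]
  have par: "parallel (TMor X ?q) (fst (E2 b) \<cdot> ?l) (snd (E2 b) \<cdot> tzero X ?E)"
    by (rule parallel_xi[OF pre L(1)])
  have lift: "pair X (E2 b) w (w \<cdot> (?q \<cdot> ?z)) \<cdot> ?xi = w \<cdot> ?l"
    if w: "w \<in> Mor X" "Cod X w = ?E" for w
  proof -
    note pw = pair_E2[OF pre parallel_zero(2)[OF pre w]]
    have "pair X (E2 b) w (w \<cdot> (?q \<cdot> ?z)) \<cdot> ?xi
        = Tplus b (pair X (E2 b) w (w \<cdot> (?q \<cdot> ?z)) \<cdot> (fst (E2 b) \<cdot> ?l))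
            (pair X (E2 b) w (w \<cdot> (?q \<cdot> ?z)) \<cdot> (snd (E2 b) \<cdot> tzero X ?E))"
      by (rule comp_Tplus[OF pre par]) (use pw pre in auto)
    also have "\<dots> = Tplus b (w \<cdot> ?l) (w \<cdot> (?q \<cdot> (?z \<cdot> ?l)))"
      using extend[OF pw(4), of ?l] extend[OF pw(5), of "tzero X ?E"] L(3) pw w pre by simp
    also have "\<dots> = plus b w (w \<cdot> (?q \<cdot> ?z)) \<cdot> ?l"
      using plus_lift_T[OF b parallel_zero(2)[OF pre w]] w pre by simp
    finally show ?thesis using plus_zero(2)[OF b w] by simp
  qed
  have "w \<cdot> ?q = (w \<cdot> ?l) \<cdot> (TMor X ?q \<cdot> tproj X (Cod X ?q))"
    if w: "w \<in> Mor X" "Cod X w = ?E" for w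
  proof -
    have "?q \<cdot> (?z \<cdot> ?q) = ?l \<cdot> (tproj X ?E \<cdot> ?q)"
      using extend[OF L(4), of ?q] pre by simp
    then show ?thesis using w pre tproj_natural[of ?q] by simp
  qed
  then have q: "x \<cdot> ?q = y \<cdot> ?q" using x y e by metis
  note px = pair_E2[OF pre parallel_zero(2)[OF pre x]] and py = pair_E2[OF pre parallel_zero(2)[OF pre y]]
  have "pair X (E2 b) x (x \<cdot> (?q \<cdot> ?z)) = pair X (E2 b) y (y \<cdot> (?q \<cdot> ?z))"
    by (rule pullback_mono[OF U])
      (use px py lift[OF x] lift[OF y] d x y e q pre par extend[OF px(4), of ?q] extend[OF py(4), of ?q]
        in auto)
  then show ?thesis using px(4) py(4) by metis
qed

section \<open>Linear maps are additive\<close>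

text \<open>Projecting along \<open>p\<close> sends the lift of \<open>x\<close> to the zero of its fibre and the zero vector at \<open>x\<close>
  to \<open>x\<close>.\<close>

lemma lift_eq_zero:
  assumes b: "core_bundle b" and x: "x \<in> Mor X" "Cod X x = Dom X (bproj b)"
    and e: "x \<cdot> blift b = x \<cdot> tzero X (Dom X (bproj b))"
  shows "x = x \<cdot> (bproj b \<cdot> bzero b)"
proof -
  note pre = core_prebundle[OF b] and L = core_lift[OF b]
  have z: "tzero X A \<cdot> tproj X A = Id X A" if "A \<in> Ob X" for A
    using tangent_additive[OF that] that by (simp add: additive_bundle_def)
  show ?thesis
    using extend[OF e, of "tproj X (Dom X (bproj b))"] L(4) x pre z by simp
qed

text \<open>The lift of a zero is a zero vector, and \<open>Tg\<close> carries zero vectors to zero vectors; so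
  \<open>lift_eq_zero\<close> applies to the image of the zero section.\<close>

lemma linear_zero:
  assumes b: "core_bundle b" "core_bundle b'" and l: "linear_morphism X b f g b'"
  shows "bzero b \<cdot> g = f \<cdot> bzero b'"
proof -
  note pre = core_prebundle[OF b(1)] core_prebundle[OF b(2)]
    and L = core_lift[OF b(1)] and g = bundle_map_arrow[OF linear_bundle_map[OF l]]
  have "(bzero b \<cdot> g) \<cdot> blift b' = (bzero b \<cdot> g) \<cdot> tzero X (Dom X (bproj b'))"
    using linear_lift[OF l] extend[OF L(3), of "TMor X g"] tzero_natural[of g] g pre by simp
  from lift_eq_zero[OF b(2) _ _ this] show ?thesis
    using g pre extend[OF g(7), of "bzero b'"] extend[OF prebundle_arrow(5)[OF pre(1)], of "f \<cdot> bzero b'"]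
    by simp
qed

lemma tangent_map:
  assumes "f \<in> Mor X"
  shows "linear_morphism X (tangent_bundle X (Dom X f)) f (TMor X f) (tangent_bundle X (Cod X f))"
    "additive (tangent_bundle X (Dom X f)) (TMor X f) (tangent_bundle X (Cod X f))"
  using assms tproj_natural[OF assms] tlift_natural[OF assms] tsum_nat[of f "Dom X f" "Cod X f"]
  by (auto simp: linear_morphism_def additive_def plus_def)

lemma tangent_prebundle [simp]: "A \<in> Ob X \<Longrightarrow> prebundle (tangent_bundle X A)"
  using tangent_additive[of A] fibre_powers_pullback[OF tangent_fibre_powers[of A]]
  unfolding prebundle_def additive_bundle_def by simp

text \<open>The lift is a monomorphism that is additive into the tangent bundle of the total object. Hence
  additivity of \<open>g\<close> follows from that of \<open>Tg\<close>, which is naturality of the sum of the tangent structure.\<close>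

lemma linear_additive:
  assumes b: "core_bundle b" "core_bundle b'" and l: "linear_morphism X b f g b'"
  shows "additive b g b'"
proof -
  let ?x = "fst (E2 b)" let ?y = "snd (E2 b)" let ?E = "Dom X (bproj b)"
  note pre = core_prebundle[OF b(1)] core_prebundle[OF b(2)]
    and m = linear_bundle_map[OF l]
  note g = bundle_map_arrow[OF m]
  have par: "parallel (bproj b') (?x \<cdot> g) (?y \<cdot> g)"
    by (rule parallel_bundle_map[OF pre m]) (use pre in simp)
  have "(bsum b \<cdot> g) \<cdot> blift b' = (bsum b \<cdot> blift b) \<cdot> TMor X g"
    using linear_lift[OF l] g pre by simp
  also have "\<dots> = plus (tangent_bundle X ?E) (?x \<cdot> blift b) (?y \<cdot> blift b) \<cdot> TMor X g"
    using core_lift(7)[OF b(1)] by simp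
  also have "\<dots> = plus (tangent_bundle X (Dom X (bproj b')))
      ((?x \<cdot> blift b) \<cdot> TMor X g) ((?y \<cdot> blift b) \<cdot> TMor X g)"
    using g pre parallel_lift(2)[OF b(1), of ?x ?y] tangent_map[OF g(2)] linear_bundle_map
    by (intro plus_additive) auto
  also have "\<dots> = plus (tangent_bundle X (Dom X (bproj b'))) ((?x \<cdot> g) \<cdot> blift b') ((?y \<cdot> g) \<cdot> blift b')"
    using linear_lift[OF l] g pre by simp
  also have "\<dots> = plus b' (?x \<cdot> g) (?y \<cdot> g) \<cdot> blift b'"
    using plus_additive[OF pre(2) _ lift_bundle_map[OF b(2)] par] pre by simp
  finally have e: "(bsum b \<cdot> g) \<cdot> blift b' = plus b' (?x \<cdot> g) (?y \<cdot> g) \<cdot> blift b'" .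
  have "bsum b \<cdot> g = plus b' (?x \<cdot> g) (?y \<cdot> g)"
    by (rule lift_mono[OF b(2) _ _ _ _ _ e]) (use g pre par in auto)
  then show ?thesis by (simp add: additive_def)
qed

section \<open>Tangent bundles and trivial bundles\<close>

text \<open>Only the additivity of the lift over the zero section is not an axiom. The flip carries \<open>Tp\<close> to
  \<open>p\<close> additively and fixes the lift, so it turns the additivity of \<open>l\<close> as a map to \<open>Tp\<close> into its
  additivity as a map to \<open>p\<close>.\<close>

lemma core_tangent_bundle:
  assumes M: "M \<in> Ob X"
  shows "core_bundle (tangent_bundle X M)"
proof -
  let ?l = "tlift X M" and ?c = "tflip X M" and ?p = "tproj X M" and ?z = "tzero X M"
  let ?P = "T2 X M" and ?T = "tangent_bundle X (TOb X M)"
  note M1 = M TOb_Ob[OF M]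
  note lt = tlift_tflip[OF M] and lc = extend[OF tlift_tflip[OF M]]
  have l: "?p \<cdot> ?z = ?l \<cdot> TMor X ?p" "?z \<cdot> ?l = ?z \<cdot> TMor X ?z"
    "tsum X M \<cdot> ?l = Tplus (tangent_bundle X M) (fst ?P \<cdot> ?l) (snd ?P \<cdot> ?l)"
    using tlift_additive[OF M] M by (auto simp: additive_morphism_def Tplus_def)
  have c: "TMor X ?p = ?c \<cdot> tproj X (TOb X M)" "TMor X ?z \<cdot> ?c = tzero X (TOb X M)"
    "TMor X (tsum X M) \<cdot> ?c = plus ?T (TMor X (fst ?P) \<cdot> ?c) (TMor X (snd ?P) \<cdot> ?c)"
    using tflip_additive[OF M] M by (auto simp: additive_morphism_def plus_def)
  note e2 = E2_arrow[OF tangent_prebundle[OF M], simplified]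
  have par: "parallel (TMor X ?p) (fst ?P \<cdot> ?l) (snd ?P \<cdot> ?l)"
    using extend[OF e2(6), of ?z] e2 M l(1)[symmetric] by (intro parallelI) auto
  have par2: "parallel (tproj X (TOb X M)) (TMor X (fst ?P) \<cdot> ?c) (TMor X (snd ?P) \<cdot> ?c)"
    using parallel_T[OF parallel_E2(1)[OF tangent_prebundle[OF M]]] M M1 c(1)
    by (auto simp: parallel_def)
  have p: "?p \<cdot> ?z = ?l \<cdot> tproj X (TOb X M)"
    using l(1) c(1) lc[of "tproj X (TOb X M)"] M by simp
  have z: "?z \<cdot> ?l = ?z \<cdot> tzero X (TOb X M)"
    using lt c(2) extend[OF l(2), of ?c] M by simp
  have s: "tsum X M \<cdot> ?l = plus ?T (fst ?P \<cdot> ?l) (snd ?P \<cdot> ?l)"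
  proof -
    let ?h = "pair X (TPair X ?P) (fst ?P \<cdot> ?l) (snd ?P \<cdot> ?l)"
    note h = pair_TE2[of "tangent_bundle X M" "fst ?P \<cdot> ?l" "snd ?P \<cdot> ?l", simplified, OF tangent_prebundle[OF M] par]
    have "tsum X M \<cdot> ?l = tsum X M \<cdot> (?l \<cdot> ?c)" using lt by simp
    also have "\<dots> = (?h \<cdot> TMor X (tsum X M)) \<cdot> ?c"
      using extend[OF l(3), of ?c] M by (simp add: Tplus_def)
    also have "\<dots> = ?h \<cdot> plus ?T (TMor X (fst ?P) \<cdot> ?c) (TMor X (snd ?P) \<cdot> ?c)"
      using c(3) h M e2 by simp
    also have "\<dots> = plus ?T (?h \<cdot> (TMor X (fst ?P) \<cdot> ?c)) (?h \<cdot> (TMor X (snd ?P) \<cdot> ?c))"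
      by (rule comp_plus) (use par2 h M e2 in auto)
    also have "\<dots> = plus ?T (fst ?P \<cdot> ?l) (snd ?P \<cdot> ?l)"
      using extend[OF h(4), of ?c] extend[OF h(5), of ?c] lt h M e2 by simp
    finally show ?thesis .
  qed
  have "additive_morphism X ?z ?l ?p ?P ?z (tsum X M)
      (tproj X (TOb X M)) (T2 X (TOb X M)) (tzero X (TOb X M)) (tsum X (TOb X M))"
    using p z s M by (simp add: additive_morphism_def plus_def)
  then show ?thesis
    using tangent_fibre_powers[OF M] tangent_additive[OF M] tlift_additive[OF M] tlift_tlift[OF M]
      tangent_universal[OF M] M unfolding core_bundle_def Let_def by simp
qed

lemma tangent_display_id:
  assumes "A \<in> Ob X"
  shows "tangent_display X (Id X A)"
  unfolding tangent_display_def
proof (intro conjI allI ballI)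
  show "\<exists>a b. tangent_pullback X ((TMor X ^^ n) (Id X A)) f a b"
    if "f \<in> Hom X N ((TOb X ^^ n) (Cod X (Id X A)))" for n N f
    using that assms tangent_pullback_id(2)[of f "(TOb X ^^ n) A"] by auto
qed (use assms in simp)

text \<open>All structure maps are identities up to the isomorphism between \<open>A\<close> and the chosen pullback of
  \<open>id\<close> along itself; the two projections of that pullback coincide.\<close>

lemma differential_trivial_bundle:
  assumes A: "A \<in> Ob X"
  shows "differential_bundle X (trivial_bundle X A)"
proof -
  let ?i = "Id X A" and ?P = "pb X (Id X A) (Id X A)" and ?z = "tzero X A"
  have fp: "has_fibre_powers X ?i" by (rule tangent_display_fibre_powers[OF tangent_display_id[OF A]])
  note P = fibre_powers_pullback[OF fp]
  note P0 = tangent_pullbackD[OF P] and P1 = tangent_pullbackD[OF tangent_pullback_T[OF P]]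
  note p = pullback_arrows[OF P0]
  have s: "snd ?P = fst ?P" using p A by simp
  have pre: "prebundle (trivial_bundle X A)"
    using P p A by (simp add: prebundle_def)
  have pair_fst: "pair X ?P x x \<cdot> fst ?P = x" if "x \<in> Mor X" "Cod X x = A" for x
    using that A pair_universal[OF P0, of x x] by simp
  have P1': "pullback X (Id X (TOb X A)) (Id X (TOb X A)) (fst (TPair X ?P)) (snd (TPair X ?P))"
    using P1 A by simp
  have pairT: "pair X (TPair X ?P) x x \<cdot> TMor X (fst ?P) = x" if "x \<in> Mor X" "Cod X x = TOb X A" for x
    using that A pair_universal[OF P1', of x x] by simp
  let ?j = "pair X ?P ?i ?i"
  have j: "?j \<in> Mor X" "Dom X ?j = A" "Cod X ?j = Dom X (fst ?P)" "?j \<cdot> fst ?P = ?i" "?j \<cdot> snd ?P = ?i"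
    using pair_universal[OF P0, of ?i ?i] A by auto
  have "fst ?P \<cdot> ?j = Id X (Dom X (fst ?P))"
    by (rule pullback_mono[OF P0]) (use j p(3,4,6,8) A s in simp_all)
  then have "tangent_pullback X (Id X (TOb X A)) ?z (fst ?P \<cdot> ?z) (fst ?P \<cdot> Id X (Dom X ?z))"
    by (intro tangent_pullback_iso[OF tangent_pullback_id(2), of _ _ _ ?j])
      (use j p(3,6) A in simp_all)
  then have U: "tangent_pullback X (Id X (TOb X A)) ?z (fst ?P \<cdot> ?z) (fst ?P)"
    using p(3,6) A by simp
  have zp: "?z \<cdot> (tproj X A \<cdot> ?z) = ?z"
    using extend[OF prebundle_arrow(5)[OF tangent_prebundle[OF A], simplified], of ?z] A by simp
  have zz: "plus (tangent_bundle X A) (fst ?P \<cdot> ?z) (fst ?P \<cdot> ?z) = fst ?P \<cdot> ?z"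
    using plus_zero(1)[OF core_tangent_bundle[OF A], of "fst ?P \<cdot> ?z"] zp p A by simp
  have zl: "?z \<cdot> tlift X A = ?z \<cdot> TMor X ?z"
    using core_lift(2)[OF core_tangent_bundle[OF A]] A by simp
  have "additive_bundle X ?i ?P ?i (fst ?P)"
  proof -
    have "pair X ?P (pair X ?P (\<pi> 0) (\<pi> 1) \<cdot> fst ?P) (\<pi> 2) \<cdot> fst ?P
        = pair X ?P (\<pi> 0) (pair X ?P (\<pi> 1) (\<pi> 2) \<cdot> fst ?P) \<cdot> fst ?P"
      if F: "fibre_power X 3 ?i r \<pi>" for r \<pi>
    proof -
      have "\<pi> i = r" if "i < 3" for i
        using F that A unfolding fibre_power_def by auto
      then have "\<pi> 0 = r" "\<pi> 1 = r" "\<pi> 2 = r" by simp_all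
      moreover have "r \<in> Mor X" "Cod X r = A" using F A unfolding fibre_power_def by auto
      ultimately show ?thesis using pair_fst by simp
    qed
    moreover have "\<exists>r \<pi>. fibre_power X 3 ?i r \<pi>"
      using fp unfolding has_fibre_powers_def by (metis funpow_0)
    ultimately show ?thesis
      using P0 pair_fst p A s unfolding additive_bundle_def by simp
  qed
  then have "core_bundle (trivial_bundle X A)"
    using fp p A s pairT zz zl U prebundle_arrow(5)[OF tangent_prebundle[OF A]]
    unfolding core_bundle_def Let_def additive_morphism_def xi_def by (simp add: plus_def)
  then show ?thesis
    using tangent_display_id[OF A] by (simp add: differential_bundle_iff)
qed

lemma core_trivial: "A \<in> Ob X \<Longrightarrow> core_bundle (trivial_bundle X A)"
  using differential_trivial_bundle[of A] by (simp add: differential_bundle_iff)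

lemma plus_trivial:
  assumes "x \<in> Mor X" "Cod X x = A"
  shows "plus (trivial_bundle X A) x x = x"
proof -
  have A: "A \<in> Ob X" using assms by auto
  from plus_zero(1)[OF core_trivial[OF A], of x] show ?thesis using assms A by simp
qed

section \<open>Operations on linear maps over a fixed base\<close>

lemma linear_comp:
  assumes A: "A \<in> Ob X" and b: "prebundle b" "prebundle b'" "prebundle b''"
    and g: "linear_morphism X b (Id X A) g b'" and h: "linear_morphism X b' (Id X A) h b''"
  shows "linear_morphism X b (Id X A) (g \<cdot> h) b''"
proof -
  note mg = bundle_map_arrow[OF linear_bundle_map[OF g]]
    and mh = bundle_map_arrow[OF linear_bundle_map[OF h]]
  have A: "Cod X (bproj b) = A" "Cod X (bproj b') = A" "Cod X (bproj b'') = A"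
    using mg mh A by auto
  have "g \<cdot> (h \<cdot> blift b'') = blift b \<cdot> (TMor X g \<cdot> TMor X h)"
    using linear_lift[OF h] extend[OF linear_lift[OF g], of "TMor X h"] mg mh b by simp
  moreover have "(g \<cdot> h) \<cdot> bproj b'' = bproj b"
    using mg mh b A \<open>A \<in> Ob X\<close> by simp
  ultimately show ?thesis
    using mg mh b A \<open>A \<in> Ob X\<close> by (simp add: linear_morphism_def)
qed

lemma linear_projection:
  assumes "core_bundle b"
  shows "linear_morphism X b (Id X (Cod X (bproj b))) (bproj b) (trivial_bundle X (Cod X (bproj b)))"
  using core_prebundle[OF assms] core_lift(1)[OF assms] by (simp add: linear_morphism_def)

lemma linear_zero_section:
  assumes "core_bundle b"
  shows "linear_morphism X (trivial_bundle X (Cod X (bproj b))) (Id X (Cod X (bproj b))) (bzero b) b"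
  using core_prebundle[OF assms] core_lift(2)[OF assms] by (simp add: linear_morphism_def)

text \<open>The lift of \<open>c\<close> is additive as a map to \<open>Tq\<close> and \<open>T\<close> sends the sum of \<open>c\<close> to the sum of \<open>Tq\<close>, so the
  equations expressing linearity of \<open>g\<close> and \<open>h\<close> can be added.\<close>

lemma linear_plus:
  assumes b: "core_bundle b" and c: "core_bundle c"
    and g: "linear_morphism X b f g c" and h: "linear_morphism X b f h c"
  shows "linear_morphism X b f (plus c g h) c" "parallel (bproj c) g h"
proof -
  note pre = core_prebundle[OF b] core_prebundle[OF c]
  note mg = bundle_map_arrow[OF linear_bundle_map[OF g]]
    and mh = bundle_map_arrow[OF linear_bundle_map[OF h]]
  show p: "parallel (bproj c) g h" using mg mh by (intro parallelI) auto
  have "plus c g h \<cdot> blift c = Tplus c (g \<cdot> blift c) (h \<cdot> blift c)"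
    by (rule plus_lift_T[OF c p])
  also have "\<dots> = blift b \<cdot> Tplus c (TMor X g) (TMor X h)"
    using comp_Tplus[OF pre(2) parallel_T[OF p], of "blift b"] linear_lift[OF g] linear_lift[OF h] pre mg
    by simp
  also have "\<dots> = blift b \<cdot> TMor X (plus c g h)"
    using T_plus[OF pre(2) p] by simp
  finally have "plus c g h \<cdot> blift c = blift b \<cdot> TMor X (plus c g h)" .
  then show "linear_morphism X b f (plus c g h) c"
    using mg p pre by (simp add: linear_morphism_def)
qed

section \<open>Limits of differential bundles\<close>

text \<open>The map \<open>\<xi>\<close> of a bundle, written with sums of elements.\<close>

definition Xi :: "'m dbundle \<Rightarrow> 'm" where
  "Xi b = Tplus b (fst (E2 b) \<cdot> blift b) (snd (E2 b) \<cdot> tzero X (Dom X (bproj b)))"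

lemma Xi_arrow:
  assumes pre: "prebundle b"
    and l: "blift b \<cdot> TMor X (bproj b) = bproj b \<cdot> tzero X (Cod X (bproj b))"
  shows "Xi b \<in> Mor X" "Dom X (Xi b) = Dom X (fst (E2 b))" "Cod X (Xi b) = TOb X (Dom X (bproj b))"
    "Xi b \<cdot> TMor X (bproj b) = fst (E2 b) \<cdot> (bproj b \<cdot> tzero X (Cod X (bproj b)))"
  using Tplus_arrow[OF pre parallel_xi[OF pre l]] pre l by (auto simp: Xi_def)

lemma Xi_natural:
  assumes pre: "prebundle b" "prebundle b'"
    and l: "blift b \<cdot> TMor X (bproj b) = bproj b \<cdot> tzero X (Cod X (bproj b))"
      "blift b' \<cdot> TMor X (bproj b') = bproj b' \<cdot> tzero X (Cod X (bproj b'))"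
    and g: "linear_morphism X b f g b'" and a: "additive b g b'"
  shows "Xi b \<cdot> TMor X g = pair X (E2 b') (fst (E2 b) \<cdot> g) (snd (E2 b) \<cdot> g) \<cdot> Xi b'"
proof -
  let ?k = "pair X (E2 b') (fst (E2 b) \<cdot> g) (snd (E2 b) \<cdot> g)"
  note m = linear_bundle_map[OF g]
  note g' = bundle_map_arrow[OF m]
  have "parallel (bproj b') (fst (E2 b) \<cdot> g) (snd (E2 b) \<cdot> g)"
    by (rule parallel_bundle_map[OF pre m]) (use pre in simp)
  note k = pair_E2[OF pre(2) this]
  have z: "tzero X (Dom X (bproj b)) \<cdot> TMor X g = g \<cdot> tzero X (Dom X (bproj b'))"
    using tzero_natural[of g] g' by simp
  have "Xi b \<cdot> TMor X g = Tplus b' ((fst (E2 b) \<cdot> blift b) \<cdot> TMor X g)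
      ((snd (E2 b) \<cdot> tzero X (Dom X (bproj b))) \<cdot> TMor X g)"
    unfolding Xi_def by (rule Tplus_additive[OF pre m a parallel_xi[OF pre(1) l(1)]])
  also have "\<dots> = Tplus b' (?k \<cdot> (fst (E2 b') \<cdot> blift b')) (?k \<cdot> (snd (E2 b') \<cdot> tzero X (Dom X (bproj b'))))"
    using extend[OF k(4), of "blift b'"] extend[OF k(5), of "tzero X (Dom X (bproj b'))"]
      linear_lift[OF g] z pre g' k by simp
  also have "\<dots> = ?k \<cdot> Xi b'"
    unfolding Xi_def
    by (rule comp_Tplus[OF pre(2) parallel_xi[OF pre(2) l(2)], symmetric]) (use k pre g' in auto)
  finally show ?thesis .
qed

text \<open>The limit of a cospan \<open>b\<^sub>1 \<rightarrow> b\<^sub>2 \<leftarrow> b\<^sub>3\<close> of bundles lying over \<open>E \<rightarrow> M = M\<close>. Its base is \<open>E\<close>, its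
  total object is the pullback of the total objects, and its structure is given componentwise.
  Every equation holds because it holds after the two projections \<open>a\<close> and \<open>c\<close>, which are jointly
  monic and remain so after applying \<open>T\<close>.\<close>

lemma limit_bundle:
  assumes b1: "core_bundle b1" and b2: "core_bundle b2" and b3: "core_bundle b3"
    and g: "linear_morphism X b1 q g b2" and h: "linear_morphism X b3 (Id X M) h b2"
    and M: "M \<in> Ob X"
    and P: "tangent_pullback X g h a c"
    and pre: "prebundle b" and fp: "has_fibre_powers X (bproj b)"
    and r: "a \<cdot> bproj b1 = bproj b"
    and z: "bzero b \<cdot> a = bzero b1" "bzero b \<cdot> c = q \<cdot> bzero b3"
    and s: "additive b a b1" "additive b c b3"
    and l: "blift b \<cdot> TMor X a = a \<cdot> blift b1" "blift b \<cdot> TMor X c = c \<cdot> blift b3"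
  shows "core_bundle b"
proof -
  let ?E = "Cod X (bproj b)" and ?B = "Dom X (bproj b)"
  note pre1 = core_prebundle[OF b1] and pre2 = core_prebundle[OF b2] and pre3 = core_prebundle[OF b3]
  note pr = pre pre1 pre2 pre3
  note P0 = tangent_pullbackD[OF P] and P1 = tangent_pullbackD[OF tangent_pullback_T[OF P]]
    and P2 = tangent_pullbackD[OF tangent_pullback_T[OF tangent_pullback_T[OF P]]]
  note p = pullback_arrows[OF P0]
  note ga = bundle_map_arrow[OF linear_bundle_map[OF g]]
    and ha = bundle_map_arrow[OF linear_bundle_map[OF h]]
  note L1 = core_lift[OF b1] and L2 = core_lift[OF b2] and L3 = core_lift[OF b3]
  have d: "Cod X (bproj b1) = ?E" "Dom X a = ?B" "Cod X (bproj b2) = M" "Cod X (bproj b3) = M"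
    "Cod X q = M" "Dom X q = ?E" "Cod X a = Dom X (bproj b1)" "Cod X c = Dom X (bproj b3)"
    "Dom X c = ?B"
    using p pr ga ha M comp_arrow[of a "bproj b1", unfolded r] by auto
  have E: "?E \<in> Ob X" "?B \<in> Ob X" using pr by auto
  have rx: "a \<cdot> (bproj b1 \<cdot> k) = bproj b \<cdot> k" if "k \<in> Mor X" "Dom X k = ?E" for k
    using extend[OF r, of k] that p d pr by simp
  have rc: "c \<cdot> bproj b3 = bproj b \<cdot> q"
  proof -
    have "bproj b \<cdot> q = a \<cdot> (g \<cdot> bproj b2)" using rx[of q] ga p pr d by simp
    also have "\<dots> = c \<cdot> (h \<cdot> bproj b2)"
      using extend[OF p(9), of "bproj b2"] ga p pr ha by simp
    also have "\<dots> = c \<cdot> bproj b3" using ha d pr by simp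
    finally show ?thesis ..
  qed
  have linA: "linear_morphism X b (Id X ?E) a b1" and linC: "linear_morphism X b q c b3"
    using p pr d r rc l E ga ha by (auto simp: linear_morphism_def)
  note mA = linear_bundle_map[OF linA] and mC = linear_bundle_map[OF linC]
  have mono: "x = y" if "x \<in> Mor X" "y \<in> Mor X" "Dom X x = Dom X y" "Cod X x = ?B" "Cod X y = ?B"
    "x \<cdot> a = y \<cdot> a" "x \<cdot> c = y \<cdot> c" for x y
    by (rule pullback_mono[OF P0]) (use that d in auto)
  have monoT: "x = y" if "x \<in> Mor X" "y \<in> Mor X" "Dom X x = Dom X y" "Cod X x = TOb X ?B"
    "Cod X y = TOb X ?B" "x \<cdot> TMor X a = y \<cdot> TMor X a" "x \<cdot> TMor X c = y \<cdot> TMor X c" for x y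
    by (rule pullback_mono[OF P1]) (use that d p in auto)
  have monoTT: "x = y" if "x \<in> Mor X" "y \<in> Mor X" "Dom X x = Dom X y"
    "Cod X x = TOb X (TOb X ?B)" "Cod X y = TOb X (TOb X ?B)"
    "x \<cdot> TMor X (TMor X a) = y \<cdot> TMor X (TMor X a)"
    "x \<cdot> TMor X (TMor X c) = y \<cdot> TMor X (TMor X c)" for x y
    by (rule pullback_mono[OF P2]) (use that d p in auto)
  have pa: "plus b x y \<cdot> a = plus b1 (x \<cdot> a) (y \<cdot> a)" "plus b x y \<cdot> c = plus b3 (x \<cdot> c) (y \<cdot> c)"
    "parallel (bproj b1) (x \<cdot> a) (y \<cdot> a)" "parallel (bproj b3) (x \<cdot> c) (y \<cdot> c)"
    if "parallel (bproj b) x y" for x y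
    using plus_additive[OF pre pre1 mA s(1) that] plus_additive[OF pre pre3 mC s(2) that]
      parallel_bundle_map[OF pre pre1 mA that] parallel_bundle_map[OF pre pre3 mC that] by auto
  have plusE: "plus b x y = w"
    if "parallel (bproj b) x y" "w \<in> Mor X" "Dom X w = Dom X x" "Cod X w = ?B"
      "plus b1 (x \<cdot> a) (y \<cdot> a) = w \<cdot> a" "plus b3 (x \<cdot> c) (y \<cdot> c) = w \<cdot> c" for x y w
    by (rule mono) (use that pa pre in auto)
  let ?i = "Id X ?B" and ?q = "bproj b" and ?z = "bzero b" and ?l = "blift b"
  let ?x = "fst (E2 b)" and ?y = "snd (E2 b)"
  have unit: "plus b (?q \<cdot> ?z) ?i = ?i" "plus b ?i (?q \<cdot> ?z) = ?i"
  proof -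
    have za: "(?q \<cdot> ?z) \<cdot> a = a \<cdot> (bproj b1 \<cdot> bzero b1)" using z rx p d pr by simp
    have zc: "(?q \<cdot> ?z) \<cdot> c = c \<cdot> (bproj b3 \<cdot> bzero b3)"
      using z extend[OF rc, of "bzero b3"] p d pr ga by simp
    have "parallel ?q (?q \<cdot> ?z) ?i" "parallel ?q ?i (?q \<cdot> ?z)"
      using parallel_zero[OF pre, of ?i] E pre by simp_all
    then show "plus b (?q \<cdot> ?z) ?i = ?i" "plus b ?i (?q \<cdot> ?z) = ?i"
      using plus_zero[OF b1, of a] plus_zero[OF b3, of c] za zc p d E pre by (auto intro!: plusE)
  qed
  have commute: "plus b ?y ?x = bsum b"
  proof (rule plusE)
    have e: "bsum b = plus b ?x ?y" by (rule sum_eq_plus[OF pre])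
    show "plus b1 (?y \<cdot> a) (?x \<cdot> a) = bsum b \<cdot> a" "plus b3 (?y \<cdot> c) (?x \<cdot> c) = bsum b \<cdot> c"
      using e pa[of ?x ?y] plus_commute[OF b1 pa(3)] plus_commute[OF b3 pa(4)] pre by auto
  qed (use pre in auto)
  have assoc: "plus b (plus b x y) w = plus b x (plus b y w)"
    if xy: "parallel ?q x y" and yw: "parallel ?q y w" for x y w
  proof (rule plusE)
    have par: "parallel ?q x (plus b y w)" "parallel ?q (plus b x y) w"
      using xy yw plus_arrow[OF pre xy] plus_arrow[OF pre yw] unfolding parallel_def by auto
    then show "parallel ?q (plus b x y) w" "plus b x (plus b y w) \<in> Mor X"
      "Dom X (plus b x (plus b y w)) = Dom X (plus b x y)" "Cod X (plus b x (plus b y w)) = ?B"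
      using xy pre by auto
    show "plus b1 (plus b x y \<cdot> a) (w \<cdot> a) = plus b x (plus b y w) \<cdot> a"
      "plus b3 (plus b x y \<cdot> c) (w \<cdot> c) = plus b x (plus b y w) \<cdot> c"
      using pa[OF xy] pa[OF yw] pa[OF par(1)] plus_assoc[OF b1] plus_assoc[OF b3] by auto
  qed
  have add: "additive_bundle X ?q (E2 b) ?z (bsum b)"
  proof -
    have "\<exists>r \<pi>. fibre_power X 3 ?q r \<pi>"
      using fp unfolding has_fibre_powers_def by (metis funpow_0)
    moreover have "plus b (plus b (\<pi> 0) (\<pi> 1)) (\<pi> 2) = plus b (\<pi> 0) (plus b (\<pi> 1) (\<pi> 2))"
      if F: "fibre_power X 3 ?q r \<pi>" for r \<pi>
    proof -
      have "\<pi> i \<in> Mor X \<and> Dom X (\<pi> i) = Dom X r \<and> Cod X (\<pi> i) = ?B \<and> \<pi> i \<cdot> ?q = r"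
        if "i < 3" for i
        using F that unfolding fibre_power_def by auto
      from this[of 0] this[of 1] this[of 2] show ?thesis
        by (intro assoc) (auto simp: parallel_def)
    qed
    ultimately show ?thesis
      using unit commute E2_pullback(2)[OF pre] pre
      unfolding additive_bundle_def plus_def[symmetric] by auto
  qed
  have lift_over: "?l \<cdot> TMor X ?q = ?q \<cdot> tzero X ?E"
    using extend[OF l(1), of "TMor X (bproj b1)"] L1(1) rx p d pr E
      T_comp[of a "bproj b1", unfolded r] by simp
  have zero_lift: "?z \<cdot> ?l = tzero X ?E \<cdot> TMor X ?z"
  proof (rule monoT)
    have "TMor X ?z \<cdot> TMor X a = TMor X (bzero b1)"
      using z(1) pr p d by (simp flip: T_comp)
    then show "(?z \<cdot> ?l) \<cdot> TMor X a = (tzero X ?E \<cdot> TMor X ?z) \<cdot> TMor X a"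
      using extend[OF z(1), of "blift b1"] L1(2) l(1) pr p d E by simp
    have "TMor X ?z \<cdot> TMor X c = TMor X q \<cdot> TMor X (bzero b3)"
      using z(2) pr p d ga by (simp flip: T_comp)
    then show "(?z \<cdot> ?l) \<cdot> TMor X c = (tzero X ?E \<cdot> TMor X ?z) \<cdot> TMor X c"
      using extend[OF z(2), of "blift b3"] L3(2) l(2) pr p d E ga M
        extend[OF tzero_natural[of q], of "TMor X (bzero b3)"] by simp
  qed (use pr E in auto)
  have zero_lift': "?z \<cdot> ?l = ?z \<cdot> tzero X ?B"
    using zero_lift tzero_natural[of ?z] pre by simp
  have par_lift: "parallel (TMor X ?q) (?x \<cdot> ?l) (?y \<cdot> ?l)"
    using parallel_map[of ?q ?x ?y ?l "TMor X ?q" "tzero X ?E"] pre lift_over E by simp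
  have lift_p: "?l \<cdot> tproj X ?B = ?q \<cdot> ?z"
  proof (rule mono)
    show "(?l \<cdot> tproj X ?B) \<cdot> a = (?q \<cdot> ?z) \<cdot> a"
      using tproj_natural[of a] extend[OF l(1), of "tproj X (Dom X (bproj b1))"] L1(4) rx z(1) pr p d E
      by simp
    show "(?l \<cdot> tproj X ?B) \<cdot> c = (?q \<cdot> ?z) \<cdot> c"
      using tproj_natural[of c] extend[OF l(2), of "tproj X (Dom X (bproj b3))"] L3(4) z(2) pr p d E ga
        extend[OF rc, of "bzero b3"] by simp
  qed (use pr E in auto)
  have par_lift': "parallel (tproj X ?B) (?x \<cdot> ?l) (?y \<cdot> ?l)"
    using parallel_map[of ?q ?x ?y ?l "tproj X ?B" ?z] pre lift_p E by simp
  have sa: "bsum b \<cdot> a = plus b1 (?x \<cdot> a) (?y \<cdot> a)" "bsum b \<cdot> c = plus b3 (?x \<cdot> c) (?y \<cdot> c)"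
    using s by (auto simp: additive_def)
  note pax = pa(3,4)[OF parallel_E2(1)[OF pre]]
  have sl: "(bsum b \<cdot> ?l) \<cdot> TMor X a = plus b1 (?x \<cdot> a) (?y \<cdot> a) \<cdot> blift b1"
     "(bsum b \<cdot> ?l) \<cdot> TMor X c = plus b3 (?x \<cdot> c) (?y \<cdot> c) \<cdot> blift b3"
    using extend[OF sa(1), of "blift b1"] extend[OF sa(2), of "blift b3"] l pr p d by simp_all
  have sum_T: "bsum b \<cdot> ?l = Tplus b (?x \<cdot> ?l) (?y \<cdot> ?l)"
  proof (rule monoT)
    have "Tplus b (?x \<cdot> ?l) (?y \<cdot> ?l) \<cdot> TMor X a = Tplus b1 ((?x \<cdot> ?l) \<cdot> TMor X a) ((?y \<cdot> ?l) \<cdot> TMor X a)"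
      by (rule Tplus_additive[OF pre pre1 mA s(1) par_lift])
    then show "(bsum b \<cdot> ?l) \<cdot> TMor X a = Tplus b (?x \<cdot> ?l) (?y \<cdot> ?l) \<cdot> TMor X a"
      using sl(1) plus_lift_T[OF b1 pax(1)] l pr p d by simp
    have "Tplus b (?x \<cdot> ?l) (?y \<cdot> ?l) \<cdot> TMor X c = Tplus b3 ((?x \<cdot> ?l) \<cdot> TMor X c) ((?y \<cdot> ?l) \<cdot> TMor X c)"
      by (rule Tplus_additive[OF pre pre3 mC s(2) par_lift])
    then show "(bsum b \<cdot> ?l) \<cdot> TMor X c = Tplus b (?x \<cdot> ?l) (?y \<cdot> ?l) \<cdot> TMor X c"
      using sl(2) plus_lift_T[OF b3 pax(2)] l pr p d by simp
  qed (use pr E par_lift in auto)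
  have plus_lift: "plus c x y \<cdot> blift c = plus (tangent_bundle X (Dom X (bproj c))) (x \<cdot> blift c) (y \<cdot> blift c)"
    if "core_bundle c" "parallel (bproj c) x y" for c x y
    using plus_additive[OF core_prebundle[OF that(1)] _ lift_bundle_map[OF that(1)] that(2)]
      core_prebundle[OF that(1)] by simp
  have sum_p: "bsum b \<cdot> ?l = plus (tangent_bundle X ?B) (?x \<cdot> ?l) (?y \<cdot> ?l)"
  proof (rule monoT)
    have "plus (tangent_bundle X ?B) (?x \<cdot> ?l) (?y \<cdot> ?l) \<cdot> TMor X a
        = plus (tangent_bundle X (Dom X (bproj b1))) ((?x \<cdot> ?l) \<cdot> TMor X a) ((?y \<cdot> ?l) \<cdot> TMor X a)"
      using tangent_map[of a] linear_bundle_map par_lift' p d pr E by (intro plus_additive) auto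
    then show "(bsum b \<cdot> ?l) \<cdot> TMor X a = plus (tangent_bundle X ?B) (?x \<cdot> ?l) (?y \<cdot> ?l) \<cdot> TMor X a"
      using sl(1) plus_lift[OF b1 pax(1)] l pr p d by simp
    have "plus (tangent_bundle X ?B) (?x \<cdot> ?l) (?y \<cdot> ?l) \<cdot> TMor X c
        = plus (tangent_bundle X (Dom X (bproj b3))) ((?x \<cdot> ?l) \<cdot> TMor X c) ((?y \<cdot> ?l) \<cdot> TMor X c)"
      using tangent_map[of c] linear_bundle_map par_lift' p d pr E by (intro plus_additive) auto
    then show "(bsum b \<cdot> ?l) \<cdot> TMor X c = plus (tangent_bundle X ?B) (?x \<cdot> ?l) (?y \<cdot> ?l) \<cdot> TMor X c"
      using sl(2) plus_lift[OF b3 pax(2)] l pr p d by simp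
  qed (use pr E plus_arrow[of "tangent_bundle X ?B", simplified, OF tangent_prebundle[OF E(2)] par_lift'] in auto)
  have coassoc: "?l \<cdot> tlift X ?B = ?l \<cdot> TMor X ?l"
  proof (rule monoTT)
    have Tl: "TMor X ?l \<cdot> TMor X (TMor X a) = TMor X a \<cdot> TMor X (blift b1)"
      "TMor X ?l \<cdot> TMor X (TMor X c) = TMor X c \<cdot> TMor X (blift b3)"
      using l pr p d by (simp_all flip: T_comp)
    show "(?l \<cdot> tlift X ?B) \<cdot> TMor X (TMor X a) = (?l \<cdot> TMor X ?l) \<cdot> TMor X (TMor X a)"
      using tlift_natural[of a] extend[OF l(1), of "tlift X (Dom X (bproj b1))"]
        extend[OF l(1), of "TMor X (blift b1)"] L1(5) Tl pr p d E by simp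
    show "(?l \<cdot> tlift X ?B) \<cdot> TMor X (TMor X c) = (?l \<cdot> TMor X ?l) \<cdot> TMor X (TMor X c)"
      using tlift_natural[of c] extend[OF l(2), of "tlift X (Dom X (bproj b3))"]
        extend[OF l(2), of "TMor X (blift b3)"] L3(5) Tl pr p d E by simp
  qed (use pr E in auto)
  \<comment> \<open>Pullbacks commute with pullbacks, twice: first the double fibre power of the limit is the
    limit of the double fibre powers, and then the square of its \<open>\<xi>\<close> is the limit of the three
    squares of \<open>\<xi>\<close>.\<close>
  define G H A C where "G = pair X (E2 b2) (fst (E2 b1) \<cdot> g) (snd (E2 b1) \<cdot> g)"
    and "H = pair X (E2 b2) (fst (E2 b3) \<cdot> h) (snd (E2 b3) \<cdot> h)"
    and "A = pair X (E2 b1) (?x \<cdot> a) (?y \<cdot> a)" and "C = pair X (E2 b3) (?x \<cdot> c) (?y \<cdot> c)"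
  note Ga = pair_E2[OF pre2 parallel_bundle_map[OF pre1 pre2 linear_bundle_map[OF g] parallel_E2(1)[OF pre1]], folded G_def]
    and Ha = pair_E2[OF pre2 parallel_bundle_map[OF pre3 pre2 linear_bundle_map[OF h] parallel_E2(1)[OF pre3]], folded H_def]
    and Aa = pair_E2[OF pre1 pax(1), folded A_def] and Ca = pair_E2[OF pre3 pax(2), folded C_def]
  have base: "tangent_pullback X q (Id X M) (Id X ?E) q"
    using tangent_pullback_id(1)[of q M] ga d by simp
  have TPE: "tangent_pullback X G H A C"
    by (rule tangent_pullback_of_pullbacks[OF P base P E2_pullback(1)[OF pre1] E2_pullback(1)[OF pre3]
      E2_pullback(1)[OF pre] E2_pullback(1)[OF pre2]])
      (use Ga Ha Aa Ca ga ha p d pr E r rx rc in simp_all)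
  note X1 = Xi_arrow[OF pre1 L1(1)] and X2 = Xi_arrow[OF pre2 L2(1)] and X3 = Xi_arrow[OF pre3 L3(1)]
    and X0 = Xi_arrow[OF pre lift_over]
  have xc: "Xi b \<cdot> TMor X a = A \<cdot> Xi b1" "Xi b \<cdot> TMor X c = C \<cdot> Xi b3"
    "G \<cdot> Xi b2 = Xi b1 \<cdot> TMor X g" "H \<cdot> Xi b2 = Xi b3 \<cdot> TMor X h"
    using Xi_natural[OF pre pre1 lift_over L1(1) linA s(1)] Xi_natural[OF pre pre3 lift_over L3(1) linC s(2)]
      Xi_natural[OF pre1 pre2 L1(1) L2(1) g linear_additive[OF b1 b2 g]]
      Xi_natural[OF pre3 pre2 L3(1) L2(1) h linear_additive[OF b3 b2 h]]
    unfolding A_def C_def G_def H_def by simp_all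
  have Tr: "TMor X ?q = TMor X a \<cdot> TMor X (bproj b1)"
    "TMor X ?q \<cdot> TMor X q = TMor X c \<cdot> TMor X (bproj b3)"
    using r rc p d pr ga by (simp_all flip: T_comp)
  have bases: "A \<cdot> (fst (E2 b1) \<cdot> bproj b1) = ?x \<cdot> ?q" "C \<cdot> (fst (E2 b3) \<cdot> bproj b3) = ?x \<cdot> (?q \<cdot> q)"
    "G \<cdot> (fst (E2 b2) \<cdot> bproj b2) = fst (E2 b1) \<cdot> (bproj b1 \<cdot> q)"
    "H \<cdot> (fst (E2 b2) \<cdot> bproj b2) = fst (E2 b3) \<cdot> bproj b3"
    using extend[OF Aa(4), of "bproj b1"] extend[OF Ca(4), of "bproj b3"]
      extend[OF Ga(4), of "bproj b2"] extend[OF Ha(4), of "bproj b2"] Aa Ca Ga Ha p d pr ga ha r rc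
    by simp_all
  have univ: "tangent_pullback X (TMor X ?q) (tzero X ?E) (Xi b) (?x \<cdot> ?q)"
    by (rule tangent_pullback_of_pullbacks[OF
        core_universal[OF b1, folded Xi_def] core_universal[OF b2, folded Xi_def]
        core_universal[OF b3, folded Xi_def] tangent_pullback_T[OF P] base TPE
        tangent_pullback_T[OF base]])
      (use X1(1-3) X2(1-3) X3(1-3) X0(1-3) xc Tr bases Ga(1-3) Ha(1-3) Aa(1-3) Ca(1-3) ga ha p d pr E M r rc
          tzero_natural[of q] in simp_all)
  show ?thesis
    unfolding core_bundle_def Let_def xi_def Tplus_def[symmetric]
    using fp add univ pre lift_over zero_lift zero_lift' lift_p sum_T sum_p coassoc E
    unfolding additive_morphism_def Xi_def by (simp add: Tplus_def plus_def)
qed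

section \<open>Pushouts of differential bundles\<close>

definition DB_map :: "'o \<Rightarrow> 'm dbundle \<Rightarrow> 'm \<Rightarrow> 'm dbundle \<Rightarrow> bool" where
  "DB_map A b g c \<longleftrightarrow> differential_bundle X b \<and> Cod X (bproj b) = A \<and>
     differential_bundle X c \<and> Cod X (bproj c) = A \<and> linear_morphism X b (Id X A) g c"

lemma DB_mapD:
  assumes "DB_map A b g c"
  shows "core_bundle b" "core_bundle c" "prebundle b" "prebundle c" "Cod X (bproj b) = A"
    "Cod X (bproj c) = A" "A \<in> Ob X" "linear_morphism X b (Id X A) g c" "g \<in> Mor X"
    "Dom X g = Dom X (bproj b)" "Cod X g = Dom X (bproj c)" "g \<cdot> bproj c = bproj b"
    "bundle_map b (Id X A) g c" "additive b g c" "bzero b \<cdot> g = bzero c"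
proof -
  show c: "core_bundle b" "core_bundle c" and A: "Cod X (bproj b) = A" "Cod X (bproj c) = A"
    and l: "linear_morphism X b (Id X A) g c"
    using assms by (auto simp: DB_map_def differential_bundle_iff)
  show pre: "prebundle b" "prebundle c" using c core_prebundle by auto
  show AO: "A \<in> Ob X" using pre A by auto
  show m: "bundle_map b (Id X A) g c" by (rule linear_bundle_map[OF l])
  note g = bundle_map_arrow[OF m]
  show "g \<in> Mor X" "Dom X g = Dom X (bproj b)" "Cod X g = Dom X (bproj c)" "g \<cdot> bproj c = bproj b"
    using g A pre AO comp_id[of "bproj b" A] by auto
  show "additive b g c" by (rule linear_additive[OF c l])
  show "bzero b \<cdot> g = bzero c" using linear_zero[OF c l] A pre AO by simp
qed

lemma DB_map_comp:
  assumes "DB_map A b g c" "DB_map A c h d"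
  shows "DB_map A b (g \<cdot> h) d"
  using assms DB_mapD[OF assms(1)] DB_mapD[OF assms(2)] linear_comp[of A b c d g h]
  by (simp add: DB_map_def)

lemma DB_map_plus:
  assumes "DB_map A b g c" "DB_map A b h c"
  shows "DB_map A b (plus c g h) c" "parallel (bproj c) g h"
  using assms DB_mapD[OF assms(1)] DB_mapD[OF assms(2)] linear_plus[of b c "Id X A" g h]
  by (auto simp: DB_map_def)

lemma DB_map_plus_comp:
  assumes "DB_map A b g c" "parallel (bproj b) x y"
  shows "plus b x y \<cdot> g = plus c (x \<cdot> g) (y \<cdot> g)"
  using plus_additive[OF DB_mapD(3,4,13,14)[OF assms(1)] assms(2)] .

lemma Hom_DB: "x \<in> Hom (DB X A) b c \<longleftrightarrow> (\<exists>g. x = (b, g, c) \<and> DB_map A b g c)"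
  by (cases x) (auto simp: DB_def DB_map_def)

text \<open>Morphisms of \<open>DB(A)\<close> carry their source and target; here the universal property is expressed by
  the underlying arrows alone.\<close>

lemma pushout_DB_iff:
  "pushout (DB X A) (b0, f, b1) (b0, g, b2) (b1, a, b3) (b2, b, b3) \<longleftrightarrow>
     DB_map A b0 f b1 \<and> DB_map A b0 g b2 \<and> DB_map A b1 a b3 \<and> DB_map A b2 b b3 \<and> f \<cdot> a = g \<cdot> b \<and>
     (\<forall>c x y. DB_map A b1 x c \<longrightarrow> DB_map A b2 y c \<longrightarrow> f \<cdot> x = g \<cdot> y \<longrightarrow>
        (\<exists>!h. DB_map A b3 h c \<and> a \<cdot> h = x \<and> b \<cdot> h = y))"
proof -
  have m: "(b, g, c) \<in> Mor (DB X A) \<longleftrightarrow> DB_map A b g c" for b g c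
    by (auto simp: DB_def DB_map_def)
  have dc: "Dom (DB X A) (b, g, c) = b" "Cod (DB X A) (b, g, c) = c" for b g c
    by (auto simp: DB_def)
  have cmp: "Comp (DB X A) (b, g, c) (d, h, e) = (b, g \<cdot> h, e)" for b g c d h e
    by (simp add: DB_def)
  have u: "(\<exists>!h. h \<in> Hom (DB X A) b3 c \<and> Comp (DB X A) (b1, a, b3) h = (b1, x, c) \<and>
        Comp (DB X A) (b2, b, b3) h = (b2, y, c))
      \<longleftrightarrow> (\<exists>!h. DB_map A b3 h c \<and> a \<cdot> h = x \<and> b \<cdot> h = y)" for c x y
    unfolding Hom_DB Ex1_def by (auto simp: cmp)
  have all: "(\<forall>x \<in> Hom (DB X A) d c. P x) \<longleftrightarrow> (\<forall>x. DB_map A d x c \<longrightarrow> P (d, x, c))" for d c P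
    unfolding Ball_def Hom_DB by blast
  show ?thesis
    unfolding pushout_def dc m all cmp u unfolding Hom_DB by auto
qed

end

section \<open>The vertical and the Finsler bundle\<close>

locale display_map = tangent_category X for X :: "('o, 'm, 'r) tangent_cat_scheme" (structure) +
  fixes q :: 'm and E M :: 'o
  assumes q_Hom: "q \<in> Hom X E M"
    and q_display: "tangent_display X q"
    and tangent_bundle_display: "tangent_display X (bproj (tangent_bundle X E))"
    and vertical_bundle_display: "tangent_display X (bproj (vertical_bundle X q))"
    and finsler_bundle_display: "tangent_display X (bproj (finsler_bundle X q))"
begin

lemma q_arrow [simp]: "q \<in> Mor X" "Dom X q = E" "Cod X q = M" "E \<in> Ob X" "M \<in> Ob X"
  using q_Hom Dom_Ob[of q] Cod_Ob[of q] by auto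

abbreviation "V \<equiv> vertical_bundle X q"
abbreviation "F \<equiv> finsler_bundle X q"
abbreviation "TE \<equiv> tangent_bundle X E"
abbreviation "OE \<equiv> trivial_bundle X E"

definition "\<iota> = vert_incl X q"
definition "\<tau> = TV X q"
definition "\<phi> = finsler_proj X q"
definition "\<sigma> = TF X q"

lemma tzero_tproj [simp]: "A \<in> Ob X \<Longrightarrow> tzero X A \<cdot> tproj X A = Id X A"
  using prebundle_arrow(5)[OF tangent_prebundle[of A]] by simp

lemma V_pullback: "tangent_pullback X (TMor X q) (tzero X M) \<iota> \<tau>"
  using tangent_display_pullback(2)[OF q_display, of "tzero X M"] by (simp add: \<iota>_def \<tau>_def)

lemma F_pullback: "tangent_pullback X q (tproj X M) \<phi> \<sigma>"
  using tangent_display_pullback(1)[OF q_display, of "tproj X M"] by (simp add: \<phi>_def \<sigma>_def)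

lemma vertical_arrow [simp]:
  "\<iota> \<in> Mor X" "Cod X \<iota> = TOb X E" "\<tau> \<in> Mor X" "Dom X \<tau> = Dom X \<iota>" "Cod X \<tau> = M"
  "\<iota> \<cdot> TMor X q = \<tau> \<cdot> tzero X M"
  using pullback_arrows[OF tangent_pullbackD[OF V_pullback]] by auto

lemma finsler_arrow [simp]:
  "\<phi> \<in> Mor X" "Cod X \<phi> = E" "\<sigma> \<in> Mor X" "Dom X \<sigma> = Dom X \<phi>" "Cod X \<sigma> = TOb X M"
  "\<sigma> \<cdot> tproj X M = \<phi> \<cdot> q"
  using pullback_arrows[OF tangent_pullbackD[OF F_pullback]] by auto

text \<open>The zero section is split by \<open>p\<close>, so \<open>\<tau>\<close> is determined by \<open>\<iota>\<close>. Hence \<open>\<iota>\<close> and \<open>T\<iota>\<close> are monic and the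
  definite descriptions in the definition of the vertical bundle denote the arrows induced by the
  pullback.\<close>

lemma \<tau>_eq: "\<tau> = \<iota> \<cdot> (TMor X q \<cdot> tproj X M)"
  using extend[OF vertical_arrow(6), of "tproj X M"] by simp

lemma \<iota>_mono:
  assumes "x \<in> Mor X" "y \<in> Mor X" "Dom X x = Dom X y" "Cod X x = Dom X \<iota>" "Cod X y = Dom X \<iota>"
    and e: "x \<cdot> \<iota> = y \<cdot> \<iota>"
  shows "x = y"
proof (rule pullback_mono[OF tangent_pullbackD[OF V_pullback]])
  show "x \<cdot> \<tau> = y \<cdot> \<tau>"
    using extend[OF e, of "TMor X q \<cdot> tproj X M"] assms \<tau>_eq by simp
qed (use assms in auto)

lemma T\<iota>_mono:
  assumes "x \<in> Mor X" "y \<in> Mor X" "Dom X x = Dom X y" "Cod X x = TOb X (Dom X \<iota>)"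
    "Cod X y = TOb X (Dom X \<iota>)" and e: "x \<cdot> TMor X \<iota> = y \<cdot> TMor X \<iota>"
  shows "x = y"
proof (rule pullback_mono[OF tangent_pullbackD[OF tangent_pullback_T[OF V_pullback]]])
  have "TMor X \<tau> = TMor X \<iota> \<cdot> (TMor X (TMor X q) \<cdot> TMor X (tproj X M))"
    using arg_cong[OF \<tau>_eq, of "TMor X"] by simp
  then show "x \<cdot> TMor X \<tau> = y \<cdot> TMor X \<tau>"
    using extend[OF e, of "TMor X (TMor X q) \<cdot> TMor X (tproj X M)"] assms by simp
qed (use assms in auto)

lemma vertical_proj: "\<iota> \<cdot> tproj X E = bproj V"
  by (simp add: vertical_bundle_def Let_def \<iota>_def)

lemma vertical_proj_arrow [simp]:
  "bproj V \<in> Mor X" "Dom X (bproj V) = Dom X \<iota>" "Cod X (bproj V) = E"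
  by (simp_all flip: vertical_proj)

lemma vertical_E2:
  "has_fibre_powers X (bproj V)"
  "tangent_pullback X (bproj V) (bproj V) (fst (E2 V)) (snd (E2 V))"
  using tangent_display_fibre_powers[OF vertical_bundle_display] fibre_powers_pullback by auto

lemma vertical_E2_arrow:
  "fst (E2 V) \<in> Mor X" "snd (E2 V) \<in> Mor X" "Cod X (fst (E2 V)) = Dom X \<iota>"
  "Cod X (snd (E2 V)) = Dom X \<iota>" "Dom X (snd (E2 V)) = Dom X (fst (E2 V))"
  "snd (E2 V) \<cdot> bproj V = fst (E2 V) \<cdot> bproj V"
  using pullback_arrows(3,4,6,7,8)[OF tangent_pullbackD[OF vertical_E2(2)]]
    pullback_arrows(9)[OF tangent_pullbackD[OF vertical_E2(2)], symmetric] by simp_all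

lemma proj_q: "bproj V \<cdot> q = \<tau>"
  using tproj_natural[of q] \<tau>_eq extend[OF vertical_proj, of q] by simp

lemma vertical_zero:
  "bzero V \<in> Mor X" "Dom X (bzero V) = E" "Cod X (bzero V) = Dom X \<iota>"
  "bzero V \<cdot> \<iota> = tzero X E" "bzero V \<cdot> \<tau> = q"
proof -
  obtain h where h: "h \<in> Mor X" "Dom X h = E" "Cod X h = Dom X \<iota>" "h \<cdot> \<iota> = tzero X E" "h \<cdot> \<tau> = q"
    using pullback_ex[OF tangent_pullbackD[OF V_pullback], of "tzero X E" q] tzero_natural[of q] by auto
  have "bzero V = (THE h. h \<in> Hom X E (Dom X \<iota>) \<and> h \<cdot> \<iota> = tzero X E)"
    by (simp add: vertical_bundle_def Let_def \<iota>_def)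
  also have "\<dots> = h" by (rule the_equality) (use h in \<open>auto intro: \<iota>_mono\<close>)
  finally show "bzero V \<in> Mor X" "Dom X (bzero V) = E" "Cod X (bzero V) = Dom X \<iota>"
    "bzero V \<cdot> \<iota> = tzero X E" "bzero V \<cdot> \<tau> = q" using h by auto
qed

lemma vertical_sum:
  "bsum V \<in> Mor X" "Dom X (bsum V) = Dom X (fst (E2 V))" "Cod X (bsum V) = Dom X \<iota>"
  "bsum V \<cdot> \<iota> = plus TE (fst (E2 V) \<cdot> \<iota>) (snd (E2 V) \<cdot> \<iota>)" "bsum V \<cdot> \<tau> = fst (E2 V) \<cdot> \<tau>"
  "parallel (tproj X E) (fst (E2 V) \<cdot> \<iota>) (snd (E2 V) \<cdot> \<iota>)"
proof -
  let ?x = "fst (E2 V)" let ?y = "snd (E2 V)" let ?w = "plus TE (?x \<cdot> \<iota>) (?y \<cdot> \<iota>)"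
  note a = vertical_E2_arrow
  show par: "parallel (tproj X E) (?x \<cdot> \<iota>) (?y \<cdot> \<iota>)"
    using a vertical_proj by (intro parallelI) auto
  have \<tau>: "?y \<cdot> \<tau> = ?x \<cdot> \<tau>"
    using extend[OF a(6), of q] a proj_q by simp
  note w = plus_arrow[of TE, simplified, OF par]
  have "?w \<cdot> TMor X q = plus (tangent_bundle X M) ((?x \<cdot> \<iota>) \<cdot> TMor X q) ((?y \<cdot> \<iota>) \<cdot> TMor X q)"
    using tangent_map[of q] linear_bundle_map par by (intro plus_additive) auto
  also have "\<dots> = plus (tangent_bundle X M) ((?x \<cdot> \<tau>) \<cdot> tzero X M) ((?x \<cdot> \<tau>) \<cdot> tzero X M)"
    using a \<tau> extend[OF \<tau>, of "tzero X M"] by simp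
  also have "\<dots> = (?x \<cdot> \<tau>) \<cdot> tzero X M"
    using plus_zero(1)[OF core_tangent_bundle[of M], of "(?x \<cdot> \<tau>) \<cdot> tzero X M"]
      extend[OF tzero_tproj[of M], of "tzero X M"] a by simp
  finally have "?w \<cdot> TMor X q = (?x \<cdot> \<tau>) \<cdot> tzero X M" .
  then obtain h where h: "h \<in> Mor X" "Dom X h = Dom X ?x" "Cod X h = Dom X \<iota>" "h \<cdot> \<iota> = ?w"
      "h \<cdot> \<tau> = ?x \<cdot> \<tau>"
    using pullback_ex[OF tangent_pullbackD[OF V_pullback], of ?w "?x \<cdot> \<tau>"] w a by auto
  have "bsum V = (THE h. h \<in> Hom X (Dom X ?x) (Dom X \<iota>) \<and> h \<cdot> \<iota> = ?w)"
    by (simp add: vertical_bundle_def Let_def \<iota>_def plus_def)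
  also have "\<dots> = h" by (rule the_equality) (use h in \<open>auto intro: \<iota>_mono\<close>)
  finally show "bsum V \<in> Mor X" "Dom X (bsum V) = Dom X ?x" "Cod X (bsum V) = Dom X \<iota>"
    "bsum V \<cdot> \<iota> = ?w" "bsum V \<cdot> \<tau> = ?x \<cdot> \<tau>" using h by auto
qed

lemma vertical_lift:
  "blift V \<in> Mor X" "Dom X (blift V) = Dom X \<iota>" "Cod X (blift V) = TOb X (Dom X \<iota>)"
  "blift V \<cdot> TMor X \<iota> = \<iota> \<cdot> tlift X E" "blift V \<cdot> TMor X \<tau> = \<tau> \<cdot> tzero X M"
proof -
  have "\<iota> \<cdot> (tlift X E \<cdot> TMor X (TMor X q)) = \<tau> \<cdot> (tzero X M \<cdot> TMor X (tzero X M))"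
    using tlift_natural[of q] extend[OF vertical_arrow(6), of "tlift X M"]
      core_lift(2)[OF core_tangent_bundle[of M]] by simp
  then obtain h where h: "h \<in> Mor X" "Dom X h = Dom X \<iota>" "Cod X h = TOb X (Dom X \<iota>)"
      "h \<cdot> TMor X \<iota> = \<iota> \<cdot> tlift X E" "h \<cdot> TMor X \<tau> = \<tau> \<cdot> tzero X M"
    using pullback_ex[OF tangent_pullbackD[OF tangent_pullback_T[OF V_pullback]], of "\<iota> \<cdot> tlift X E" "\<tau> \<cdot> tzero X M"]
    by auto
  have "blift V = (THE h. h \<in> Hom X (Dom X \<iota>) (TOb X (Dom X \<iota>)) \<and> h \<cdot> TMor X \<iota> = \<iota> \<cdot> tlift X E)"
    by (simp add: vertical_bundle_def Let_def \<iota>_def)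
  also have "\<dots> = h" by (rule the_equality) (use h in \<open>auto intro: T\<iota>_mono\<close>)
  finally show "blift V \<in> Mor X" "Dom X (blift V) = Dom X \<iota>" "Cod X (blift V) = TOb X (Dom X \<iota>)"
    "blift V \<cdot> TMor X \<iota> = \<iota> \<cdot> tlift X E" "blift V \<cdot> TMor X \<tau> = \<tau> \<cdot> tzero X M" using h by auto
qed

lemma vertical_prebundle [simp]: "prebundle V"
proof -
  have "bzero V \<cdot> bproj V = Id X E"
    using extend[OF vertical_zero(4), of "tproj X E"] vertical_zero(1-3) vertical_proj[symmetric] by simp
  moreover have "bsum V \<cdot> bproj V = fst (E2 V) \<cdot> bproj V"
  proof -
    have "bsum V \<cdot> bproj V = (bsum V \<cdot> \<iota>) \<cdot> tproj X E"
      using vertical_sum(1-3) vertical_proj by simp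
    also have "\<dots> = (fst (E2 V) \<cdot> \<iota>) \<cdot> tproj X E"
      using vertical_sum(4) plus_arrow(4)[of TE, simplified, OF vertical_sum(6)] by simp
    finally show ?thesis using vertical_E2_arrow vertical_proj by simp
  qed
  ultimately show ?thesis
    unfolding prebundle_def using vertical_E2 vertical_zero vertical_sum vertical_lift by simp
qed

text \<open>The vertical bundle is the limit of \<open>p\<^sub>E \<rightarrow> p\<^sub>M \<leftarrow> 0\<^sub>M\<close>.\<close>

lemma vertical_differential: "differential_bundle X V"
proof -
  have t: "core_bundle (tangent_bundle X E)" "core_bundle (tangent_bundle X M)" "core_bundle (trivial_bundle X M)"
    using core_tangent_bundle core_trivial by auto
  have g: "linear_morphism X (tangent_bundle X E) q (TMor X q) (tangent_bundle X M)"
    using tangent_map(1)[of q] by simp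
  have h: "linear_morphism X (trivial_bundle X M) (Id X M) (tzero X M) (tangent_bundle X M)"
    using linear_zero_section[OF t(2)] by simp
  have e: "snd (E2 V) \<cdot> \<tau> = fst (E2 V) \<cdot> \<tau>"
    using extend[OF vertical_E2_arrow(6), of q] vertical_E2_arrow proj_q by simp
  have "core_bundle V"
    by (rule limit_bundle[OF t g h _ V_pullback vertical_prebundle vertical_E2(1)])
      (use vertical_proj vertical_zero vertical_sum vertical_lift plus_trivial[of "fst (E2 V) \<cdot> \<tau>" M]
        vertical_E2_arrow e in \<open>auto simp: additive_def\<close>)
  then show ?thesis using vertical_bundle_display by (simp add: differential_bundle_iff)
qed

lemma finsler_proj: "bproj F = \<phi>"
  by (simp add: finsler_bundle_def Let_def \<phi>_def)

lemma finsler_E2: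
  "has_fibre_powers X \<phi>"
  "tangent_pullback X \<phi> \<phi> (fst (pb X \<phi> \<phi>)) (snd (pb X \<phi> \<phi>))"
  using tangent_display_fibre_powers[OF finsler_bundle_display] fibre_powers_pullback
  by (auto simp: finsler_proj)

lemma finsler_E2_arrow:
  "fst (pb X \<phi> \<phi>) \<in> Mor X" "snd (pb X \<phi> \<phi>) \<in> Mor X" "Cod X (fst (pb X \<phi> \<phi>)) = Dom X \<phi>"
  "Cod X (snd (pb X \<phi> \<phi>)) = Dom X \<phi>" "Dom X (snd (pb X \<phi> \<phi>)) = Dom X (fst (pb X \<phi> \<phi>))"
  "snd (pb X \<phi> \<phi>) \<cdot> \<phi> = fst (pb X \<phi> \<phi>) \<cdot> \<phi>"
  using pullback_arrows(3,4,6,7,8)[OF tangent_pullbackD[OF finsler_E2(2)]]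
    pullback_arrows(9)[OF tangent_pullbackD[OF finsler_E2(2)], symmetric] by simp_all

lemma finsler_pair:
  assumes "x \<in> Mor X" "y \<in> Mor X" "Dom X x = Dom X y" "Cod X x = E" "Cod X y = TOb X M"
    "x \<cdot> q = y \<cdot> tproj X M"
  shows "pair X (pb X q (tproj X M)) x y \<in> Mor X" "Dom X (pair X (pb X q (tproj X M)) x y) = Dom X x"
    "Cod X (pair X (pb X q (tproj X M)) x y) = Dom X \<phi>"
    "pair X (pb X q (tproj X M)) x y \<cdot> \<phi> = x" "pair X (pb X q (tproj X M)) x y \<cdot> \<sigma> = y"
  using pair_universal[of q "tproj X M" "pb X q (tproj X M)" x y] tangent_pullbackD[OF F_pullback] assms
  by (auto simp: \<phi>_def \<sigma>_def)

lemma finsler_zero: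
  "bzero F \<in> Mor X" "Dom X (bzero F) = E" "Cod X (bzero F) = Dom X \<phi>"
  "bzero F \<cdot> \<phi> = Id X E" "bzero F \<cdot> \<sigma> = q \<cdot> tzero X M"
proof -
  have "bzero F = pair X (pb X q (tproj X M)) (Id X E) (q \<cdot> tzero X M)"
    by (simp add: finsler_bundle_def Let_def)
  then show "bzero F \<in> Mor X" "Dom X (bzero F) = E" "Cod X (bzero F) = Dom X \<phi>"
    "bzero F \<cdot> \<phi> = Id X E" "bzero F \<cdot> \<sigma> = q \<cdot> tzero X M"
    using finsler_pair[of "Id X E" "q \<cdot> tzero X M"] by simp_all
qed

lemma finsler_sum:
  "bsum F \<in> Mor X" "Dom X (bsum F) = Dom X (fst (pb X \<phi> \<phi>))" "Cod X (bsum F) = Dom X \<phi>"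
  "bsum F \<cdot> \<phi> = fst (pb X \<phi> \<phi>) \<cdot> \<phi>"
  "bsum F \<cdot> \<sigma> = plus (tangent_bundle X M) (fst (pb X \<phi> \<phi>) \<cdot> \<sigma>) (snd (pb X \<phi> \<phi>) \<cdot> \<sigma>)"
proof -
  let ?x = "fst (pb X \<phi> \<phi>)" let ?y = "snd (pb X \<phi> \<phi>)"
  let ?w = "plus (tangent_bundle X M) (?x \<cdot> \<sigma>) (?y \<cdot> \<sigma>)"
  note a = finsler_E2_arrow
  have par: "parallel (tproj X M) (?x \<cdot> \<sigma>) (?y \<cdot> \<sigma>)"
    using a extend[OF a(6), of q] by (intro parallelI) auto
  note w = plus_arrow[of "tangent_bundle X M", simplified, OF par]
  have "bsum F = pair X (pb X q (tproj X M)) (?x \<cdot> \<phi>) ?w"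
    by (simp add: finsler_bundle_def Let_def \<phi>_def \<sigma>_def plus_def)
  then show "bsum F \<in> Mor X" "Dom X (bsum F) = Dom X ?x" "Cod X (bsum F) = Dom X \<phi>"
    "bsum F \<cdot> \<phi> = ?x \<cdot> \<phi>" "bsum F \<cdot> \<sigma> = ?w"
    using finsler_pair[of "?x \<cdot> \<phi>" ?w] w a by simp_all
qed

lemma finsler_lift:
  "blift F \<in> Mor X" "Dom X (blift F) = Dom X \<phi>" "Cod X (blift F) = TOb X (Dom X \<phi>)"
  "blift F \<cdot> TMor X \<phi> = \<phi> \<cdot> tzero X E" "blift F \<cdot> TMor X \<sigma> = \<sigma> \<cdot> tlift X M"
proof -
  have P: "pullback X (TMor X q) (TMor X (tproj X M)) (fst (TPair X (pb X q (tproj X M))))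
     (snd (TPair X (pb X q (tproj X M))))"
    using tangent_pullbackD[OF tangent_pullback_T[OF F_pullback]] by (simp add: \<phi>_def \<sigma>_def)
  have "(\<phi> \<cdot> tzero X E) \<cdot> TMor X q = (\<sigma> \<cdot> tlift X M) \<cdot> TMor X (tproj X M)"
    using tzero_natural[of q] core_lift(1)[OF core_tangent_bundle[of M]]
      extend[OF finsler_arrow(6), of "tzero X M"] by simp
  moreover have "blift F = pair X (TPair X (pb X q (tproj X M))) (\<phi> \<cdot> tzero X E) (\<sigma> \<cdot> tlift X M)"
    by (simp add: finsler_bundle_def Let_def \<phi>_def \<sigma>_def)
  ultimately show "blift F \<in> Mor X" "Dom X (blift F) = Dom X \<phi>" "Cod X (blift F) = TOb X (Dom X \<phi>)"
    "blift F \<cdot> TMor X \<phi> = \<phi> \<cdot> tzero X E" "blift F \<cdot> TMor X \<sigma> = \<sigma> \<cdot> tlift X M"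
    using pair_universal[OF P, of "\<phi> \<cdot> tzero X E" "\<sigma> \<cdot> tlift X M"] finsler_arrow by (auto simp: \<phi>_def \<sigma>_def)
qed

lemma finsler_prebundle [simp]: "prebundle F"
  unfolding prebundle_def finsler_proj
  using finsler_E2 finsler_zero finsler_sum finsler_lift by simp

text \<open>The Finsler bundle is the limit of \<open>0\<^sub>E \<rightarrow> 0\<^sub>M \<leftarrow> p\<^sub>M\<close>.\<close>

lemma finsler_differential: "differential_bundle X F"
proof -
  have t: "core_bundle (trivial_bundle X E)" "core_bundle (trivial_bundle X M)" "core_bundle (tangent_bundle X M)"
    using core_tangent_bundle core_trivial by auto
  have g: "linear_morphism X (trivial_bundle X E) q q (trivial_bundle X M)"
    using tzero_natural[of q] by (simp add: linear_morphism_def)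
  have h: "linear_morphism X (tangent_bundle X M) (Id X M) (tproj X M) (trivial_bundle X M)"
    using linear_projection[OF t(3)] by simp
  have "core_bundle F"
    by (rule limit_bundle[OF t g h _ F_pullback finsler_prebundle])
      (use finsler_zero finsler_sum finsler_lift plus_trivial[of "fst (pb X \<phi> \<phi>) \<cdot> \<phi>" E]
        finsler_E2_arrow finsler_E2 in \<open>auto simp: additive_def finsler_proj\<close>)
  then show ?thesis using finsler_bundle_display by (simp add: differential_bundle_iff)
qed

lemma tangent_differential: "differential_bundle X TE"
  using core_tangent_bundle[of E] tangent_bundle_display by (simp add: differential_bundle_iff)

section \<open>The square of vertical inclusion and horizontal descent\<close>

definition "\<pi> = horizontal_descent X q"

lemma descent [simp]:
  "\<pi> \<in> Mor X" "Dom X \<pi> = TOb X E" "Cod X \<pi> = Dom X \<phi>" "\<pi> \<cdot> \<phi> = tproj X E" "\<pi> \<cdot> \<sigma> = TMor X q"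
  using finsler_pair[of "tproj X E" "TMor X q"] tproj_natural[of q]
  by (simp_all add: \<pi>_def horizontal_descent_def)

lemma F_mono:
  assumes "x \<in> Mor X" "y \<in> Mor X" "Dom X x = Dom X y" "Cod X x = Dom X \<phi>" "Cod X y = Dom X \<phi>"
    "x \<cdot> \<phi> = y \<cdot> \<phi>" "x \<cdot> \<sigma> = y \<cdot> \<sigma>"
  shows "x = y"
  by (rule pullback_mono[OF tangent_pullbackD[OF F_pullback]]) (use assms in auto)

lemma incl_DB: "DB_map E V \<iota> TE"
  using vertical_differential tangent_differential vertical_proj vertical_lift
  by (simp add: DB_map_def linear_morphism_def)

lemma descent_DB: "DB_map E TE \<pi> F"
proof -
  have T: "TMor X \<pi> \<cdot> TMor X \<phi> = TMor X (tproj X E)" "TMor X \<pi> \<cdot> TMor X \<sigma> = TMor X (TMor X q)"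
    by (simp_all flip: T_comp)
  have "\<pi> \<cdot> blift F = tlift X E \<cdot> TMor X \<pi>"
  proof (rule pullback_mono[OF tangent_pullbackD[OF tangent_pullback_T[OF F_pullback]]])
    show "(\<pi> \<cdot> blift F) \<cdot> TMor X \<phi> = (tlift X E \<cdot> TMor X \<pi>) \<cdot> TMor X \<phi>"
      using finsler_lift T core_lift(1)[OF core_tangent_bundle[of E]]
        extend[OF descent(4), of "tzero X E"] by simp
    show "(\<pi> \<cdot> blift F) \<cdot> TMor X \<sigma> = (tlift X E \<cdot> TMor X \<pi>) \<cdot> TMor X \<sigma>"
      using finsler_lift T tlift_natural[of q] extend[OF descent(5), of "tlift X M"] by simp
  qed (use finsler_lift in auto)
  then show ?thesis
    using finsler_differential tangent_differential
    by (simp add: DB_map_def linear_morphism_def finsler_proj)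
qed

lemma trivial_DB:
  assumes "differential_bundle X b" "Cod X (bproj b) = E"
  shows "DB_map E b (bproj b) OE" "DB_map E OE (bzero b) b" "DB_map E b (bproj b \<cdot> bzero b) b"
proof -
  have c: "core_bundle b" using assms by (simp add: differential_bundle_iff)
  show "DB_map E b (bproj b) OE" "DB_map E OE (bzero b) b"
    using linear_projection[OF c] linear_zero_section[OF c] assms differential_trivial_bundle[of E]
    by (auto simp: DB_map_def)
  then show "DB_map E b (bproj b \<cdot> bzero b) b" by (rule DB_map_comp)
qed

lemma incl_descent: "\<iota> \<cdot> \<pi> = bproj V \<cdot> bzero F"
proof (rule F_mono)
  show "(\<iota> \<cdot> \<pi>) \<cdot> \<phi> = (bproj V \<cdot> bzero F) \<cdot> \<phi>"
    using vertical_proj finsler_zero by simp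
  show "(\<iota> \<cdot> \<pi>) \<cdot> \<sigma> = (bproj V \<cdot> bzero F) \<cdot> \<sigma>"
    using finsler_zero extend[OF proj_q, of "tzero X M"] by simp
qed (use finsler_zero in auto)

lemma submersion_iff:
  "submersion X q \<longleftrightarrow> (\<forall>c x y. DB_map E TE x c \<longrightarrow> DB_map E OE y c \<longrightarrow> \<iota> \<cdot> x = bproj V \<cdot> y \<longrightarrow>
     (\<exists>!h. DB_map E F h c \<and> \<pi> \<cdot> h = x \<and> bzero F \<cdot> h = y))"
proof -
  have "submersion X q \<longleftrightarrow> pushout (DB X E) (V, \<iota>, TE) (V, bproj V, OE) (TE, \<pi>, F) (OE, bzero F, F)"
    unfolding submersion_def Let_def by (simp add: \<iota>_def \<pi>_def)
  then show ?thesis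
    using incl_DB descent_DB incl_descent trivial_DB(1)[OF vertical_differential]
      trivial_DB(2)[OF finsler_differential] by (simp add: pushout_DB_iff finsler_proj)
qed

section \<open>Connections\<close>

lemma vertical_connection_iff:
  "vertical_connection X q R \<longleftrightarrow> DB_map E TE R V \<and> \<iota> \<cdot> R = Id X (Dom X \<iota>)"
  using vertical_differential tangent_differential
  by (auto simp: vertical_connection_def DB_map_def linear_morphism_def \<iota>_def)

lemma horizontal_connection_iff:
  "horizontal_connection X q H \<longleftrightarrow> DB_map E F H TE \<and> H \<cdot> \<pi> = Id X (Dom X \<phi>)"
proof -
  have "horizontal_connection X q H \<longleftrightarrow> H \<in> Mor X \<and> Dom X H = Dom X \<phi> \<and> Cod X H = TOb X E \<and>
      H \<cdot> \<pi> = Id X (Dom X \<phi>) \<and> linear_morphism X F (Id X E) H TE"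
    by (simp add: horizontal_connection_def \<pi>_def \<phi>_def)
  moreover have "DB_map E F H TE \<longleftrightarrow> linear_morphism X F (Id X E) H TE"
    using finsler_differential tangent_differential by (simp add: DB_map_def finsler_proj)
  moreover have "H \<in> Mor X \<and> Dom X H = Dom X \<phi> \<and> Cod X H = TOb X E" if "DB_map E F H TE"
    using DB_mapD[OF that] by (simp add: finsler_proj)
  ultimately show ?thesis by blast
qed

lemma ehresmann_iff:
  "ehresmann_connection X q R H \<longleftrightarrow> vertical_connection X q R \<and> horizontal_connection X q H \<and>
     H \<cdot> R = \<phi> \<cdot> bzero V \<and> plus TE (R \<cdot> \<iota>) (\<pi> \<cdot> H) = Id X (TOb X E)"
  by (simp add: ehresmann_connection_def plus_def \<iota>_def \<pi>_def \<phi>_def)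

lemma zero_absorb:
  assumes g: "DB_map E b g c"
  shows "plus c (bproj b \<cdot> bzero c) g = g" "plus c g (bproj b \<cdot> bzero c) = g"
  using plus_zero[OF DB_mapD(2)[OF g], of g] DB_mapD[OF g] extend[of g "bproj c" "bproj b" "bzero c"]
  by simp_all

text \<open>The equation \<open>R \<iota> + \<pi> H = id\<close> followed by \<open>g\<close>, which is additive because it is linear.\<close>

lemma ehresmann_decompose:
  assumes eh: "ehresmann_connection X q R H" and g: "DB_map E TE g c"
  shows "plus c (R \<cdot> (\<iota> \<cdot> g)) (\<pi> \<cdot> (H \<cdot> g)) = g"
proof -
  have R: "DB_map E TE R V" and H: "DB_map E F H TE"
    and s: "plus TE (R \<cdot> \<iota>) (\<pi> \<cdot> H) = Id X (TOb X E)"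
    using eh by (auto simp: ehresmann_iff vertical_connection_iff horizontal_connection_iff)
  note p = DB_map_plus(2)[OF DB_map_comp[OF R incl_DB] DB_map_comp[OF descent_DB H]]
  show ?thesis
    using DB_map_plus_comp[OF g p] s DB_mapD[OF g] DB_mapD[OF R] DB_mapD[OF H] by (simp add: finsler_proj)
qed

text \<open>A map \<open>x\<close> that vanishes on vertical vectors equals \<open>\<pi> H x\<close>, since the first term of its decomposition
  is zero; so it factors through \<open>\<pi>\<close> by \<open>H x\<close>, uniquely because \<open>\<pi>\<close> is split by \<open>H\<close>.\<close>

lemma ehresmann_submersion:
  assumes eh: "ehresmann_connection X q R H"
  shows "submersion X q"
  unfolding submersion_iff
proof (intro allI impI)
  fix c x y
  assume x: "DB_map E TE x c" and y: "DB_map E OE y c" and e: "\<iota> \<cdot> x = bproj V \<cdot> y"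
  have R: "DB_map E TE R V" and H: "DB_map E F H TE" and HP: "H \<cdot> \<pi> = Id X (Dom X \<phi>)"
    using eh by (auto simp: ehresmann_iff vertical_connection_iff horizontal_connection_iff)
  note d = DB_mapD[OF R] DB_mapD[OF H] DB_mapD[OF x] DB_mapD[OF y]
  have yz: "y = bzero c" using DB_mapD(9,10,15)[OF y] by simp
  have "R \<cdot> (\<iota> \<cdot> x) = tproj X E \<cdot> bzero c"
    using e yz extend[OF DB_mapD(12)[OF R], of "bzero c"] d by simp
  then have "\<pi> \<cdot> (H \<cdot> x) = x"
    using ehresmann_decompose[OF eh x] zero_absorb(1)[OF DB_map_comp[OF descent_DB DB_map_comp[OF H x]]]
    by simp
  moreover have "bzero F \<cdot> (H \<cdot> x) = y"
    using DB_mapD(15)[OF DB_map_comp[OF H x]] yz by simp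
  moreover have "h = H \<cdot> x" if "DB_map E F h c" "\<pi> \<cdot> h = x" for h
    using that(2) DB_mapD[OF that(1)] extend[OF HP, of h] d by (simp add: finsler_proj)
  ultimately show "\<exists>!h. DB_map E F h c \<and> \<pi> \<cdot> h = x \<and> bzero F \<cdot> h = y"
    using DB_map_comp[OF H x] by blast
qed

lemma full_horizontal_iff:
  "full_horizontal_connection X q H \<longleftrightarrow> horizontal_connection X q H \<and> bzero V \<cdot> \<iota> = bzero F \<cdot> H \<and>
     (\<forall>c x y. DB_map E V x c \<longrightarrow> DB_map E F y c \<longrightarrow> bzero V \<cdot> x = bzero F \<cdot> y \<longrightarrow>
        (\<exists>!h. DB_map E TE h c \<and> \<iota> \<cdot> h = x \<and> H \<cdot> h = y))"
proof -
  have "full_horizontal_connection X q H \<longleftrightarrow> horizontal_connection X q H \<and>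
      pushout (DB X E) (OE, bzero V, V) (OE, bzero F, F) (V, \<iota>, TE) (F, H, TE)"
    unfolding full_horizontal_connection_def Let_def by (simp add: \<iota>_def)
  then show ?thesis
    using incl_DB trivial_DB(2)[OF vertical_differential] trivial_DB(2)[OF finsler_differential]
    by (auto simp: pushout_DB_iff finsler_proj horizontal_connection_iff)
qed

text \<open>The copairing of \<open>x\<close> and \<open>y\<close> is \<open>R x + \<pi> y\<close>. Mixed terms vanish as \<open>\<iota> \<pi>\<close> and \<open>H R\<close> are zero maps,
  and uniqueness is the decomposition formula.\<close>

lemma ehresmann_full_horizontal:
  assumes eh: "ehresmann_connection X q R H"
  shows "full_horizontal_connection X q H"
  unfolding full_horizontal_iff
proof (intro conjI allI impI)
  have R: "DB_map E TE R V" and H: "DB_map E F H TE" and HP: "H \<cdot> \<pi> = Id X (Dom X \<phi>)"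
    and IR: "\<iota> \<cdot> R = Id X (Dom X \<iota>)" and HR: "H \<cdot> R = \<phi> \<cdot> bzero V"
    using eh by (auto simp: ehresmann_iff vertical_connection_iff horizontal_connection_iff)
  note d = DB_mapD[OF R] DB_mapD[OF H]
  show "horizontal_connection X q H" using eh by (simp add: ehresmann_iff)
  show "bzero V \<cdot> \<iota> = bzero F \<cdot> H" using vertical_zero DB_mapD(15)[OF H] by simp
  fix c x y
  assume x: "DB_map E V x c" and y: "DB_map E F y c"
  note dx = DB_mapD[OF x] and dy = DB_mapD[OF y]
  let ?h = "plus c (R \<cdot> x) (\<pi> \<cdot> y)"
  note Rx = DB_map_comp[OF R x] and py = DB_map_comp[OF descent_DB y]
  note h = DB_map_plus(1)[OF Rx py] and p = DB_map_plus(2)[OF Rx py]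
  have "\<iota> \<cdot> ?h = plus c x (bproj V \<cdot> bzero c)"
    using comp_plus[OF DB_mapD(4)[OF x] p, of \<iota>] extend[OF IR, of x] extend[OF incl_descent, of y]
      finsler_zero DB_mapD(15)[OF y] d dx dy by (simp add: finsler_proj)
  then have 1: "\<iota> \<cdot> ?h = x" using zero_absorb(2)[OF x] by simp
  have "H \<cdot> ?h = plus c (\<phi> \<cdot> bzero c) y"
    using comp_plus[OF DB_mapD(4)[OF x] p, of H] extend[OF HR, of x] extend[OF HP, of y]
      vertical_zero DB_mapD(15)[OF x] d dx dy by (simp add: finsler_proj)
  then have 2: "H \<cdot> ?h = y" using zero_absorb(1)[OF y] by (simp add: finsler_proj)
  show "\<exists>!h. DB_map E TE h c \<and> \<iota> \<cdot> h = x \<and> H \<cdot> h = y"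
  proof (rule ex1I[of _ ?h])
    show "DB_map E TE ?h c \<and> \<iota> \<cdot> ?h = x \<and> H \<cdot> ?h = y" using h 1 2 by simp
    show "k = ?h" if "DB_map E TE k c \<and> \<iota> \<cdot> k = x \<and> H \<cdot> k = y" for k
      using ehresmann_decompose[OF eh, of k c] that by simp
  qed
qed

text \<open>The pair \<open>R\<close>, \<open>\<pi>\<close> makes \<open>TE\<close> the pullback of \<open>q\<^sup>V\<close> along \<open>q\<^sup>F\<close>, with \<open>(u, v) \<mapsto> u \<iota> + v H\<close> as the inverse of
  the comparison. Pasting this square with the one defining \<open>Fq\<close> gives the square of fullness.\<close>

lemma ehresmann_full_vertical:
  assumes eh: "ehresmann_connection X q R H"
  shows "full_vertical_connection X q R"
proof -
  have R: "DB_map E TE R V" and H: "DB_map E F H TE" and HP: "H \<cdot> \<pi> = Id X (Dom X \<phi>)"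
    and IR: "\<iota> \<cdot> R = Id X (Dom X \<iota>)" and HR: "H \<cdot> R = \<phi> \<cdot> bzero V"
    and s: "plus TE (R \<cdot> \<iota>) (\<pi> \<cdot> H) = Id X (TOb X E)"
    using eh by (auto simp: ehresmann_iff vertical_connection_iff horizontal_connection_iff)
  note d = DB_mapD[OF R] DB_mapD[OF H]
  have dm: "Dom X R = TOb X E" "Cod X R = Dom X \<iota>" "Dom X H = Dom X \<phi>" "Cod X H = TOb X E"
    "R \<in> Mor X" "H \<in> Mor X" "R \<cdot> bproj V = tproj X E" "H \<cdot> tproj X E = \<phi>"
    using d by (simp_all add: finsler_proj)
  define P where "P = pb X (bproj V) \<phi>"
  have TP: "tangent_pullback X (bproj V) \<phi> (fst P) (snd P)"
    unfolding P_def by (rule tangent_display_pullback(1)[OF vertical_bundle_display]) simp_all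
  note P0 = tangent_pullbackD[OF TP]
  define u v where "u = fst P" and "v = snd P"
  have uv: "u \<in> Mor X" "v \<in> Mor X" "Cod X u = Dom X \<iota>" "Cod X v = Dom X \<phi>" "Dom X v = Dom X u"
    and uvq: "u \<cdot> bproj V = v \<cdot> \<phi>"
    using pullback_arrows[OF P0] by (auto simp: u_def v_def)
  note i = pair_universal[OF P0, of R \<pi>, folded u_def v_def]
  let ?i = "pair X P R \<pi>"
  have i: "?i \<in> Mor X" "Dom X ?i = TOb X E" "Cod X ?i = Dom X u" "?i \<cdot> u = R" "?i \<cdot> v = \<pi>"
    using i dm by simp_all
  have par: "parallel (tproj X E) (u \<cdot> \<iota>) (v \<cdot> H)"
    using uv uvq dm vertical_proj by (intro parallelI) auto
  let ?j = "plus TE (u \<cdot> \<iota>) (v \<cdot> H)"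
  note ja = plus_arrow[of TE, simplified, OF par]
  have j: "?j \<in> Mor X" "Dom X ?j = Dom X u" "Cod X ?j = TOb X E"
    using ja uv by simp_all
  have "?j \<cdot> R = plus V u (u \<cdot> (bproj V \<cdot> bzero V))"
    using DB_map_plus_comp[OF R] par uv dm IR HR extend[OF uvq, of "bzero V"] vertical_zero by simp
  then have jR: "?j \<cdot> R = u"
    using plus_zero(2)[OF DB_mapD(2)[OF R], of u] uv by simp
  have "?j \<cdot> \<pi> = plus F (v \<cdot> (\<phi> \<cdot> bzero F)) v"
    using DB_map_plus_comp[OF descent_DB] par uv dm HP incl_descent extend[OF uvq, of "bzero F"]
      finsler_zero by simp
  then have j\<pi>: "?j \<cdot> \<pi> = v"
    using plus_zero(1)[OF DB_mapD(1)[OF H], of v] uv by (simp add: finsler_proj)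
  have ij: "?i \<cdot> ?j = Id X (TOb X E)"
  proof -
    have "?i \<cdot> ?j = plus TE (?i \<cdot> (u \<cdot> \<iota>)) (?i \<cdot> (v \<cdot> H))"
      by (rule comp_plus) (use par i uv dm in auto)
    then show ?thesis
      using s extend[OF i(4), of \<iota>] extend[OF i(5), of H] i uv dm by simp
  qed
  have ji: "?j \<cdot> ?i = Id X (Dom X u)"
    by (rule pullback_mono[OF P0, folded u_def v_def]) (use i j uv jR j\<pi> in auto)
  have "tangent_pullback X (bproj V) \<phi> (?i \<cdot> u) (?i \<cdot> v)"
    by (rule tangent_pullback_iso[OF TP, folded u_def v_def, of _ ?j]) (use i j ij ji in simp_all)
  then have "tangent_pullback X (bproj V) \<phi> R \<pi>" using i by simp
  from tangent_pullback_paste[OF F_pullback this]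
  have "tangent_pullback X \<tau> (tproj X M) R (TMor X q)" using proj_q by simp
  then show ?thesis
    using eh by (simp add: full_vertical_connection_def ehresmann_iff \<tau>_def)
qed

text \<open>The coproduct property, applied to the identity of \<open>V\<close> and the zero map of \<open>F\<close>, yields \<open>R\<close>; its
  uniqueness part identifies \<open>R \<iota> + \<pi> H\<close> with the identity.\<close>

lemma full_horizontal_ehresmann:
  assumes fh: "full_horizontal_connection X q H"
  shows "\<exists>R. ehresmann_connection X q R H"
proof -
  have hc: "horizontal_connection X q H" and z: "bzero V \<cdot> \<iota> = bzero F \<cdot> H"
    and U: "\<And>c x y. DB_map E V x c \<Longrightarrow> DB_map E F y c \<Longrightarrow> bzero V \<cdot> x = bzero F \<cdot> y \<Longrightarrow>
        (\<exists>!h. DB_map E TE h c \<and> \<iota> \<cdot> h = x \<and> H \<cdot> h = y)"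
    using fh by (auto simp: full_horizontal_iff)
  have H: "DB_map E F H TE" and HP: "H \<cdot> \<pi> = Id X (Dom X \<phi>)"
    using hc by (auto simp: horizontal_connection_iff)
  have idV: "DB_map E V (Id X (Dom X \<iota>)) V" and zFV: "DB_map E F (\<phi> \<cdot> bzero V) V"
    and idT: "DB_map E TE (Id X (TOb X E)) TE"
    using vertical_differential tangent_differential vertical_lift
      DB_map_comp[OF trivial_DB(1)[OF finsler_differential] trivial_DB(2)[OF vertical_differential]]
    by (auto simp: DB_map_def linear_morphism_def finsler_proj)
  have "bzero V \<cdot> Id X (Dom X \<iota>) = bzero F \<cdot> (\<phi> \<cdot> bzero V)"
    using vertical_zero extend[OF finsler_zero(4), of "bzero V"] finsler_zero by simp
  from U[OF idV zFV this] obtain R where R: "DB_map E TE R V" and IR: "\<iota> \<cdot> R = Id X (Dom X \<iota>)"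
      and HR: "H \<cdot> R = \<phi> \<cdot> bzero V"
    by auto
  have dm: "Dom X R = TOb X E" "Cod X R = Dom X \<iota>" "Dom X H = Dom X \<phi>" "Cod X H = TOb X E"
    "R \<in> Mor X" "H \<in> Mor X" "R \<cdot> bproj V = tproj X E" "H \<cdot> tproj X E = \<phi>" "bzero F \<cdot> H = tzero X E"
    using DB_mapD[OF R] DB_mapD[OF H] by (simp_all add: finsler_proj)
  note RI = DB_map_comp[OF R incl_DB] and PH = DB_map_comp[OF descent_DB H]
  let ?s = "plus TE (R \<cdot> \<iota>) (\<pi> \<cdot> H)"
  note sDB = DB_map_plus(1)[OF RI PH] and par = DB_map_plus(2)[OF RI PH]
  have "\<iota> \<cdot> ?s = plus TE \<iota> (bproj V \<cdot> tzero X E)"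
    using comp_plus[of TE, OF _ par, of \<iota>] extend[OF IR, of \<iota>] extend[OF incl_descent, of H] dm finsler_zero
    by simp
  then have 1: "\<iota> \<cdot> ?s = \<iota>" using zero_absorb(2)[OF incl_DB] by simp
  have "H \<cdot> ?s = plus TE (\<phi> \<cdot> tzero X E) H"
    using comp_plus[of TE, OF _ par, of H] extend[OF HR, of \<iota>] extend[OF HP, of H] dm vertical_zero
    by simp
  then have 2: "H \<cdot> ?s = H" using zero_absorb(1)[OF H] by (simp add: finsler_proj)
  have "?s = Id X (TOb X E)"
    using U[OF incl_DB H z] sDB 1 2 idT dm by (metis comp_id vertical_arrow(1,2))
  then show ?thesis
    using R IR HR hc by (auto simp: ehresmann_iff vertical_connection_iff)
qed

text \<open>The endomorphism \<open>K\<close> induced by \<open>K R = 0\<close> and \<open>K Tq = Tq\<close> stands for the difference of the identity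
  and \<open>R \<iota>\<close>. It is linear since \<open>TR\<close> and \<open>T\<^sup>2q\<close> are jointly monic, and it vanishes on vertical vectors, so
  the pushout of the submersion factors it as \<open>\<pi> H\<close>. The equations for \<open>H\<close> that start in \<open>F\<close>
  are checked after \<open>\<pi>\<close> and the zero section, which are jointly epic for linear maps, and
  those that end in \<open>TE\<close> after \<open>R\<close> and \<open>Tq\<close>.\<close>

lemma full_vertical_ehresmann:
  assumes fv: "full_vertical_connection X q R" and sub: "submersion X q"
  shows "\<exists>H. ehresmann_connection X q R H"
proof -
  have vc: "vertical_connection X q R" and P: "tangent_pullback X \<tau> (tproj X M) R (TMor X q)"
    using fv by (auto simp: full_vertical_connection_def \<tau>_def)
  have R: "DB_map E TE R V" and IR: "\<iota> \<cdot> R = Id X (Dom X \<iota>)"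
    using vc by (auto simp: vertical_connection_iff)
  note P0 = tangent_pullbackD[OF P]
  note PT = tangent_pullbackD[OF tangent_pullback_T[OF P]]
  have dm: "Dom X R = TOb X E" "Cod X R = Dom X \<iota>" "R \<in> Mor X" "R \<cdot> bproj V = tproj X E"
    "tzero X E \<cdot> R = bzero V" "R \<cdot> blift V = tlift X E \<cdot> TMor X R"
    using DB_mapD[OF R] linear_lift[OF DB_mapD(8)[OF R]] by simp_all
  have mono: "x = y" if "x \<in> Mor X" "y \<in> Mor X" "Dom X x = Dom X y" "Cod X x = TOb X E"
    "Cod X y = TOb X E" "x \<cdot> R = y \<cdot> R" "x \<cdot> TMor X q = y \<cdot> TMor X q" for x y
    by (rule pullback_mono[OF P0]) (use that dm in auto)
  have R\<tau>: "R \<cdot> \<tau> = TMor X q \<cdot> tproj X M" using pullback_arrows(9)[OF P0] .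
  note vz = vertical_zero
  have "(tproj X E \<cdot> bzero V) \<cdot> \<tau> = TMor X q \<cdot> tproj X M"
    using vz tproj_natural[of q] by simp
  then obtain K where K: "K \<in> Mor X" "Dom X K = TOb X E" "Cod X K = TOb X E"
      "K \<cdot> R = tproj X E \<cdot> bzero V" "K \<cdot> TMor X q = TMor X q"
    using pullback_ex[OF P0, of "tproj X E \<cdot> bzero V" "TMor X q"] vz dm by auto
  have Kp: "K \<cdot> tproj X E = tproj X E"
    using extend[OF K(4), of "bproj V"] K dm vz prebundle_arrow(5)[OF vertical_prebundle] by simp
  have TK: "TMor X K \<cdot> TMor X R = TMor X (tproj X E) \<cdot> TMor X (bzero V)"
    "TMor X K \<cdot> TMor X (TMor X q) = TMor X (TMor X q)"
    using K dm vz by (simp_all flip: T_comp)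
  have Kl: "K \<cdot> tlift X E = tlift X E \<cdot> TMor X K"
  proof (rule pullback_mono[OF PT])
    show "(K \<cdot> tlift X E) \<cdot> TMor X R = (tlift X E \<cdot> TMor X K) \<cdot> TMor X R"
    proof -
      have "(K \<cdot> tlift X E) \<cdot> TMor X R = tproj X E \<cdot> (bzero V \<cdot> blift V)"
        using extend[OF K(4), of "blift V"] K dm vz vertical_lift by simp
      also have "\<dots> = tproj X E \<cdot> (tzero X E \<cdot> TMor X (bzero V))"
        using core_lift(2)[OF DB_mapD(2)[OF R]] by simp
      also have "\<dots> = (tlift X E \<cdot> TMor X K) \<cdot> TMor X R"
        using TK extend[OF core_lift(1)[OF core_tangent_bundle[of E], simplified], of "TMor X (bzero V)"]
          K dm vz by simp
      finally show ?thesis .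
    qed
    show "(K \<cdot> tlift X E) \<cdot> TMor X (TMor X q) = (tlift X E \<cdot> TMor X K) \<cdot> TMor X (TMor X q)"
      using tlift_natural[of q] TK extend[OF K(5), of "tlift X M"] K by simp
  qed (use K dm in auto)
  have KDB: "DB_map E TE K TE"
    using tangent_differential K Kp Kl by (simp add: DB_map_def linear_morphism_def)
  have IK: "\<iota> \<cdot> K = bproj V \<cdot> tzero X E"
  proof (rule mono)
    show "(\<iota> \<cdot> K) \<cdot> R = (bproj V \<cdot> tzero X E) \<cdot> R"
      using K dm vz extend[OF vertical_proj, of "bzero V"] by simp
    show "(\<iota> \<cdot> K) \<cdot> TMor X q = (bproj V \<cdot> tzero X E) \<cdot> TMor X q"
      using K tzero_natural[of q] extend[OF proj_q, of "tzero X M"] by simp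
  qed (use K in auto)
  have U: "\<And>c x y. DB_map E TE x c \<Longrightarrow> DB_map E OE y c \<Longrightarrow> \<iota> \<cdot> x = bproj V \<cdot> y \<Longrightarrow>
     (\<exists>!h. DB_map E F h c \<and> \<pi> \<cdot> h = x \<and> bzero F \<cdot> h = y)"
    using sub unfolding submersion_iff by blast
  have zT: "DB_map E OE (tzero X E) TE" using trivial_DB(2)[OF tangent_differential] by simp
  from U[OF KDB zT IK] obtain H where H: "DB_map E F H TE" and PH: "\<pi> \<cdot> H = K"
      and ZH: "bzero F \<cdot> H = tzero X E" by auto
  note dF = finsler_zero
  have dH: "H \<in> Mor X" "Dom X H = Dom X \<phi>" "Cod X H = TOb X E"
    using DB_mapD[OF H] by (simp_all add: finsler_proj)
  have idF: "DB_map E F (Id X (Dom X \<phi>)) F"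
    using finsler_differential finsler_lift by (simp add: DB_map_def linear_morphism_def finsler_proj)
  have zF: "DB_map E OE (bzero F) F"
    using trivial_DB(2)[OF finsler_differential] by (simp add: finsler_proj)
  have HP: "H \<cdot> \<pi> = Id X (Dom X \<phi>)"
  proof -
    have "\<pi> \<cdot> (H \<cdot> \<pi>) = \<pi>"
    proof (rule F_mono)
      show "(\<pi> \<cdot> (H \<cdot> \<pi>)) \<cdot> \<phi> = \<pi> \<cdot> \<phi>" "(\<pi> \<cdot> (H \<cdot> \<pi>)) \<cdot> \<sigma> = \<pi> \<cdot> \<sigma>"
        using extend[OF PH, of "tproj X E"] extend[OF PH, of "TMor X q"] dH K Kp by simp_all
    qed (use dH in auto)
    moreover have "bzero F \<cdot> (H \<cdot> \<pi>) = bzero F"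
      using DB_mapD(15)[OF DB_map_comp[OF H descent_DB]] .
    ultimately show ?thesis
      using U[OF descent_DB zF incl_descent] DB_map_comp[OF H descent_DB] idF dF
      by (metis comp_id descent(1,3))
  qed
  have zFV: "DB_map E F (\<phi> \<cdot> bzero V) V"
    using DB_map_comp[OF trivial_DB(1)[OF finsler_differential] trivial_DB(2)[OF vertical_differential]]
    by (simp add: finsler_proj)
  have zTV: "DB_map E TE (tproj X E \<cdot> bzero V) V" and zV: "DB_map E OE (bzero V) V"
    using DB_map_comp[OF trivial_DB(1)[OF tangent_differential] trivial_DB(2)[OF vertical_differential]]
      trivial_DB(2)[OF vertical_differential] by simp_all
  have HR: "H \<cdot> R = \<phi> \<cdot> bzero V"
  proof -
    have "\<iota> \<cdot> (tproj X E \<cdot> bzero V) = bproj V \<cdot> bzero V"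
      using extend[OF vertical_proj, of "bzero V"] vz by simp
    note u = U[OF zTV zV this]
    have "\<pi> \<cdot> (H \<cdot> R) = tproj X E \<cdot> bzero V" "\<pi> \<cdot> (\<phi> \<cdot> bzero V) = tproj X E \<cdot> bzero V"
      using extend[OF PH, of R] extend[OF descent(4), of "bzero V"] K dm dH vz by simp_all
    moreover have "bzero F \<cdot> (H \<cdot> R) = bzero V" "bzero F \<cdot> (\<phi> \<cdot> bzero V) = bzero V"
      using DB_mapD(15)[OF DB_map_comp[OF H R]] DB_mapD(15)[OF zFV] by simp_all
    ultimately show ?thesis using u DB_map_comp[OF H R] zFV by blast
  qed
  have "plus TE (R \<cdot> \<iota>) K = Id X (TOb X E)"
  proof -
    note par = DB_map_plus(2)[OF DB_map_comp[OF R incl_DB] KDB]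
    note pa = plus_arrow[of TE, simplified, OF par[simplified]]
    show ?thesis
    proof (rule mono)
      have "plus TE (R \<cdot> \<iota>) K \<cdot> R = plus V R (tproj X E \<cdot> bzero V)"
        using DB_map_plus_comp[OF R par] IR K dm by simp
      then show "plus TE (R \<cdot> \<iota>) K \<cdot> R = Id X (TOb X E) \<cdot> R"
        using zero_absorb(2)[OF R] dm by simp
      have "plus TE (R \<cdot> \<iota>) K \<cdot> TMor X q = plus (tangent_bundle X M) ((R \<cdot> \<iota>) \<cdot> TMor X q) (K \<cdot> TMor X q)"
        using tangent_map[of q] linear_bundle_map par by (intro plus_additive) auto
      also have "\<dots> = plus (tangent_bundle X M) (TMor X q \<cdot> (tproj X M \<cdot> tzero X M)) (TMor X q)"
        using K dm extend[OF R\<tau>, of "tzero X M"] by simp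
      also have "\<dots> = TMor X q"
        using plus_zero(1)[OF core_tangent_bundle[of M], of "TMor X q"] by simp
      finally show "plus TE (R \<cdot> \<iota>) K \<cdot> TMor X q = Id X (TOb X E) \<cdot> TMor X q" by simp
    qed (use pa dm in auto)
  qed
  then show ?thesis
    using H HP HR PH vc by (auto simp: ehresmann_iff horizontal_connection_iff)
qed

end

theorem theorem3p33:
  fixes X :: "('o, 'm) tangent_cat" and E M :: 'o and q :: 'm
  assumes "tangent_category X"
    and "q \<in> Hom X E M"
    and "tangent_display X q"
    (* the convention that all differential bundles are display, for the
       differential bundles over E occurring in the statement *)
    and "tangent_display X (bproj (tangent_bundle X E))"
    and "tangent_display X (bproj (vertical_bundle X q))"
    and "tangent_display X (bproj (finsler_bundle X q))"
  shows "(\<forall>R \<in> Hom X (TOb X E) (Vob X q).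
            full_vertical_connection X q R \<and> submersion X q \<longleftrightarrow>
            (\<exists>H. ehresmann_connection X q R H)) \<and>
         (\<forall>H \<in> Hom X (Fob X q) (TOb X E).
            full_horizontal_connection X q H \<and> submersion X q \<longleftrightarrow>
            (\<exists>R. ehresmann_connection X q R H))"
proof -
  interpret display_map X q E M
    using assms by (intro display_map.intro display_map_axioms.intro)
  show ?thesis
    using ehresmann_submersion ehresmann_full_vertical ehresmann_full_horizontal
      full_vertical_ehresmann full_horizontal_ehresmann by blast
qed

end
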